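(* Let $\theta\in(0,1)$ and let $h^0\in L^2(0,T)$. Then for every iteration index $k\ge 1$ the error $h^k$ of the continuous Dirichlet--Neumann waveform relaxation (DNWR) iteration on the time interval $(0,T)$ satisfies $$\|h^k\|_{L^2(0,T)}\le \min_{r>0}\, e^{rT}\max_{\omega\in\mathbb{R}}\left|\hat\rho(r+i\omega)\right|^k\,\|h^0\|_{L^2(0,T)},$$ where $$\hat\rho(s)=1-\theta-\theta\sqrt{\frac{\alpha_1\lambda_1}{\alpha_2\lambda_2}}\coth\left(\sqrt{\frac{\alpha_1 s}{\lambda_1}}\,a\right)\tanh\left(\sqrt{\frac{\alpha_2 s}{\lambda_2}}\,b\right),\qquad s\in\mathbb{C}.$$
   Context: Let $a,b,T>0$ and let $\alpha_j,\lambda_j>0$ ($j=1,2$) be constants (volumetric heat capacities and heat conductivities). Put $Q_1=(-a,0)\times(0,T)$ and $Q_2=(0,b)\times(0,T)$. The DNWR iteration solves two heat equations $\alpha_j\partial_t u_j-\lambda_j\partial_{xx}u_j=f_j$ in $Q_j$ with given initial data, outer Dirichlet data at $x=-a$ and $x=b$, and continuity of temperature and of heat flux at $x=0$. By linearity, its error is described by the same iteration with all sources, initial data and outer boundary data equal to zero: given the initial interface error $h^0$, for $k=0,1,2,\dots$ solve $$\alpha_1\partial_t u_1^{k+1}-\lambda_1\partial_{xx}u_1^{k+1}=0\ \text{in }Q_1,\quad u_1^{k+1}(-a,t)=0,\quad u_1^{k+1}(0,t)=h^k(t),\quad u_1^{k+1}(x,0)=0,$$ then $$\alpha_2\partial_t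 u_2^{k+1}-\lambda_2\partial_{xx}u_2^{k+1}=0\ \text{in }Q_2,\quad -\lambda_2\partial_x u_2^{k+1}(0,t)=-\lambda_1\partial_x u_1^{k+1}(0,t),\quad u_2^{k+1}(b,t)=0,\quad u_2^{k+1}(x,0)=0,$$ and update $$h^{k+1}(t)=(1-\theta)h^k(t)+\theta u_2^{k+1}(0,t),$$ where $\theta\in(0,1)$ is the relaxation parameter. The solutions are understood in the generalized sense of Lions--Magenes (Non-Homogeneous Boundary Value Problems and Applications II, Chapter 4), for which $h^k$ is well defined when $h^0\in L^2(0,T)$. In $\hat\rho$ the square roots of complex arguments are principal (all square-root branches give the same value). The symbols $\min_{r>0}$ and $\max_{\omega\in\mathbb{R}}$ are to be read as infimum and supremum when not attained. *)

theory Defs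
  imports "HOL-Analysis.Analysis"
begin

definition coth :: "'a \<Rightarrow> 'a :: {banach, real_normed_field}" where
  "coth z = cosh z / sinh z"

definition square_integrable :: "'a measure \<Rightarrow> ('a \<Rightarrow> real) \<Rightarrow> bool" where
  "square_integrable M f \<longleftrightarrow> f \<in> borel_measurable M \<and> integrable M (\<lambda>x. (f x)\<^sup>2)"

definition L2_norm :: "'a measure \<Rightarrow> ('a \<Rightarrow> real) \<Rightarrow> real" where
  "L2_norm M f = sqrt (LINT x|M. (f x)\<^sup>2)"

abbreviation time_interval :: "real \<Rightarrow> real measure" where
  "time_interval T \<equiv> lebesgue_on {0<..<T}"

abbreviation space_time :: "real \<Rightarrow> real \<Rightarrow> real \<Rightarrow> (real \<times> real) measure" where
  "space_time c d T \<equiv> lebesgue_on ({c<..<d} \<times> {0<..<T})"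

text \<open>
  Generalized solutions on \<open>(c,d) \<times> (0,T)\<close> are defined by transposition. A pair \<open>(x,t)\<close> lists
  space first. The test functions are twice continuously differentiable in \<open>x\<close> and once in \<open>t\<close>, up to
  the boundary; they vanish at the final time only, so that testing with them encodes the zero
  initial condition.
\<close>

definition test_function ::
  "real \<Rightarrow> real \<Rightarrow> real \<Rightarrow> (real \<times> real \<Rightarrow> real) \<Rightarrow> (real \<times> real \<Rightarrow> real) \<Rightarrow>
   (real \<times> real \<Rightarrow> real) \<Rightarrow> (real \<times> real \<Rightarrow> real) \<Rightarrow> bool" where
  "test_function c d T \<phi> \<phi>t \<phi>x \<phi>xx \<longleftrightarrow>
     (\<forall>f \<in> {\<phi>, \<phi>t, \<phi>x, \<phi>xx}. continuous_on ({c..d} \<times> {0..T}) f) \<and>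
     (\<forall>x \<in> {c..d}. \<forall>t \<in> {0..T}.
        ((\<lambda>\<tau>. \<phi> (x, \<tau>)) has_real_derivative \<phi>t (x, t)) (at t within {0..T}) \<and>
        ((\<lambda>\<xi>. \<phi> (\<xi>, t)) has_real_derivative \<phi>x (x, t)) (at x within {c..d}) \<and>
        ((\<lambda>\<xi>. \<phi>x (\<xi>, t)) has_real_derivative \<phi>xx (x, t)) (at x within {c..d})) \<and>
     (\<forall>x \<in> {c..d}. \<phi> (x, T) = 0)"

text \<open>
  For a smooth solution of \<open>\<alpha> u\<^sub>t = \<kappa> u\<^sub>x\<^sub>x\<close> with \<open>u (x, 0) = 0\<close>, Green's formula reads
  \<open>\<integral>\<integral> u (\<alpha> \<phi>\<^sub>t + \<kappa> \<phi>\<^sub>x\<^sub>x) = [\<integral> (q \<phi> + \<kappa> u \<phi>\<^sub>x) dt]\<close>, the bracket being the value at \<open>x = d\<close> minus the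
  value at \<open>x = c\<close>, where \<open>q = - \<kappa> u\<^sub>x\<close> is the heat flux.
  The notions below are read off from this identity. The flux of a solution whose Dirichlet
  data are merely square integrable is in general not a function, hence it is a functional \<open>q\<close>
  that acts on the boundary values of test functions.
\<close>

definition adjoint_pairing ::
  "real \<Rightarrow> real \<Rightarrow> real \<Rightarrow> real \<Rightarrow> real \<Rightarrow> (real \<times> real \<Rightarrow> real) \<Rightarrow>
   (real \<times> real \<Rightarrow> real) \<Rightarrow> (real \<times> real \<Rightarrow> real) \<Rightarrow> real" where
  "adjoint_pairing \<alpha> \<kappa> c d T u \<phi>t \<phi>xx =
     (LINT p|space_time c d T. u p * (\<alpha> * \<phi>t p + \<kappa> * \<phi>xx p))"

text \<open>Solution with \<open>u = gc\<close> at \<open>x = c\<close>, \<open>u = gd\<close> at \<open>x = d\<close>.\<close>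

definition dirichlet_solution ::
  "real \<Rightarrow> real \<Rightarrow> real \<Rightarrow> real \<Rightarrow> real \<Rightarrow> (real \<Rightarrow> real) \<Rightarrow> (real \<Rightarrow> real) \<Rightarrow>
   (real \<times> real \<Rightarrow> real) \<Rightarrow> bool" where
  "dirichlet_solution \<alpha> \<kappa> c d T gc gd u \<longleftrightarrow>
     square_integrable (space_time c d T) u \<and>
     (\<forall>\<phi> \<phi>t \<phi>x \<phi>xx. test_function c d T \<phi> \<phi>t \<phi>x \<phi>xx \<longrightarrow>
        (\<forall>t \<in> {0..T}. \<phi> (c, t) = 0 \<and> \<phi> (d, t) = 0) \<longrightarrow>
        adjoint_pairing \<alpha> \<kappa> c d T u \<phi>t \<phi>xx =
          \<kappa> * (LINT t|time_interval T. gd t * \<phi>x (d, t))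
          - \<kappa> * (LINT t|time_interval T. gc t * \<phi>x (c, t)))"

text \<open>Flux \<open>q\<close> at \<open>x = d\<close> of a solution \<open>u\<close> with Dirichlet data \<open>gc\<close> and \<open>gd\<close>.\<close>

definition right_flux ::
  "real \<Rightarrow> real \<Rightarrow> real \<Rightarrow> real \<Rightarrow> real \<Rightarrow> (real \<Rightarrow> real) \<Rightarrow> (real \<Rightarrow> real) \<Rightarrow>
   (real \<times> real \<Rightarrow> real) \<Rightarrow> ((real \<Rightarrow> real) \<Rightarrow> real) \<Rightarrow> bool" where
  "right_flux \<alpha> \<kappa> c d T gc gd u q \<longleftrightarrow>
     (\<forall>\<phi> \<phi>t \<phi>x \<phi>xx. test_function c d T \<phi> \<phi>t \<phi>x \<phi>xx \<longrightarrow>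
        (\<forall>t \<in> {0..T}. \<phi> (c, t) = 0) \<longrightarrow>
        q (\<lambda>t. \<phi> (d, t)) =
          adjoint_pairing \<alpha> \<kappa> c d T u \<phi>t \<phi>xx
          - \<kappa> * (LINT t|time_interval T. gd t * \<phi>x (d, t))
          + \<kappa> * (LINT t|time_interval T. gc t * \<phi>x (c, t)))"

text \<open>Solution with flux \<open>q\<close> at \<open>x = c\<close> and \<open>u = gd\<close> at \<open>x = d\<close>.\<close>

definition neumann_dirichlet_solution ::
  "real \<Rightarrow> real \<Rightarrow> real \<Rightarrow> real \<Rightarrow> real \<Rightarrow> ((real \<Rightarrow> real) \<Rightarrow> real) \<Rightarrow> (real \<Rightarrow> real) \<Rightarrow>
   (real \<times> real \<Rightarrow> real) \<Rightarrow> bool" where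
  "neumann_dirichlet_solution \<alpha> \<kappa> c d T q gd u \<longleftrightarrow>
     square_integrable (space_time c d T) u \<and>
     (\<forall>\<phi> \<phi>t \<phi>x \<phi>xx. test_function c d T \<phi> \<phi>t \<phi>x \<phi>xx \<longrightarrow>
        (\<forall>t \<in> {0..T}. \<phi>x (c, t) = 0 \<and> \<phi> (d, t) = 0) \<longrightarrow>
        adjoint_pairing \<alpha> \<kappa> c d T u \<phi>t \<phi>xx =
          \<kappa> * (LINT t|time_interval T. gd t * \<phi>x (d, t)) - q (\<lambda>t. \<phi> (c, t)))"

text \<open>Trace \<open>g\<close> at \<open>x = c\<close> of a solution \<open>u\<close> with flux \<open>q\<close> at \<open>x = c\<close> and Dirichlet data \<open>gd\<close>.\<close>

definition left_trace ::
  "real \<Rightarrow> real \<Rightarrow> real \<Rightarrow> real \<Rightarrow> real \<Rightarrow> ((real \<Rightarrow> real) \<Rightarrow> real) \<Rightarrow> (real \<Rightarrow> real) \<Rightarrow>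
   (real \<times> real \<Rightarrow> real) \<Rightarrow> (real \<Rightarrow> real) \<Rightarrow> bool" where
  "left_trace \<alpha> \<kappa> c d T q gd u g \<longleftrightarrow>
     square_integrable (time_interval T) g \<and>
     (\<forall>\<phi> \<phi>t \<phi>x \<phi>xx. test_function c d T \<phi> \<phi>t \<phi>x \<phi>xx \<longrightarrow>
        (\<forall>t \<in> {0..T}. \<phi> (d, t) = 0) \<longrightarrow>
        adjoint_pairing \<alpha> \<kappa> c d T u \<phi>t \<phi>xx =
          \<kappa> * (LINT t|time_interval T. gd t * \<phi>x (d, t)) - q (\<lambda>t. \<phi> (c, t))
          - \<kappa> * (LINT t|time_interval T. g t * \<phi>x (c, t)))"

text \<open>
  One step of the error iteration: \<open>q\<close> is the common interface flux
  \<open>-\<kappa>1 \<partial>\<^sub>x u1 (0, t) = -\<kappa>2 \<partial>\<^sub>x u2 (0, t)\<close> and \<open>g\<close> is \<open>u2 (0, t)\<close>. The conductivities are called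
  \<open>\<kappa>1\<close>, \<open>\<kappa>2\<close>.
\<close>

definition dnwr_step ::
  "real \<Rightarrow> real \<Rightarrow> real \<Rightarrow> real \<Rightarrow> real \<Rightarrow> real \<Rightarrow> real \<Rightarrow> real \<Rightarrow>
   (real \<Rightarrow> real) \<Rightarrow> (real \<Rightarrow> real) \<Rightarrow> bool" where
  "dnwr_step a b T \<alpha>1 \<kappa>1 \<alpha>2 \<kappa>2 \<theta> h h' \<longleftrightarrow>
     (\<exists>u1 q u2 g.
        dirichlet_solution \<alpha>1 \<kappa>1 (-a) 0 T (\<lambda>t. 0) h u1 \<and>
        right_flux \<alpha>1 \<kappa>1 (-a) 0 T (\<lambda>t. 0) h u1 q \<and>
        neumann_dirichlet_solution \<alpha>2 \<kappa>2 0 b T q (\<lambda>t. 0) u2 \<and>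
        left_trace \<alpha>2 \<kappa>2 0 b T q (\<lambda>t. 0) u2 g \<and>
        (AE t in time_interval T. h' t = (1 - \<theta>) * h t + \<theta> * g t))"

definition dnwr_symbol ::
  "real \<Rightarrow> real \<Rightarrow> real \<Rightarrow> real \<Rightarrow> real \<Rightarrow> real \<Rightarrow> real \<Rightarrow> complex \<Rightarrow> complex" where
  "dnwr_symbol a b \<alpha>1 \<kappa>1 \<alpha>2 \<kappa>2 \<theta> s =
     1 - of_real \<theta> -
     of_real \<theta> * of_real (sqrt ((\<alpha>1 * \<kappa>1) / (\<alpha>2 * \<kappa>2))) *
       coth (csqrt (of_real \<alpha>1 * s / of_real \<kappa>1) * of_real a) *
       tanh (csqrt (of_real \<alpha>2 * s / of_real \<kappa>2) * of_real b)"

end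

theory Submission
  imports Defs "HOL-Complex_Analysis.Complex_Analysis"
begin

text \<open>
  It suffices to treat one step in a weighted norm. Let \<open>M\<close> be the supremum of \<open>\<bar>\<rho>\<bar>\<close> on the line
  \<open>Re s = r\<close>, where \<open>\<rho>\<close> is the symbol. If a step from \<open>h\<close> to \<open>h'\<close> increases the \<open>L\<^sup>2(0,T)\<close>
  norm of \<open>exp (- r t) * h t\<close> at most by the factor \<open>M\<close>, then \<open>k\<close> steps cost \<open>M ^ k\<close>, removing the
  weight costs \<open>exp (r T)\<close>, and \<open>r > 0\<close> is arbitrary.

  On the half-line \<open>(0,\<infinity>)\<close> a step would be a causal convolution, and each exponential
  \<open>exp (- s t)\<close> with \<open>s > 0\<close> an eigenfunction of its adjoint with eigenvalue \<open>\<rho> s\<close>: the functions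
  \<open>exp (- s t) sinh (p x)\<close> with \<open>\<kappa> p\<^sup>2 = \<alpha> s\<close> solve the adjoint heat equation exactly. The norm
  bound for such an operator, restricted to finite sums of real exponentials
  \<open>e t = (\<Sum>i. c i * exp (- \<sigma> i t))\<close>, is an inequality between two quadratic forms in the Cauchy
  matrix \<open>1 / (\<sigma> i + \<sigma> j)\<close>, the Gram matrix of the exponentials in \<open>L\<^sup>2(0,\<infinity>)\<close>. It is the easy
  half of the Nevanlinna--Pick theorem on a half-plane, lemma \<open>Pick_inequality\<close>, and it
  follows from Cauchy's integral formula on the line \<open>Re s = r\<close>.

  On \<open>(0,T)\<close> the test functions have to vanish at time \<open>T\<close>, so the exponentials are multiplied by
  a cutoff in time that equals \<open>1\<close> up to some \<open>T' < T\<close>. The derivative of the cutoff produces two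
  space-time integrals over \<open>T' < t < T\<close>. Causality says that these should not matter for
  test functions supported in \<open>[0,T']\<close>; the quantitative form is lemma \<open>dnwr_step_defect_bound\<close>: they
  are at most a constant times the \<open>L\<^sup>2\<close> norm of the tail of \<open>e\<close> on \<open>(T',\<infinity>)\<close>. Here the Cauchy formula
  is used once more. It needs decay of the heat profile faster than \<open>\<bar>s\<bar>\<close> to the power \<open>-1/2\<close> on
  the line; the exponent \<open>-5/8\<close> is bought with a singularity \<open>\<bar>x\<bar>\<close> to the power \<open>-1/4\<close> at the
  interface, which is still square integrable.

  A continuous function supported in \<open>[0,T']\<close> is approximated by exponential sums with error
  \<open>\<epsilon> exp (- t)\<close>, by Weierstrass' theorem in the variable \<open>y = exp (- t)\<close>. The tail is then
  small, and letting \<open>\<epsilon>\<close> tend to \<open>0\<close> gives the estimate of \<open>h'\<close> against all such functions. They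
  are dense in \<open>L\<^sup>2(0,T)\<close> as \<open>T'\<close> varies, which proves the one-step bound
  (lemma \<open>dnwr_step_weighted_contraction\<close>).
\<close>

section \<open>Cauchy's integral formula in a half-plane\<close>

lemma integrable_norm_vertical_line_powr:
  fixes m p :: real
  assumes "m > 0" "p > 1"
  shows "integrable lborel (\<lambda>\<omega>. cmod (Complex m \<omega>) powr (-p))"
proof -
  let ?g = "\<lambda>x. indicator {0..} x *\<^sub>R (m + x) powr (-p)"
  have "((\<lambda>x. x powr (-p)) has_integral -(m powr (-p + 1)) / (-p + 1)) {m..}"
    using assms by (intro has_integral_powr_to_inf) auto
  then have "(\<lambda>x. x powr (-p)) absolutely_integrable_on {m..}"
    by (intro nonnegative_absolutely_integrable_1) (auto simp: integrable_on_def)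
  then have "set_integrable lborel {m..} (\<lambda>x. x powr (-p))"
    unfolding set_integrable_def
    by (subst (asm) integrable_completion) auto
  then have i0: "integrable lborel (\<lambda>x. indicator {m..} x *\<^sub>R x powr (-p))"
    unfolding set_integrable_def .
  have i1: "integrable lborel ?g"
  proof -
    have "integrable lborel (\<lambda>x. (\<lambda>x. indicator {m..} x *\<^sub>R x powr (-p)) (m + 1 * x))"
      by (rule lborel_integrable_real_affine[OF i0]) simp
    moreover have "(\<lambda>x. (\<lambda>x. indicator {m..} x *\<^sub>R x powr (-p)) (m + 1 * x)) = ?g"
      by (simp add: fun_eq_iff indicator_def)
    ultimately show ?thesis by simp
  qed
  have i2: "integrable lborel (\<lambda>x. ?g (0 + (-1) * x))"
    by (rule lborel_integrable_real_affine[OF i1]) simp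
  have i3: "integrable lborel (\<lambda>x. 2 powr p * (?g x + ?g (0 + (-1) * x)))"
    using i1 i2 by (intro integrable_mult_right Bochner_Integration.integrable_add)
  show ?thesis
  proof (rule Bochner_Integration.integrable_bound[OF i3])
    show "(\<lambda>\<omega>. cmod (Complex m \<omega>) powr - p) \<in> borel_measurable lborel"
      unfolding cmod_def by simp
    show "AE x in lborel. norm (cmod (Complex m x) powr - p) \<le> norm (2 powr p * (?g x + ?g (0 + (-1) * x)))"
    proof (rule AE_I2)
      fix x :: real
      have "m \<le> cmod (Complex m x)" "\<bar>x\<bar> \<le> cmod (Complex m x)"
        using abs_Re_le_cmod[of "Complex m x"] abs_Im_le_cmod[of "Complex m x"] assms by auto
      then have "(m + \<bar>x\<bar>) / 2 \<le> cmod (Complex m x)" by simp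
      then have "cmod (Complex m x) powr - p \<le> ((m + \<bar>x\<bar>) / 2) powr - p"
        using assms by (intro powr_mono2') auto
      also have "\<dots> = 2 powr p * (m + \<bar>x\<bar>) powr -p"
        using assms by (simp add: powr_divide powr_minus_divide)
      also have "\<dots> \<le> 2 powr p * (?g x + ?g (0 + (-1) * x))"
        by (intro mult_left_mono) (auto simp: indicator_def)
      finally show "norm (cmod (Complex m x) powr - p) \<le> norm (2 powr p * (?g x + ?g (0 + (-1) * x)))"
        by simp
    qed
  qed
qed

lemma tendsto_integral_symmetric_interval:
  fixes f :: "real \<Rightarrow> complex"
  assumes "integrable lborel f"
  shows "(\<lambda>n::nat. integral {- real n..real n} f) \<longlonglongrightarrow> (LINT x|lborel. f x)"
proof -
  have "(\<lambda>n::nat. LINT x|lborel. indicator {- real n..real n} x *\<^sub>R f x) \<longlonglongrightarrow> (LINT x|lborel. f x)"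
  proof (rule integral_dominated_convergence[where w = "\<lambda>x. norm (f x)"])
    show "AE x in lborel. (\<lambda>n. indicator {- real n..real n} x *\<^sub>R f x) \<longlonglongrightarrow> f x"
    proof (rule AE_I2, rule tendsto_eventually)
      fix x :: real
      obtain N :: nat where N: "\<bar>x\<bar> \<le> real N" using real_arch_simple by blast
      show "\<forall>\<^sub>F n in sequentially. indicator {- real n..real n} x *\<^sub>R f x = f x"
        using eventually_ge_at_top[of N] by eventually_elim (use N in \<open>auto simp: indicator_def\<close>)
    qed
  qed (use assms in \<open>auto simp: indicator_def\<close>)
  moreover have "(LINT x|lborel. indicator {- real n..real n} x *\<^sub>R f x) = integral {- real n..real n} f" for n
  proof -
    have "set_integrable lborel {- real n..real n} f"
      using assms unfolding set_integrable_def
      by (intro integrable_mult_indicator) auto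
    then have "set_lebesgue_integral lborel {- real n..real n} f = integral {- real n..real n} f"
      by (rule set_borel_integral_eq_integral)
    then show ?thesis by (simp add: set_lebesgue_integral_def)
  qed
  ultimately show ?thesis by simp
qed

text \<open>
  Cauchy's formula on the rectangle with left side from \<open>r - i n\<close> to \<open>r + i n\<close> and width \<open>n\<close>. The
  kernel is \<open>O(1/n)\<close> on the other three sides, of total length \<open>4 n\<close>, so their contribution is
  \<open>O(n powr (- \<delta>))\<close>. The left side is traversed downwards, which accounts for the sign in
  \<open>\<sigma> - \<i> \<omega>\<close>.
\<close>

lemma half_plane_Cauchy_integral_formula:
  fixes F :: "complex \<Rightarrow> complex" and r r\<^sub>0 \<sigma> C \<delta> :: real
  assumes F: "F holomorphic_on {z. Re z > r\<^sub>0}" "r\<^sub>0 < r"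
    and pos: "r > 0" "\<sigma> > 0" "\<delta> > 0"
    and bd: "\<And>z. Re z \<ge> r \<Longrightarrow> cmod (F z) \<le> C * cmod z powr (-\<delta>)"
  shows "integrable lborel (\<lambda>\<omega>. F (Complex r \<omega>) / (of_real \<sigma> - \<i> * of_real \<omega>))"
    and "(LINT \<omega>|lborel. F (Complex r \<omega>) / (of_real \<sigma> - \<i> * of_real \<omega>)) = 2 * pi * F (of_real (r + \<sigma>))"
proof -
  let ?g = "\<lambda>\<omega>. F (Complex r \<omega>) / (of_real \<sigma> - \<i> * of_real \<omega>)"
  have contF: "continuous_on {z. Re z > r\<^sub>0} F"
    using F holomorphic_on_imp_continuous_on by blast
  have C0: "C \<ge> 0"
  proof -
    have "0 \<le> C * r powr (-\<delta>)"
      using order_trans[OF norm_ge_zero bd[of "of_real r"]] pos by simp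
    then show ?thesis using pos by (simp add: zero_le_mult_iff)
  qed
  have cl: "continuous_on UNIV (\<lambda>\<omega>. Complex r \<omega>)"
    unfolding Complex_eq by (intro continuous_intros)
  have nz: "of_real \<sigma> - \<i> * of_real \<omega> \<noteq> 0" for \<omega> :: real
    using pos by (auto simp: complex_eq_iff)
  have cont: "continuous_on UNIV ?g"
    by (intro continuous_intros continuous_on_compose2[OF contF cl]) (use F nz in auto)
  let ?m = "min r \<sigma>"
  show int: "integrable lborel ?g"
  proof (rule Bochner_Integration.integrable_bound)
    show "integrable lborel (\<lambda>\<omega>. C * cmod (Complex ?m \<omega>) powr (-(1+\<delta>)))"
      using pos by (intro integrable_mult_right integrable_norm_vertical_line_powr) auto
    show "?g \<in> borel_measurable lborel"
      using cont by (simp add: borel_measurable_continuous_onI)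
    show "AE \<omega> in lborel. norm (?g \<omega>) \<le> norm (C * cmod (Complex ?m \<omega>) powr (-(1+\<delta>)))"
    proof (rule AE_I2)
      fix \<omega> :: real
      have m0: "cmod (Complex ?m \<omega>) > 0" using pos by (auto simp: complex_eq_iff min_def)
      have "cmod (Complex ?m \<omega>) \<le> cmod (of_real \<sigma> - \<i> * of_real \<omega>)"
        using pos unfolding cmod_def by (auto intro!: real_sqrt_le_mono power_mono)
      then have 1: "1 / cmod (of_real \<sigma> - \<i> * of_real \<omega>) \<le> cmod (Complex ?m \<omega>) powr (-1)"
        using m0 by (simp add: powr_minus_divide frac_le)
      have "cmod (Complex ?m \<omega>) \<le> cmod (Complex r \<omega>)"
        using pos unfolding cmod_def by (auto intro!: real_sqrt_le_mono power_mono)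
      then have "cmod (Complex r \<omega>) powr (-\<delta>) \<le> cmod (Complex ?m \<omega>) powr (-\<delta>)"
        using m0 pos by (intro powr_mono2') auto
      then have 2: "cmod (F (Complex r \<omega>)) \<le> C * cmod (Complex ?m \<omega>) powr (-\<delta>)"
        using order_trans[OF bd[of "Complex r \<omega>"] mult_left_mono[OF _ C0]] by simp
      have "norm (?g \<omega>) = cmod (F (Complex r \<omega>)) * (1 / cmod (of_real \<sigma> - \<i> * of_real \<omega>))"
        by (simp add: norm_divide)
      also have "\<dots> \<le> (C * cmod (Complex ?m \<omega>) powr (-\<delta>)) * cmod (Complex ?m \<omega>) powr (-1)"
        using 1 2 C0 by (intro mult_mono) auto
      also have "\<dots> = C * cmod (Complex ?m \<omega>) powr (-(1+\<delta>))"
      proof -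
        have e: "- (1 + \<delta>) = - \<delta> + - 1" by simp
        show ?thesis unfolding e powr_add by (simp only: mult.assoc)
      qed
      finally show "norm (?g \<omega>) \<le> norm (C * cmod (Complex ?m \<omega>) powr (-(1+\<delta>)))"
        using C0 by simp
    qed
  qed
  let ?s = "of_real (r + \<sigma>) :: complex"
  let ?f = "\<lambda>z. F z / (z - ?s)"
  let ?c = "\<lambda>n::nat. contour_integral (linepath (Complex r (-real n)) (Complex (r + real n) (-real n))) ?f
      + contour_integral (linepath (Complex (r + real n) (-real n)) (Complex (r + real n) (real n))) ?f
      + contour_integral (linepath (Complex (r + real n) (real n)) (Complex r (real n))) ?f"
  obtain N :: nat where N: "2 * (\<sigma> + 1) \<le> real N" using real_arch_simple by blast
  have nbig: "real n > \<sigma>" "real n > 0" "real n / 2 \<ge> \<sigma>" if "n \<ge> N" for n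
    using that N pos by (auto simp: field_simps)
  \<comment> \<open>The contour integral over the left side, rewritten as an integral over \<open>\<omega>\<close>.\<close>
  have rect: "?c n + \<i> * integral {- real n..real n} ?g = 2 * pi * \<i> * F ?s" if n: "n \<ge> N" for n
  proof -
    let ?a1 = "Complex r (-real n)" and ?a3 = "Complex (r + real n) (real n)"
    let ?a2 = "Complex (r + real n) (-real n)" and ?a4 = "Complex r (real n)"
    have sbox: "?s \<in> box ?a1 ?a3" using pos nbig[OF n] by (auto simp: in_box_complex_iff)
    have pim: "path_image (rectpath ?a1 ?a3) \<subseteq> {z. Re z > r\<^sub>0} - {?s}"
      using F pos nbig[OF n] sbox
      by (subst path_image_rectpath_cbox_minus_box) (auto simp: in_cbox_complex_iff)
    have "((\<lambda>w. F w / (w - ?s)) has_contour_integral (2*pi * \<i> * winding_number (rectpath ?a1 ?a3) ?s * F ?s)) (rectpath ?a1 ?a3)"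
      by (rule Cauchy_integral_formula_convex_simple[OF convex_halfspace_Re_gt F(1)])
        (use pim pos F in \<open>auto simp: interior_open open_halfspace_Re_gt\<close>)
    then have "(?f has_contour_integral (2 * pi * \<i> * F ?s)) (rectpath ?a1 ?a3)"
      using winding_number_rectpath[OF sbox] by simp
    then have tot: "contour_integral (rectpath ?a1 ?a3) ?f = 2 * pi * \<i> * F ?s" and
      ci: "?f contour_integrable_on (rectpath ?a1 ?a3)"
      by (auto simp: contour_integral_unique contour_integrable_on_def)
    have ci': "?f contour_integrable_on linepath ?a1 ?a2" "?f contour_integrable_on linepath ?a2 ?a3"
      "?f contour_integrable_on linepath ?a3 ?a4" "?f contour_integrable_on linepath ?a4 ?a1"
      using ci by (auto simp: rectpath_def Let_def)
    have sp: "contour_integral (rectpath ?a1 ?a3) ?f = ?c n + contour_integral (linepath ?a4 ?a1) ?f"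
      using ci' by (simp add: rectpath_def Let_def)
    have "contour_integral (linepath ?a4 ?a1) ?f = - contour_integral (linepath ?a1 ?a4) ?f"
      using contour_integral_reversepath[of "linepath ?a1 ?a4" ?f] by simp
    also have "contour_integral (linepath ?a1 ?a4) ?f = \<i> * integral {-real n..real n} (\<lambda>x. ?f (Complex r x))"
      using nbig[OF n] by (intro contour_integral_linepath_same_Re) auto
    also have "(\<lambda>x. ?f (Complex r x)) = (\<lambda>x. - ?g x)"
    proof
      fix x
      have "Complex r x - ?s = - (of_real \<sigma> - \<i> * of_real x)" by (simp add: complex_eq_iff)
      then show "?f (Complex r x) = - ?g x" by (metis minus_divide_right)
    qed
    finally show ?thesis using sp tot by simp
  qed
  \<comment> \<open>On the far sides both \<open>\<bar>z\<bar> \<ge> n\<close> and \<open>\<bar>z - (r + \<sigma>)\<bar> \<ge> n / 2\<close> hold.\<close>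
  have side: "cmod (contour_integral (linepath p q) ?f) \<le> 4 * C * real n powr (-\<delta>)"
    if n: "n \<ge> N" and p: "r \<le> Re p" and q: "r \<le> Re q" and l: "cmod (q - p) \<le> 2 * real n"
      and far: "\<And>z. z \<in> closed_segment p q \<Longrightarrow> Re z = r + real n \<or> \<bar>Im z\<bar> = real n" for p q n
  proof -
    note nb = nbig[OF n]
    have seg: "Re z \<ge> r" if "z \<in> closed_segment p q" for z
    proof -
      have "closed_segment p q \<subseteq> {z. Re z \<ge> r}"
        using p q by (intro closed_segment_subset convex_halfspace_Re_ge) auto
      then show ?thesis using that by auto
    qed
    have zb: "cmod z \<ge> real n" "cmod (z - ?s) \<ge> real n / 2" if z: "z \<in> closed_segment p q" for z
      using far[OF z] abs_Re_le_cmod[of z] abs_Im_le_cmod[of z] abs_Re_le_cmod[of "z - ?s"]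
        abs_Im_le_cmod[of "z - ?s"] pos nb by auto
    have cs: "continuous_on (closed_segment p q) ?f"
    proof (intro continuous_intros continuous_on_subset[OF contF])
      show "closed_segment p q \<subseteq> {z. r\<^sub>0 < Re z}" using seg F by force
      show "\<forall>z\<in>closed_segment p q. z - ?s \<noteq> 0" 
      proof
        fix z assume "z \<in> closed_segment p q"
        from zb(2)[OF this] nb(2) have "0 < cmod (z - ?s)" by linarith
          then show "z - ?s \<noteq> 0" by simp
      qed
    qed
    have "cmod (contour_integral (linepath p q) ?f) \<le> (C * real n powr (-\<delta>) * (2 / real n)) * cmod (q - p)"
    proof (rule contour_integral_bound_linepath)
      show "?f contour_integrable_on linepath p q"
        using cs by (rule contour_integrable_continuous_linepath)
      show "0 \<le> C * real n powr - \<delta> * (2 / real n)" using C0 by simp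
      fix z assume z: "z \<in> closed_segment p q"
      have "cmod (?f z) = cmod (F z) * (1 / cmod (z - ?s))" by (simp add: norm_divide)
      also have "\<dots> \<le> (C * cmod z powr (-\<delta>)) * (1 / (real n / 2))"
        using bd[OF seg[OF z]] zb[OF z] nb C0 by (intro mult_mono frac_le) auto
      also have "\<dots> \<le> (C * real n powr (-\<delta>)) * (1 / (real n / 2))"
        using zb[OF z] nb C0 pos by (intro mult_right_mono mult_left_mono powr_mono2') auto
      finally show "cmod (?f z) \<le> C * real n powr - \<delta> * (2 / real n)" by simp
    qed
    also have "\<dots> \<le> (C * real n powr (-\<delta>) * (2 / real n)) * (2 * real n)"
      using l C0 by (intro mult_left_mono) auto
    also have "\<dots> = 4 * C * real n powr (-\<delta>)" using nb by simp
    finally show ?thesis .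
  qed
  have sides: "cmod (?c n) \<le> 12 * C * real n powr (-\<delta>)" if n: "n \<ge> N" for n
  proof -
    note nb = nbig[OF n]
    have h1: "cmod (contour_integral (linepath (Complex r (-real n)) (Complex (r + real n) (-real n))) ?f) \<le> 4 * C * real n powr (-\<delta>)"
      by (rule side[OF n]) (use nb in \<open>auto simp: closed_segment_same_Im cmod_def\<close>)
    have h2: "cmod (contour_integral (linepath (Complex (r + real n) (-real n)) (Complex (r + real n) (real n))) ?f) \<le> 4 * C * real n powr (-\<delta>)"
      by (rule side[OF n]) (use nb in \<open>auto simp: closed_segment_same_Re cmod_def real_sqrt_mult\<close>)
    have h3: "cmod (contour_integral (linepath (Complex (r + real n) (real n)) (Complex r (real n))) ?f) \<le> 4 * C * real n powr (-\<delta>)"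
      by (rule side[OF n]) (use nb in \<open>auto simp: closed_segment_same_Im cmod_def\<close>)
    show ?thesis
      using norm_triangle_mono[OF norm_triangle_mono[OF h1 h2] h3] by simp
  qed
  have "(\<lambda>n. 12 * C * real n powr (-\<delta>)) \<longlonglongrightarrow> 12 * C * 0"
    using pos by (intro tendsto_mult tendsto_const tendsto_neg_powr filterlim_real_sequentially) auto
  then have g0: "(\<lambda>n. 12 * C * real n powr (-\<delta>)) \<longlonglongrightarrow> 0" by simp
  have "eventually (\<lambda>n. cmod (?c n) \<le> 12 * C * real n powr (-\<delta>)) sequentially"
    by (rule eventually_sequentiallyI[of N]) (rule sides)
  then have c0: "?c \<longlonglongrightarrow> 0"
    using g0 by (rule Lim_null_comparison)
  have "(\<lambda>n. ?c n + \<i> * integral {- real n..real n} ?g) \<longlonglongrightarrow> 0 + \<i> * (LINT \<omega>|lborel. ?g \<omega>)"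
    by (intro tendsto_intros c0 tendsto_integral_symmetric_interval int)
  moreover have "(\<lambda>n. ?c n + \<i> * integral {- real n..real n} ?g) \<longlonglongrightarrow> 2 * pi * \<i> * F ?s"
    by (rule tendsto_eventually, rule eventually_sequentiallyI[of N], rule rect)
  ultimately have "0 + \<i> * (LINT \<omega>|lborel. ?g \<omega>) = 2 * pi * \<i> * F ?s"
    using LIMSEQ_unique by blast
  then have "\<i> * (LINT \<omega>|lborel. ?g \<omega>) = \<i> * (2 * pi * F ?s)" by (simp add: algebra_simps)
  then show "(LINT \<omega>|lborel. ?g \<omega>) = 2 * pi * F ?s" by (simp only: mult_cancel_left) simp
qed

section \<open>Cauchy matrices and the Pick inequality\<close>

lemma integrable_mult_of_square_integrable:
  fixes f g :: "'a \<Rightarrow> real"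
  assumes [measurable]: "f \<in> borel_measurable M" "g \<in> borel_measurable M"
    and f: "integrable M (\<lambda>x. (f x)\<^sup>2)" and g: "integrable M (\<lambda>x. (g x)\<^sup>2)"
  shows "integrable M (\<lambda>x. f x * g x)"
proof (rule Bochner_Integration.integrable_bound)
  show "integrable M (\<lambda>x. (f x)\<^sup>2 + (g x)\<^sup>2)" using f g by simp
  show "AE x in M. norm (f x * g x) \<le> norm ((f x)\<^sup>2 + (g x)\<^sup>2)"
  proof (rule AE_I2)
    fix x
    have "2 * (\<bar>f x\<bar> * \<bar>g x\<bar>) \<le> (f x)\<^sup>2 + (g x)\<^sup>2"
      using sum_squares_bound[of "\<bar>f x\<bar>" "\<bar>g x\<bar>"] by simp
    moreover have "0 \<le> \<bar>f x\<bar> * \<bar>g x\<bar>" by simp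
    ultimately have "\<bar>f x\<bar> * \<bar>g x\<bar> \<le> (f x)\<^sup>2 + (g x)\<^sup>2" by linarith
    then show "norm (f x * g x) \<le> norm ((f x)\<^sup>2 + (g x)\<^sup>2)" by (simp add: abs_mult)
  qed
qed simp

text \<open>
  The quadratic polynomial \<open>\<integral> (t f + g)\<^sup>2\<close> in \<open>t\<close> is nonnegative; it is evaluated at its minimum.
\<close>

lemma integral_Cauchy_Schwarz:
  fixes f g :: "'a \<Rightarrow> real"
  assumes m: "f \<in> borel_measurable M" "g \<in> borel_measurable M"
    and f: "integrable M (\<lambda>x. (f x)\<^sup>2)" and g: "integrable M (\<lambda>x. (g x)\<^sup>2)"
  shows "\<bar>LINT x|M. f x * g x\<bar> \<le> sqrt (LINT x|M. (f x)\<^sup>2) * sqrt (LINT x|M. (g x)\<^sup>2)"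
proof -
  let ?A = "LINT x|M. (f x)\<^sup>2" and ?B = "LINT x|M. f x * g x" and ?C = "LINT x|M. (g x)\<^sup>2"
  have fg: "integrable M (\<lambda>x. f x * g x)"
    by (rule integrable_mult_of_square_integrable) fact+
  have A0: "?A \<ge> 0" and C0: "?C \<ge> 0" by (auto intro: integral_nonneg_AE)
  have quad: "0 \<le> t\<^sup>2 * ?A + 2 * t * ?B + ?C" for t
  proof -
    have "0 \<le> (LINT x|M. (t * f x + g x)\<^sup>2)" by (rule integral_nonneg_AE) simp
    also have "(LINT x|M. (t * f x + g x)\<^sup>2) = (LINT x|M. t\<^sup>2 * (f x)\<^sup>2 + (2 * t * (f x * g x) + (g x)\<^sup>2))"
      by (intro Bochner_Integration.integral_cong) (auto simp: power2_eq_square algebra_simps)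
    also have "\<dots> = t\<^sup>2 * ?A + (2 * t * ?B + ?C)" using f g fg by simp
    finally show ?thesis by simp
  qed
  have "?B\<^sup>2 \<le> ?A * ?C"
  proof (cases "?A = 0")
    case True
    then have "AE x in M. (f x)\<^sup>2 = 0"
      using f by (subst (asm) integral_nonneg_eq_0_iff_AE) auto
    then have "AE x in M. f x * g x = 0" by auto
    then have "?B = 0" by (rule integral_eq_zero_AE)
    then show ?thesis using True by simp
  next
    case False
    then have A: "?A > 0" using A0 by linarith
    have "0 \<le> (- ?B / ?A)\<^sup>2 * ?A + 2 * (- ?B / ?A) * ?B + ?C" by (rule quad)
    also have "\<dots> = ?C - ?B\<^sup>2 / ?A" using A by (simp add: field_simps power2_eq_square)
    finally show ?thesis using A by (simp add: field_simps)
  qed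
  then have "sqrt (?B\<^sup>2) \<le> sqrt (?A * ?C)" by (rule real_sqrt_le_mono)
  then show ?thesis by (simp add: real_sqrt_mult)
qed

text \<open>
  The squared norm of \<open>\<Sum>i\<in>I. c i * exp (- \<sigma> i t)\<close> in \<open>L\<^sup>2(0,\<infinity>)\<close>, in closed form.
\<close>

definition cauchy_form :: "'i set \<Rightarrow> ('i \<Rightarrow> real) \<Rightarrow> ('i \<Rightarrow> real) \<Rightarrow> real" where
  "cauchy_form I \<sigma> c = (\<Sum>i\<in>I. \<Sum>j\<in>I. c i * c j / (\<sigma> i + \<sigma> j))"

text \<open>
  Kernels \<open>1 / (z - r + \<sigma>)\<close> are compared with \<open>1 / \<bar>z\<bar>\<close>, the decay that the half-plane formula
  is stated with.
\<close>

lemma cmod_shifted_ge: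
  assumes "r > 0" "\<sigma> > 0" "Re z \<ge> r"
  shows "cmod z * min 1 (\<sigma> / r) \<le> cmod (z - of_real r + of_real \<sigma>)"
proof -
  let ?m = "min 1 (\<sigma> / r)"
  have m: "0 \<le> ?m" "?m \<le> 1" using assms by auto
  have "r * ?m \<le> \<sigma>" using assms by (simp add: min_def field_simps)
  moreover have "(Re z - r) * ?m \<le> (Re z - r) * 1"
    using assms m by (intro mult_left_mono) auto
  ultimately have "Re z * ?m \<le> Re z - r + \<sigma>" by (simp add: algebra_simps)
  moreover have "0 \<le> Re z * ?m" using assms m by (intro mult_nonneg_nonneg) linarith+
  ultimately have 1: "(Re z * ?m)\<^sup>2 \<le> (Re z - r + \<sigma>)\<^sup>2" by (rule power_mono)
  have "\<bar>Im z * ?m\<bar> \<le> \<bar>Im z\<bar>" using m by (simp add: abs_mult mult_left_le)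
  then have "(Im z * ?m)\<^sup>2 \<le> (Im z)\<^sup>2" by (simp add: abs_le_square_iff)
  with 1 have "sqrt ((Re z * ?m)\<^sup>2 + (Im z * ?m)\<^sup>2) \<le> cmod (z - of_real r + of_real \<sigma>)"
    unfolding cmod_def by (intro real_sqrt_le_mono) (simp add: add_mono)
  moreover have "(Re z * ?m)\<^sup>2 + (Im z * ?m)\<^sup>2 = ((Re z)\<^sup>2 + (Im z)\<^sup>2) * ?m\<^sup>2"
    by (simp add: power_mult_distrib distrib_right)
  ultimately show ?thesis using m by (simp add: real_sqrt_mult cmod_def)
qed

lemma cmod_inverse_shifted_le:
  assumes "r > 0" "\<sigma> > 0" "Re z \<ge> r"
  shows "cmod (1 / (z - of_real r + of_real \<sigma>)) \<le> (1 / min 1 (\<sigma> / r)) * cmod z powr (-1)"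
proof -
  have z: "cmod z > 0" using assms by auto
  have m: "0 < min 1 (\<sigma> / r)" using assms by auto
  have "1 / cmod (z - of_real r + of_real \<sigma>) \<le> 1 / (cmod z * min 1 (\<sigma> / r))"
    using cmod_shifted_ge[OF assms] m z by (intro frac_le) auto
  then show ?thesis using z by (simp add: norm_divide powr_minus_divide mult.commute)
qed

text \<open>
  The half-plane formula for \<open>F z = 1 / (z - 1 + \<tau>)\<close> on the line \<open>Re z = 1\<close>, evaluated at
  \<open>z = 1 + \<sigma>\<close>.
\<close>

lemma integral_kernel_product:
  assumes "\<sigma> > 0" "\<tau> > (0::real)"
  shows "integrable lborel (\<lambda>\<omega>. 1 / ((of_real \<tau> + \<i> * of_real \<omega>) * (of_real \<sigma> - \<i> * of_real \<omega>)))"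
    and "(LINT \<omega>|lborel. 1 / ((of_real \<tau> + \<i> * of_real \<omega>) * (of_real \<sigma> - \<i> * of_real \<omega>))) =
      complex_of_real (2 * pi / (\<sigma> + \<tau>))"
proof -
  let ?F = "\<lambda>z::complex. 1 / (z - of_real 1 + of_real \<tau>)"
  have hol: "?F holomorphic_on {z. Re z > 1 - \<tau>}"
    by (intro holomorphic_intros) (auto simp: complex_eq_iff)
  have e: "?F (Complex 1 \<omega>) / (of_real \<sigma> - \<i> * of_real \<omega>) = 1 / ((of_real \<tau> + \<i> * of_real \<omega>) * (of_real \<sigma> - \<i> * of_real \<omega>))"
    for \<omega> :: real by (simp add: Complex_eq add.commute)
  note C = half_plane_Cauchy_integral_formula[OF hol _ zero_less_one assms(1) zero_less_one cmod_inverse_shifted_le[OF zero_less_one assms(2)]]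
  show "integrable lborel (\<lambda>\<omega>. 1 / ((of_real \<tau> + \<i> * of_real \<omega>) * (of_real \<sigma> - \<i> * of_real \<omega>)))"
    unfolding e[symmetric] using C(1) assms by simp
  show "(LINT \<omega>|lborel. 1 / ((of_real \<tau> + \<i> * of_real \<omega>) * (of_real \<sigma> - \<i> * of_real \<omega>))) =
      complex_of_real (2 * pi / (\<sigma> + \<tau>))"
    unfolding e[symmetric] using C(2) assms by simp
qed

lemma kernel_sum_square_expansion:
  fixes c \<sigma> :: "'i \<Rightarrow> real"
  shows "complex_of_real ((cmod (\<Sum>i\<in>I. of_real (c i) / (of_real (\<sigma> i) - \<i> * of_real \<omega>)))\<^sup>2) =
    (\<Sum>i\<in>I. \<Sum>j\<in>I. of_real (c i * c j) * (1 / ((of_real (\<sigma> i) + \<i> * of_real \<omega>) * (of_real (\<sigma> j) - \<i> * of_real \<omega>))))"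
proof -
  let ?k = "\<Sum>i\<in>I. of_real (c i) / (of_real (\<sigma> i) - \<i> * of_real \<omega>)"
  have "complex_of_real ((cmod ?k)\<^sup>2) = cnj ?k * ?k" by (simp only: complex_norm_square mult.commute)
  also have "cnj ?k = (\<Sum>i\<in>I. of_real (c i) / (of_real (\<sigma> i) + \<i> * of_real \<omega>))" by simp
  also have "\<dots> * ?k = (\<Sum>i\<in>I. \<Sum>j\<in>I. of_real (c i * c j) * (1 / ((of_real (\<sigma> i) + \<i> * of_real \<omega>) * (of_real (\<sigma> j) - \<i> * of_real \<omega>))))"
    by (simp add: sum_product)
  finally show ?thesis .
qed

text \<open>
  Plancherel's identity for an exponential sum: \<open>1 / (\<sigma> - \<i> \<omega>)\<close> is the Fourier transform of
  \<open>exp (- \<sigma> t)\<close> on \<open>(0,\<infinity>)\<close>, up to the sign convention for \<open>\<omega>\<close>.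
\<close>

lemma integral_kernel_sum_square:
  fixes c \<sigma> :: "'i \<Rightarrow> real"
  assumes I: "finite I" "\<forall>i\<in>I. \<sigma> i > 0"
  shows "integrable lborel (\<lambda>\<omega>. (cmod (\<Sum>i\<in>I. of_real (c i) / (of_real (\<sigma> i) - \<i> * of_real \<omega>)))\<^sup>2)"
    and "(LINT \<omega>|lborel. (cmod (\<Sum>i\<in>I. of_real (c i) / (of_real (\<sigma> i) - \<i> * of_real \<omega>)))\<^sup>2)
      = 2 * pi * cauchy_form I \<sigma> c"
proof -
  define k where "k = (\<lambda>\<omega>. \<Sum>i\<in>I. complex_of_real (c i) / (of_real (\<sigma> i) - \<i> * of_real \<omega>))"
  define p where "p = (\<lambda>i j \<omega>. complex_of_real (c i * c j) * (1 / ((of_real (\<sigma> i) + \<i> * of_real \<omega>) * (of_real (\<sigma> j) - \<i> * of_real \<omega>))))"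
  have e: "complex_of_real ((cmod (k \<omega>))\<^sup>2) = (\<Sum>i\<in>I. \<Sum>j\<in>I. p i j \<omega>)" for \<omega>
    unfolding k_def p_def by (rule kernel_sum_square_expansion)
  have i: "integrable lborel (p i j)" if "i \<in> I" "j \<in> I" for i j
    unfolding p_def by (intro integrable_mult_right integral_kernel_product(1)) (use I that in auto)
  have int: "integrable lborel (\<lambda>\<omega>. complex_of_real ((cmod (k \<omega>))\<^sup>2))"
    unfolding e by (intro Bochner_Integration.integrable_sum i)
  then have "integrable lborel (\<lambda>\<omega>. (cmod (k \<omega>))\<^sup>2)"
    by (simp only: complex_of_real_integrable_eq)
  then show "integrable lborel (\<lambda>\<omega>. (cmod (\<Sum>i\<in>I. of_real (c i) / (of_real (\<sigma> i) - \<i> * of_real \<omega>)))\<^sup>2)"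
    by (simp only: k_def)
  have "complex_of_real (LINT \<omega>|lborel. (cmod (k \<omega>))\<^sup>2) = (LINT \<omega>|lborel. complex_of_real ((cmod (k \<omega>))\<^sup>2))"
    by (rule integral_complex_of_real[symmetric])
  also have "\<dots> = (\<Sum>i\<in>I. \<Sum>j\<in>I. (LINT \<omega>|lborel. p i j \<omega>))"
    unfolding e by (simp add: Bochner_Integration.integral_sum i Bochner_Integration.integrable_sum del: of_real_mult)
  also have "\<dots> = (\<Sum>i\<in>I. \<Sum>j\<in>I. of_real (c i * c j) * complex_of_real (2 * pi / (\<sigma> j + \<sigma> i)))"
    unfolding p_def integral_mult_right_zero
    by (intro sum.cong refl arg_cong2[of _ _ _ _ "(*)"] integral_kernel_product(2)) (use I in auto)
  also have "\<dots> = of_real (2 * pi * cauchy_form I \<sigma> c)"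
    by (simp add: cauchy_form_def sum_distrib_left add.commute mult_ac)
  finally show "(LINT \<omega>|lborel. (cmod (\<Sum>i\<in>I. of_real (c i) / (of_real (\<sigma> i) - \<i> * of_real \<omega>)))\<^sup>2)
      = 2 * pi * cauchy_form I \<sigma> c"
    unfolding k_def of_real_eq_iff .
qed

lemma cauchy_form_nonneg:
  assumes "finite I" "\<forall>i\<in>I. \<sigma> i > 0"
  shows "0 \<le> cauchy_form I \<sigma> c"
proof -
  have "0 \<le> 2 * pi * cauchy_form I \<sigma> c"
    unfolding integral_kernel_sum_square(2)[where \<sigma> = \<sigma> and c = c, OF assms, symmetric]
    by (rule integral_nonneg_AE) simp
  then show ?thesis using pi_gt_zero by (auto simp: zero_le_mult_iff)
qed

lemma square_integrable_on_vertical_line: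
  fixes F :: "complex \<Rightarrow> complex"
  assumes F: "F holomorphic_on {z. Re z > r\<^sub>0}" "r\<^sub>0 < r"
    and pos: "r > 0" "\<delta> > 1 / 2"
    and bd: "\<And>z. Re z \<ge> r \<Longrightarrow> cmod (F z) \<le> C * cmod z powr (-\<delta>)"
  shows "(\<lambda>\<omega>. F (Complex r \<omega>)) \<in> borel_measurable lborel"
    and "integrable lborel (\<lambda>\<omega>. (cmod (F (Complex r \<omega>)))\<^sup>2)"
    and "(LINT \<omega>|lborel. (cmod (F (Complex r \<omega>)))\<^sup>2) \<le> C\<^sup>2 * (LINT \<omega>|lborel. cmod (Complex r \<omega>) powr (-(2 * \<delta>)))"
proof -
  have cl: "continuous_on UNIV (\<lambda>\<omega>. Complex r \<omega>)"
    unfolding Complex_eq by (intro continuous_intros)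
  have "continuous_on UNIV (\<lambda>\<omega>. F (Complex r \<omega>))"
    by (rule continuous_on_compose2[OF holomorphic_on_imp_continuous_on[OF F(1)] cl]) (use F in auto)
  then show m[measurable]: "(\<lambda>\<omega>. F (Complex r \<omega>)) \<in> borel_measurable lborel"
    by (simp add: borel_measurable_continuous_onI)
  have i: "integrable lborel (\<lambda>\<omega>. C\<^sup>2 * cmod (Complex r \<omega>) powr (-(2 * \<delta>)))"
    using pos by (intro integrable_mult_right integrable_norm_vertical_line_powr) auto
  have b: "(cmod (F (Complex r \<omega>)))\<^sup>2 \<le> C\<^sup>2 * cmod (Complex r \<omega>) powr (-(2 * \<delta>))" for \<omega>
  proof -
    have "(cmod (F (Complex r \<omega>)))\<^sup>2 \<le> (C * cmod (Complex r \<omega>) powr (-\<delta>))\<^sup>2"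
      using bd[of "Complex r \<omega>"] by (intro power_mono) auto
    also have "\<dots> = C\<^sup>2 * cmod (Complex r \<omega>) powr (-(2 * \<delta>))"
      by (simp add: power_mult_distrib power2_eq_square powr_add[symmetric])
    finally show ?thesis .
  qed
  show i2: "integrable lborel (\<lambda>\<omega>. (cmod (F (Complex r \<omega>)))\<^sup>2)"
    by (rule Bochner_Integration.integrable_bound[OF i]) (use b in \<open>auto simp: abs_le_iff intro: order_trans[OF b]\<close>)
  have "(LINT \<omega>|lborel. (cmod (F (Complex r \<omega>)))\<^sup>2) \<le> (LINT \<omega>|lborel. C\<^sup>2 * cmod (Complex r \<omega>) powr (-(2 * \<delta>)))"
    by (rule integral_mono[OF i2 i b])
  then show "(LINT \<omega>|lborel. (cmod (F (Complex r \<omega>)))\<^sup>2) \<le> C\<^sup>2 * (LINT \<omega>|lborel. cmod (Complex r \<omega>) powr (-(2 * \<delta>)))"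
    by simp
qed

text \<open>
  The functional \<open>F \<mapsto> \<Sum>i. c i * F (r + \<sigma> i)\<close> is bounded on the Hardy space of the half-plane
  \<open>Re z > r\<close>, with norm given by the Cauchy form of \<open>c\<close>: by the Cauchy formula it is the pairing on
  the line of \<open>F\<close> with a sum of kernels, whose norm is known from Plancherel. The condition
  \<open>\<delta> > 1 / 2\<close> makes \<open>F\<close> square integrable on the line.
\<close>

lemma half_plane_point_values_le:
  fixes F :: "complex \<Rightarrow> complex" and c \<sigma> :: "'i \<Rightarrow> real"
  assumes I: "finite I" "\<forall>i\<in>I. \<sigma> i > 0"
    and F: "F holomorphic_on {z. Re z > r\<^sub>0}" "r\<^sub>0 < r"
    and pos: "r > 0" "\<delta> > 1 / 2"
    and bd: "\<And>z. Re z \<ge> r \<Longrightarrow> cmod (F z) \<le> C * cmod z powr (-\<delta>)"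
  shows "2 * pi * (cmod (\<Sum>i\<in>I. of_real (c i) * F (of_real (r + \<sigma> i))))\<^sup>2
    \<le> (LINT \<omega>|lborel. (cmod (F (Complex r \<omega>)))\<^sup>2) * cauchy_form I \<sigma> c"
proof -
  let ?k = "\<lambda>\<omega>. \<Sum>i\<in>I. of_real (c i) / (of_real (\<sigma> i) - \<i> * of_real \<omega>)"
  let ?S = "\<Sum>i\<in>I. of_real (c i) * F (of_real (r + \<sigma> i))"
  let ?N = "LINT \<omega>|lborel. (cmod (F (Complex r \<omega>)))\<^sup>2"
  note [measurable] = square_integrable_on_vertical_line(1)[OF F pos bd]
  have nF: "integrable lborel (\<lambda>\<omega>. (cmod (F (Complex r \<omega>)))\<^sup>2)"
    by (rule square_integrable_on_vertical_line(2)[OF F pos bd])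
  have d0: "\<delta> > 0" using pos by simp
  note Cf = half_plane_Cauchy_integral_formula[OF F pos(1) bspec[OF I(2)] d0 bd]
  define G where "G = (\<lambda>i \<omega>. F (Complex r \<omega>) / (of_real (\<sigma> i) - \<i> * of_real \<omega>))"
  have G: "integrable lborel (G i)" "(LINT \<omega>|lborel. G i \<omega>) = 2 * pi * F (of_real (r + \<sigma> i))" if "i \<in> I" for i
    unfolding G_def using Cf[OF that] by auto
  have "2 * pi * ?S = (\<Sum>i\<in>I. of_real (c i) * (LINT \<omega>|lborel. G i \<omega>))"
    by (simp add: G(2) sum_distrib_left mult_ac)
  also have "\<dots> = (LINT \<omega>|lborel. (\<Sum>i\<in>I. of_real (c i) * G i \<omega>))"
    by (simp add: Bochner_Integration.integral_sum G(1))
  also have "\<dots> = (LINT \<omega>|lborel. F (Complex r \<omega>) * ?k \<omega>)"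
    by (simp add: G_def sum_distrib_left mult_ac)
  finally have S: "2 * pi * ?S = (LINT \<omega>|lborel. F (Complex r \<omega>) * ?k \<omega>)" .
  have km: "?k \<in> borel_measurable lborel" by measurable
  have "cmod (2 * pi * ?S) \<le> (LINT \<omega>|lborel. cmod (F (Complex r \<omega>)) * cmod (?k \<omega>))"
    unfolding S using integral_norm_bound[of lborel "\<lambda>\<omega>. F (Complex r \<omega>) * ?k \<omega>"] by (simp add: norm_mult)
  also have "\<dots> \<le> sqrt ?N * sqrt (LINT \<omega>|lborel. (cmod (?k \<omega>))\<^sup>2)"
    using integral_kernel_sum_square(1)[where \<sigma> = \<sigma> and c = c, OF I] nF
    by (intro order_trans[OF abs_ge_self integral_Cauchy_Schwarz]) auto
  also have "\<dots> = sqrt (?N * (2 * pi * cauchy_form I \<sigma> c))"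
    unfolding integral_kernel_sum_square(2)[where \<sigma> = \<sigma> and c = c, OF I] by (simp add: real_sqrt_mult)
  finally have "(cmod (2 * pi * ?S))\<^sup>2 \<le> (sqrt (?N * (2 * pi * cauchy_form I \<sigma> c)))\<^sup>2"
    by (rule power_mono) simp
  also have "\<dots> = ?N * (2 * pi * cauchy_form I \<sigma> c)"
    using cauchy_form_nonneg[of I \<sigma> c] I
    by (intro real_sqrt_pow2 mult_nonneg_nonneg integral_nonneg_AE) auto
  finally have "(2 * pi) * (2 * pi * (cmod ?S)\<^sup>2) \<le> (2 * pi) * (?N * cauchy_form I \<sigma> c)"
    by (simp add: norm_mult power_mult_distrib power2_eq_square mult_ac)
  then show ?thesis by (rule mult_left_le_imp_le) simp
qed

text \<open>
  Multiplication by \<open>f\<close> has norm at most \<open>M\<close> on the Hardy space, and its adjoint multiplies the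
  kernel of the point \<open>r + \<sigma> i\<close> by \<open>p i\<close>. Concretely, with \<open>d i = c i * p i\<close> and the kernel sum
  \<open>G z = \<Sum>i. d i / (z - r + \<sigma> i)\<close>, the point values of \<open>f G\<close> paired with \<open>c\<close> give the Cauchy form
  \<open>Q d\<close>. Lemma \<open>half_plane_point_values_le\<close> bounds its square by \<open>M\<^sup>2 * Q d * Q c\<close>, and one factor
  \<open>Q d\<close> cancels.
  The norm estimate takes place on the line, where \<open>M\<close> is the bound; \<open>B\<close> controls the contour at
  infinity.
\<close>

lemma Pick_inequality:
  fixes f :: "complex \<Rightarrow> complex" and c \<sigma> p :: "'i \<Rightarrow> real"
  assumes I: "finite I" "\<forall>i\<in>I. \<sigma> i > 0"
    and f: "f holomorphic_on {z. Re z > r\<^sub>0}" "r\<^sub>0 < r" and r: "r > 0"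
    and bd: "\<And>z. Re z \<ge> r \<Longrightarrow> cmod (f z) \<le> B"
    and M: "\<And>\<omega>. cmod (f (Complex r \<omega>)) \<le> M"
    and p: "\<And>i. i \<in> I \<Longrightarrow> f (of_real (r + \<sigma> i)) = of_real (p i)"
  shows "cauchy_form I \<sigma> (\<lambda>i. c i * p i) \<le> M\<^sup>2 * cauchy_form I \<sigma> c"
proof -
  let ?d = "\<lambda>i. c i * p i"
  let ?Q = "cauchy_form I \<sigma>"
  let ?G = "\<lambda>z::complex. \<Sum>i\<in>I. of_real (?d i) * (1 / (z - of_real r + of_real (\<sigma> i)))"
  let ?F = "\<lambda>z. f z * ?G z"
  let ?k = "\<lambda>\<omega>. \<Sum>i\<in>I. of_real (?d i) / (of_real (\<sigma> i) - \<i> * of_real \<omega>)"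
  \<comment> \<open>The poles \<open>r - \<sigma> i\<close> of the kernels lie to the left of the line, but not necessarily
      left of \<open>r\<^sub>0\<close>.\<close>
  define r1 where "r1 = Max (insert r\<^sub>0 ((\<lambda>i. r - \<sigma> i) ` I))"
  have r1: "r1 < r" "r\<^sub>0 \<le> r1" "\<And>i. i \<in> I \<Longrightarrow> r - \<sigma> i \<le> r1"
    unfolding r1_def using I f by auto
  have hF: "?F holomorphic_on {z. Re z > r1}"
  proof (intro holomorphic_intros holomorphic_on_subset[OF f(1)])
    show "z - of_real r + of_real (\<sigma> i) \<noteq> 0" if "i \<in> I" "z \<in> {z. Re z > r1}" for i z
      using r1(3)[OF that(1)] that(2) by (auto simp: complex_eq_iff)
  qed (use r1 in auto)
  have B0: "B \<ge> 0" using bd[of "of_real r"] order_trans[OF norm_ge_zero] by fastforce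
  let ?C = "B * (\<Sum>i\<in>I. \<bar>?d i\<bar> * (1 / min 1 (\<sigma> i / r)))"
  have bF: "cmod (?F z) \<le> ?C * cmod z powr (-1)" if z: "Re z \<ge> r" for z
  proof -
    have "cmod (?G z) \<le> (\<Sum>i\<in>I. cmod (of_real (?d i) * (1 / (z - of_real r + of_real (\<sigma> i)))))"
      by (rule norm_sum)
    also have "\<dots> \<le> (\<Sum>i\<in>I. \<bar>?d i\<bar> * ((1 / min 1 (\<sigma> i / r)) * cmod z powr (-1)))"
      unfolding norm_mult norm_of_real
      by (intro sum_mono mult_left_mono cmod_inverse_shifted_le) (use r I z in auto)
    finally have "cmod (?G z) \<le> (\<Sum>i\<in>I. \<bar>?d i\<bar> * (1 / min 1 (\<sigma> i / r))) * cmod z powr (-1)"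
      by (simp only: sum_distrib_right mult.assoc)
    then have "cmod (?F z) \<le> B * ((\<Sum>i\<in>I. \<bar>?d i\<bar> * (1 / min 1 (\<sigma> i / r))) * cmod z powr (-1))"
      unfolding norm_mult using bd[OF z] B0 by (intro mult_mono) auto
    then show ?thesis by (simp only: mult.assoc)
  qed
  have "(\<Sum>i\<in>I. of_real (c i) * ?F (of_real (r + \<sigma> i))) = (\<Sum>i\<in>I. of_real (c i) * (of_real (p i) * (\<Sum>j\<in>I. of_real (?d j / (\<sigma> i + \<sigma> j)))))"
    by (intro sum.cong refl) (simp add: p del: of_real_add, simp)
  also have "\<dots> = of_real (?Q ?d)"
    by (simp add: cauchy_form_def sum_distrib_left mult_ac)
  finally have S: "(\<Sum>i\<in>I. of_real (c i) * ?F (of_real (r + \<sigma> i))) = of_real (?Q ?d)" .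
  have M0: "M \<ge> 0" using M[of 0] norm_ge_zero order_trans by blast
  have "2 * pi * (?Q ?d)\<^sup>2 \<le> (LINT \<omega>|lborel. (cmod (?F (Complex r \<omega>)))\<^sup>2) * ?Q c"
    using half_plane_point_values_le[where \<sigma> = \<sigma> and c = c, OF I hF r1(1) r _ bF] unfolding S by simp
  also have "\<dots> \<le> (LINT \<omega>|lborel. M\<^sup>2 * (cmod (?k \<omega>))\<^sup>2) * ?Q c"
  proof (intro mult_right_mono integral_mono)
    show "integrable lborel (\<lambda>\<omega>. (cmod (?F (Complex r \<omega>)))\<^sup>2)"
      by (rule square_integrable_on_vertical_line(2)[OF hF r1(1) r _ bF]) auto
    show "integrable lborel (\<lambda>\<omega>. M\<^sup>2 * (cmod (?k \<omega>))\<^sup>2)"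
      by (intro integrable_mult_right integral_kernel_sum_square(1)[OF I])
    fix \<omega> :: real
    have "?G (Complex r \<omega>) = cnj (?k \<omega>)" by (simp add: Complex_eq add.commute)
    then have "cmod (?G (Complex r \<omega>)) = cmod (?k \<omega>)" by (simp only: complex_mod_cnj)
    then show "(cmod (?F (Complex r \<omega>)))\<^sup>2 \<le> M\<^sup>2 * (cmod (?k \<omega>))\<^sup>2"
      unfolding norm_mult power_mult_distrib using M[of \<omega>] by (intro mult_mono power_mono) auto
  qed (use cauchy_form_nonneg[where \<sigma> = \<sigma>, OF I] in auto)
  also have "\<dots> = 2 * pi * (M\<^sup>2 * ?Q ?d * ?Q c)"
    by (simp only: integral_mult_right_zero integral_kernel_sum_square(2)[where \<sigma> = \<sigma> and c = ?d, OF I] mult_ac)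
  finally have "(?Q ?d)\<^sup>2 \<le> M\<^sup>2 * ?Q ?d * ?Q c" by simp
  then have "?Q ?d * ?Q ?d \<le> ?Q ?d * (M\<^sup>2 * ?Q c)" by (simp add: power2_eq_square mult_ac)
  moreover have "?Q ?d \<ge> 0" "?Q c \<ge> 0" using cauchy_form_nonneg[where \<sigma> = \<sigma>, OF I] by auto
  ultimately show ?thesis by (cases "?Q ?d = 0") (auto simp: mult_le_cancel_left)
qed

section \<open>Hyperbolic functions of the heat roots\<close>

lemma sinh_Re_le_cmod_sinh: "sinh (Re z) \<le> cmod (sinh z)"
proof -
  have "cmod (exp z) - cmod (exp (-z)) \<le> cmod (exp z - exp (-z))" by (rule norm_triangle_ineq2)
  then show ?thesis by (simp add: sinh_field_def norm_divide divide_right_mono)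
qed

lemma sinh_Re_le_cmod_cosh: "sinh (Re z) \<le> cmod (cosh z)"
proof -
  have "cmod (exp z) - cmod (exp (-z)) \<le> cmod (exp z + exp (-z))" by (rule norm_diff_ineq)
  then show ?thesis by (simp add: sinh_field_def cosh_field_def norm_divide divide_right_mono)
qed

lemma cmod_sinh_le_cosh_Re: "cmod (sinh z) \<le> cosh (Re z)"
proof -
  have "cmod (exp z - exp (-z)) \<le> cmod (exp z) + cmod (exp (-z))" by (rule norm_triangle_ineq4)
  then show ?thesis by (simp add: sinh_field_def cosh_field_def norm_divide divide_right_mono)
qed

lemma cmod_cosh_le_cosh_Re: "cmod (cosh z) \<le> cosh (Re z)"
proof -
  have "cmod (exp z + exp (-z)) \<le> cmod (exp z) + cmod (exp (-z))" by (rule norm_triangle_ineq)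
  then show ?thesis by (simp add: cosh_field_def norm_divide divide_right_mono)
qed

lemma cosh_over_sinh_le:
  fixes x c :: real
  assumes "0 < c" "c \<le> x"
  shows "cosh x / sinh x \<le> 1 / tanh c"
proof -
  have "cosh x / sinh x = 1 / tanh x" by (simp add: tanh_def)
  also have "\<dots> \<le> 1 / tanh c" using assms by (intro divide_left_mono) (auto simp: zero_less_mult_iff)
  finally show ?thesis .
qed

lemma sinh_nonzero_right_half_plane: "Re z > 0 \<Longrightarrow> sinh z \<noteq> 0"
  using sinh_Re_le_cmod_sinh[of z] by (auto simp: not_le[symmetric])

lemma cosh_nonzero_right_half_plane: "Re z > 0 \<Longrightarrow> cosh z \<noteq> 0"
  using sinh_Re_le_cmod_cosh[of z] by (auto simp: not_le[symmetric])

lemma cmod_coth_le: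
  assumes "0 < c" "c \<le> Re z"
  shows "cmod (coth z) \<le> 1 / tanh c"
proof -
  have s: "0 < sinh (Re z)" using assms by simp
  have "cmod (coth z) = cmod (cosh z) / cmod (sinh z)" by (simp add: coth_def norm_divide)
  also have "\<dots> \<le> cosh (Re z) / sinh (Re z)"
    using s by (intro frac_le cmod_cosh_le_cosh_Re sinh_Re_le_cmod_sinh) auto
  also have "\<dots> \<le> 1 / tanh c" using assms by (rule cosh_over_sinh_le)
  finally show ?thesis .
qed

lemma cmod_tanh_le:
  assumes "0 < c" "c \<le> Re z"
  shows "cmod (tanh z) \<le> 1 / tanh c"
proof -
  have s: "0 < sinh (Re z)" using assms by simp
  have "cmod (tanh z) = cmod (sinh z) / cmod (cosh z)" by (simp add: tanh_def norm_divide)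
  also have "\<dots> \<le> cosh (Re z) / sinh (Re z)"
    using s by (intro frac_le cmod_sinh_le_cosh_Re sinh_Re_le_cmod_cosh) auto
  also have "\<dots> \<le> 1 / tanh c" using assms by (rule cosh_over_sinh_le)
  finally show ?thesis .
qed

text \<open>
  The exponent \<open>p\<close> of the spatial profiles: \<open>exp (- s t) * sinh (p x)\<close> solves the adjoint heat
  equation when \<open>\<kappa> p\<^sup>2 = \<alpha> s\<close>.
\<close>

definition heat_root :: "real \<Rightarrow> real \<Rightarrow> complex \<Rightarrow> complex" where
  "heat_root \<alpha> \<kappa> s = csqrt (of_real \<alpha> * s / of_real \<kappa>)"

lemma heat_root_argument: "of_real \<alpha> * s / of_real \<kappa> = of_real (\<alpha> / \<kappa>) * (s :: complex)"
  by simp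

lemma heat_root_of_real:
  assumes "\<alpha> > 0" "\<kappa> > 0" "s > 0"
  shows "heat_root \<alpha> \<kappa> (of_real s) = of_real (sqrt (\<alpha> * s / \<kappa>))"
proof -
  have "of_real \<alpha> * of_real s / of_real \<kappa> = complex_of_real (\<alpha> * s / \<kappa>)" by simp
  moreover have "csqrt (complex_of_real (\<alpha> * s / \<kappa>)) = of_real (sqrt (\<alpha> * s / \<kappa>))"
    by (rule csqrt_of_real) (use assms in simp)
  ultimately show ?thesis unfolding heat_root_def by simp
qed

lemma cmod_heat_root:
  assumes "\<alpha> > 0" "\<kappa> > 0"
  shows "cmod (heat_root \<alpha> \<kappa> s) = sqrt (\<alpha> / \<kappa>) * cmod s powr (1/2)"
  using assms by (simp add: heat_root_def norm_mult norm_divide real_sqrt_mult real_sqrt_divide powr_half_sqrt)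

text \<open>
  The argument of a principal root of a point in the right half-plane is at most \<open>\<pi>/4\<close>, so the
  real part is at least \<open>1 / sqrt 2\<close> times the modulus. All decay estimates rest on this.
\<close>

lemma Re_heat_root_ge:
  assumes "\<alpha> > 0" "\<kappa> > 0" "Re s > 0"
  shows "sqrt (\<alpha> / (2 * \<kappa>)) * cmod s powr (1/2) \<le> Re (heat_root \<alpha> \<kappa> s)"
proof -
  let ?w = "of_real (\<alpha> / \<kappa>) * s"
  have "(\<alpha> / (2 * \<kappa>)) * cmod s \<le> (cmod ?w + Re ?w) / 2"
    using assms by (simp add: norm_mult norm_divide field_simps)
  then have "sqrt ((\<alpha> / (2 * \<kappa>)) * cmod s) \<le> sqrt ((cmod ?w + Re ?w) / 2)"
    by (rule real_sqrt_le_mono)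
  also have "\<dots> = Re (heat_root \<alpha> \<kappa> s)"
    unfolding heat_root_def heat_root_argument by simp
  finally show ?thesis by (simp add: powr_half_sqrt real_sqrt_mult[symmetric])
qed

lemma Re_heat_root_ge_const:
  assumes "\<alpha> > 0" "\<kappa> > 0" "0 < r" "r \<le> Re s"
  shows "sqrt (\<alpha> / (2 * \<kappa>)) * sqrt r \<le> Re (heat_root \<alpha> \<kappa> s)"
proof -
  have "r \<le> cmod s" using assms complex_Re_le_cmod[of s] by linarith
  then have "sqrt (\<alpha> / (2 * \<kappa>)) * sqrt r \<le> sqrt (\<alpha> / (2 * \<kappa>)) * cmod s powr (1/2)"
    using assms by (intro mult_left_mono) (auto simp: powr_half_sqrt)
  also have "\<dots> \<le> Re (heat_root \<alpha> \<kappa> s)" using assms by (intro Re_heat_root_ge) auto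
  finally show ?thesis .
qed

lemma Re_heat_root_pos:
  assumes "\<alpha> > 0" "\<kappa> > 0" "Re s > 0"
  shows "Re (heat_root \<alpha> \<kappa> s) > 0"
proof -
  have "0 < sqrt (\<alpha> / (2 * \<kappa>)) * sqrt (Re s)" using assms by simp
  then show ?thesis using Re_heat_root_ge_const[of \<alpha> \<kappa> "Re s" s] assms by linarith
qed

lemma heat_root_holomorphic:
  assumes "\<alpha> > 0" "\<kappa> > 0"
  shows "heat_root \<alpha> \<kappa> holomorphic_on {s. Re s > 0}"
proof -
  have "(\<lambda>s. csqrt (of_real (\<alpha> / \<kappa>) * s)) holomorphic_on {s. Re s > 0}"
    by (intro holomorphic_intros) (use assms in \<open>auto simp: complex_nonpos_Reals_iff mult_le_0_iff divide_le_0_iff\<close>)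
  then show ?thesis by (simp add: heat_root_def[abs_def])
qed

lemma sinh_heat_root_holomorphic:
  assumes "\<alpha> > 0" "\<kappa> > 0"
  shows "(\<lambda>s. sinh (heat_root \<alpha> \<kappa> s * of_real x)) holomorphic_on {s. Re s > 0}"
  unfolding sinh_field_def by (intro holomorphic_intros heat_root_holomorphic assms) auto

lemma cosh_heat_root_holomorphic:
  assumes "\<alpha> > 0" "\<kappa> > 0"
  shows "(\<lambda>s. cosh (heat_root \<alpha> \<kappa> s * of_real x)) holomorphic_on {s. Re s > 0}"
  unfolding cosh_field_def by (intro holomorphic_intros heat_root_holomorphic assms) auto

lemma sinh_heat_root_nonzero:
  assumes "\<alpha> > 0" "\<kappa> > 0" "x > 0" "Re s > 0"
  shows "sinh (heat_root \<alpha> \<kappa> s * of_real x) \<noteq> 0" "cosh (heat_root \<alpha> \<kappa> s * of_real x) \<noteq> 0"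
  using Re_heat_root_pos[OF assms(1,2,4)] assms(3)
  by (auto intro!: sinh_nonzero_right_half_plane cosh_nonzero_right_half_plane)

lemma tanh_heat_root_holomorphic:
  assumes "\<alpha> > 0" "\<kappa> > 0" "x > 0"
  shows "(\<lambda>s. tanh (heat_root \<alpha> \<kappa> s * of_real x)) holomorphic_on {s. Re s > 0}"
  unfolding tanh_def
  by (intro holomorphic_on_divide sinh_heat_root_holomorphic cosh_heat_root_holomorphic)
    (use assms sinh_heat_root_nonzero in auto)

lemma coth_heat_root_holomorphic:
  assumes "\<alpha> > 0" "\<kappa> > 0" "x > 0"
  shows "(\<lambda>s. coth (heat_root \<alpha> \<kappa> s * of_real x)) holomorphic_on {s. Re s > 0}"
  unfolding coth_def
  by (intro holomorphic_on_divide sinh_heat_root_holomorphic cosh_heat_root_holomorphic)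
    (use assms sinh_heat_root_nonzero in auto)

lemma heat_root_hyperbolic_bounded:
  assumes "\<alpha> > 0" "\<kappa> > 0" "x > 0" "r > 0" "r \<le> Re s"
  shows "cmod (tanh (heat_root \<alpha> \<kappa> s * of_real x)) \<le> 1 / tanh (sqrt (\<alpha> / (2 * \<kappa>)) * sqrt r * x)"
    and "cmod (coth (heat_root \<alpha> \<kappa> s * of_real x)) \<le> 1 / tanh (sqrt (\<alpha> / (2 * \<kappa>)) * sqrt r * x)"
  using Re_heat_root_ge_const[OF assms(1,2,4,5)] assms
  by (auto intro!: cmod_tanh_le cmod_coth_le mult_right_mono)

definition real_dnwr_symbol ::
  "real \<Rightarrow> real \<Rightarrow> real \<Rightarrow> real \<Rightarrow> real \<Rightarrow> real \<Rightarrow> real \<Rightarrow> real \<Rightarrow> real" where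
  "real_dnwr_symbol a b \<alpha>1 \<kappa>1 \<alpha>2 \<kappa>2 \<theta> s = 1 - \<theta> - \<theta> * (sqrt ((\<alpha>1 * \<kappa>1) / (\<alpha>2 * \<kappa>2)) *
      coth (sqrt (\<alpha>1 * s / \<kappa>1) * a) * tanh (sqrt (\<alpha>2 * s / \<kappa>2) * b))"

context
  fixes a b \<alpha>1 \<kappa>1 \<alpha>2 \<kappa>2 \<theta> :: real
  assumes pos: "a > 0" "b > 0" "\<alpha>1 > 0" "\<kappa>1 > 0" "\<alpha>2 > 0" "\<kappa>2 > 0"
begin

lemma dnwr_symbol_heat_root:
  "dnwr_symbol a b \<alpha>1 \<kappa>1 \<alpha>2 \<kappa>2 \<theta> s = 1 - of_real \<theta> -
     of_real \<theta> * of_real (sqrt ((\<alpha>1 * \<kappa>1) / (\<alpha>2 * \<kappa>2))) *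
       coth (heat_root \<alpha>1 \<kappa>1 s * of_real a) * tanh (heat_root \<alpha>2 \<kappa>2 s * of_real b)"
  by (simp add: dnwr_symbol_def heat_root_def)

lemma dnwr_symbol_holomorphic:
  "dnwr_symbol a b \<alpha>1 \<kappa>1 \<alpha>2 \<kappa>2 \<theta> holomorphic_on {s. Re s > 0}"
  unfolding dnwr_symbol_heat_root[abs_def]
  by (intro holomorphic_intros coth_heat_root_holomorphic tanh_heat_root_holomorphic pos)

lemma dnwr_symbol_bounded:
  assumes "r > 0"
  obtains B where "\<And>s. r \<le> Re s \<Longrightarrow> cmod (dnwr_symbol a b \<alpha>1 \<kappa>1 \<alpha>2 \<kappa>2 \<theta> s) \<le> B"
proof
  fix s assume s: "r \<le> Re s"
  let ?c = "of_real \<theta> * of_real (sqrt ((\<alpha>1 * \<kappa>1) / (\<alpha>2 * \<kappa>2))) :: complex"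
  let ?A = "1 / tanh (sqrt (\<alpha>1 / (2 * \<kappa>1)) * sqrt r * a)" and ?B = "1 / tanh (sqrt (\<alpha>2 / (2 * \<kappa>2)) * sqrt r * b)"
  have "cmod (dnwr_symbol a b \<alpha>1 \<kappa>1 \<alpha>2 \<kappa>2 \<theta> s) \<le> cmod (1 - of_real \<theta>) +
     cmod (?c * coth (heat_root \<alpha>1 \<kappa>1 s * of_real a) * tanh (heat_root \<alpha>2 \<kappa>2 s * of_real b))"
    unfolding dnwr_symbol_heat_root by (rule norm_triangle_ineq4)
  also have "\<dots> \<le> cmod (1 - of_real \<theta>) + cmod ?c * ?A * ?B"
    unfolding norm_mult[of _ "tanh _"] norm_mult[of _ "coth _"]
    using pos assms s
    by (intro add_left_mono mult_mono heat_root_hyperbolic_bounded mult_nonneg_nonneg) auto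
  finally show "cmod (dnwr_symbol a b \<alpha>1 \<kappa>1 \<alpha>2 \<kappa>2 \<theta> s) \<le> cmod (1 - of_real \<theta>) + cmod ?c * ?A * ?B" .
qed

lemma dnwr_symbol_of_real:
  assumes "s > 0"
  shows "dnwr_symbol a b \<alpha>1 \<kappa>1 \<alpha>2 \<kappa>2 \<theta> (of_real s) =
    of_real (real_dnwr_symbol a b \<alpha>1 \<kappa>1 \<alpha>2 \<kappa>2 \<theta> s)"
  unfolding dnwr_symbol_heat_root real_dnwr_symbol_def
  by (simp add: heat_root_of_real pos assms coth_def tanh_def cosh_field_def sinh_field_def
      exp_of_real[symmetric] del: exp_of_real)

end

text \<open>
  Trades exponential decay away from the interface for a power of the distance.
\<close>

lemma exp_neg_le_powr:
  fixes w :: real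
  assumes "w > 0"
  shows "exp (-w) \<le> w powr (-1/4)"
proof -
  have "ln w \<le> w - 1" using assms by (rule ln_le_minus_one)
  then have "-w \<le> (-1/4) * ln w" using assms by (cases "ln w \<ge> 0") (auto)
  then show ?thesis using assms by (simp add: powr_def)
qed

lemma cmod_sinh_ratio_le:
  assumes "0 < y" "y < l" "0 < c" "c \<le> Re p"
  shows "cmod (sinh (p * of_real y) / sinh (p * of_real l)) \<le> 2 / (1 - exp (- (2 * c * l))) * exp (- (Re p * (l - y)))"
proof -
  let ?A = "Re p"
  have A: "?A > 0" using assms by linarith
  have l: "l > 0" using assms by linarith
  have e: "exp (- (2 * c * l)) < 1" using assms l by simp
  have "exp (?A * l) * (1 - exp (- (2 * c * l))) / 2 \<le> exp (?A * l) * (1 - exp (- (2 * ?A * l))) / 2"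
    using assms l by (intro divide_right_mono mult_left_mono) auto
  also have "\<dots> = sinh (?A * l)"
    by (simp add: sinh_field_def algebra_simps exp_add[symmetric])
  also have "\<dots> \<le> cmod (sinh (p * of_real l))" using sinh_Re_le_cmod_sinh[of "p * of_real l"] by simp
  finally have den: "exp (?A * l) * (1 - exp (- (2 * c * l))) / 2 \<le> cmod (sinh (p * of_real l))" .
  have "cmod (sinh (p * of_real y)) \<le> cosh (?A * y)" using cmod_sinh_le_cosh_Re[of "p * of_real y"] by simp
  also have "\<dots> \<le> exp (?A * y)"
    using A assms by (simp add: cosh_field_def)
  finally have num: "cmod (sinh (p * of_real y)) \<le> exp (?A * y)" .
  have "cmod (sinh (p * of_real y) / sinh (p * of_real l)) = cmod (sinh (p * of_real y)) / cmod (sinh (p * of_real l))"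
    by (rule norm_divide)
  also have "\<dots> \<le> exp (?A * y) / (exp (?A * l) * (1 - exp (- (2 * c * l))) / 2)"
    using num den e by (intro frac_le) auto
  also have "\<dots> = 2 / (1 - exp (- (2 * c * l))) * (exp (?A * y) / exp (?A * l))"
    using e by (simp add: field_simps)
  also have "exp (?A * y) / exp (?A * l) = exp (- (?A * (l - y)))"
    by (simp add: exp_diff[symmetric] algebra_simps)
  finally show ?thesis .
qed

text \<open>
  On its own \<open>tanh (q b) / q\<close> decays like \<open>\<bar>s\<bar> powr (-1/2)\<close>, which just fails to be square
  integrable on a vertical line. The ratio of hyperbolic sines is \<open>O(exp (- Re p * (l - y)))\<close>, hence
  \<open>O((\<bar>s\<bar> powr (1/2) * (l - y)) powr (-1/4))\<close>, and this supplies the missing \<open>\<bar>s\<bar> powr (-1/8)\<close>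
  while the singularity at \<open>y = l\<close> remains square integrable in \<open>y\<close>.
\<close>

lemma heat_profile_bound:
  assumes pos: "\<alpha> > 0" "\<kappa> > 0" "l > 0" "\<alpha>2 > 0" "\<kappa>2 > 0" "b > 0" "r > 0"
  obtains C where "C \<ge> 0"
    "\<And>y s. \<lbrakk>0 < y; y < l; r \<le> Re s\<rbrakk> \<Longrightarrow>
      cmod (sinh (heat_root \<alpha> \<kappa> s * of_real y) / sinh (heat_root \<alpha> \<kappa> s * of_real l) *
        (tanh (heat_root \<alpha>2 \<kappa>2 s * of_real b) / heat_root \<alpha>2 \<kappa>2 s))
      \<le> C * (l - y) powr (-1/4) * cmod s powr (-(5/8))"
proof -
  define g where "g = sqrt (\<alpha> / (2 * \<kappa>))"
  define D where "D = 2 / (1 - exp (- (2 * (g * sqrt r) * l)))"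
  define E where "E = 1 / tanh (sqrt (\<alpha>2 / (2 * \<kappa>2)) * sqrt r * b)"
  have g0: "g > 0" using pos by (simp add: g_def)
  have gr: "0 < g * sqrt r" using g0 pos by simp
  have D0: "D > 0" using gr pos unfolding D_def by simp
  have E0: "E > 0" using pos unfolding E_def by simp
  show thesis
  proof
    show "0 \<le> D * g powr (-1/4) * (E / sqrt (\<alpha>2 / \<kappa>2))" using D0 E0 pos by simp
    fix y s assume y: "0 < y" "y < l" and s: "r \<le> Re s"
    let ?p = "heat_root \<alpha> \<kappa> s" and ?q = "heat_root \<alpha>2 \<kappa>2 s"
    have m: "cmod s > 0" using s pos complex_Re_le_cmod[of s] by linarith
    have Re: "g * cmod s powr (1/2) \<le> Re ?p" unfolding g_def using pos s by (intro Re_heat_root_ge) auto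
    have "cmod (sinh (?p * of_real y) / sinh (?p * of_real l)) \<le> D * exp (- (Re ?p * (l - y)))"
      unfolding D_def using y gr pos s
      by (intro cmod_sinh_ratio_le) (auto simp: g_def intro!: Re_heat_root_ge_const)
    also have "\<dots> \<le> D * exp (- ((g * cmod s powr (1/2)) * (l - y)))"
      using Re y D0 by (intro mult_left_mono) auto
    also have "\<dots> \<le> D * ((g * cmod s powr (1/2)) * (l - y)) powr (-1/4)"
      using y D0 g0 m by (intro mult_left_mono exp_neg_le_powr) auto
    also have "\<dots> = D * g powr (-1/4) * (l - y) powr (-1/4) * cmod s powr (-(1/8))"
      using y g0 m by (simp add: powr_mult powr_powr)
    finally have 1: "cmod (sinh (?p * of_real y) / sinh (?p * of_real l)) \<le>
      D * g powr (-1/4) * (l - y) powr (-1/4) * cmod s powr (-(1/8))" .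
    have "cmod (tanh (?q * of_real b) / ?q) = cmod (tanh (?q * of_real b)) / (sqrt (\<alpha>2 / \<kappa>2) * cmod s powr (1/2))"
      using pos by (simp add: norm_divide cmod_heat_root)
    also have "\<dots> \<le> E / (sqrt (\<alpha>2 / \<kappa>2) * cmod s powr (1/2))"
      unfolding E_def using pos s by (intro divide_right_mono heat_root_hyperbolic_bounded) auto
    also have "\<dots> = E / sqrt (\<alpha>2 / \<kappa>2) * cmod s powr (-(1/2))"
      by (simp add: powr_minus field_simps)
    finally have 2: "cmod (tanh (?q * of_real b) / ?q) \<le> E / sqrt (\<alpha>2 / \<kappa>2) * cmod s powr (-(1/2))" .
    have "cmod (sinh (?p * of_real y) / sinh (?p * of_real l) * (tanh (?q * of_real b) / ?q)) \<le>
      (D * g powr (-1/4) * (l - y) powr (-1/4) * cmod s powr (-(1/8))) * (E / sqrt (\<alpha>2 / \<kappa>2) * cmod s powr (-(1/2)))"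
      unfolding norm_mult[of "sinh _ / sinh _"] using 1 2 D0 by (intro mult_mono) auto
    also have "\<dots> = D * g powr (-1/4) * (E / sqrt (\<alpha>2 / \<kappa>2)) * (l - y) powr (-1/4) * (cmod s powr (-(1/8)) * cmod s powr (-(1/2)))"
      by (simp only: mult_ac)
    also have "cmod s powr (-(1/8)) * cmod s powr (-(1/2)) = cmod s powr (-(5/8))"
      by (simp add: powr_add[symmetric])
    finally show "cmod (sinh (?p * of_real y) / sinh (?p * of_real l) * (tanh (?q * of_real b) / ?q))
      \<le> D * g powr (-1/4) * (E / sqrt (\<alpha>2 / \<kappa>2)) * (l - y) powr (-1/4) * cmod s powr (-(5/8))" .
  qed
qed

text \<open>
  The point evaluation bound for the profile as a function of \<open>s\<close>, with \<open>y\<close> and \<open>\<tau>\<close> as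
  parameters. The constant depends on neither \<open>\<tau>\<close> nor the exponential sum.
\<close>

lemma heat_profile_sum_bound:
  assumes pos: "\<alpha> > 0" "\<kappa> > 0" "l > 0" "\<alpha>2 > 0" "\<kappa>2 > 0" "b > 0" "r > 0"
  obtains C where "C \<ge> 0"
    "\<And>I (\<sigma> :: 'i \<Rightarrow> real) c \<tau> y. \<lbrakk>finite I; \<forall>i\<in>I. \<sigma> i > 0; 0 < y; y < l; 0 \<le> \<tau>\<rbrakk> \<Longrightarrow>
      \<bar>\<Sum>i\<in>I. c i * (exp (- ((r + \<sigma> i) * \<tau>)) *
        (sinh (sqrt (\<alpha> * (r + \<sigma> i) / \<kappa>) * y) / sinh (sqrt (\<alpha> * (r + \<sigma> i) / \<kappa>) * l) *
        (tanh (sqrt (\<alpha>2 * (r + \<sigma> i) / \<kappa>2) * b) / sqrt (\<alpha>2 * (r + \<sigma> i) / \<kappa>2))))\<bar>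
      \<le> C * (l - y) powr (-1/4) * sqrt (cauchy_form I \<sigma> c)"
proof -
  obtain C where C: "C \<ge> 0" and bd: "\<And>y s. \<lbrakk>0 < y; y < l; r \<le> Re s\<rbrakk> \<Longrightarrow>
      cmod (sinh (heat_root \<alpha> \<kappa> s * of_real y) / sinh (heat_root \<alpha> \<kappa> s * of_real l) *
        (tanh (heat_root \<alpha>2 \<kappa>2 s * of_real b) / heat_root \<alpha>2 \<kappa>2 s))
      \<le> C * (l - y) powr (-1/4) * cmod s powr (-(5/8))"
    using heat_profile_bound[OF pos] by blast
  \<comment> \<open>The integrand is integrable because \<open>2 * (5/8) > 1\<close>.\<close>
  define J where "J = (LINT \<omega>|lborel. cmod (Complex r \<omega>) powr (-(2 * (5/8))))"
  have J0: "J \<ge> 0" unfolding J_def by (rule integral_nonneg_AE) simp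
  show thesis
  proof
    show "0 \<le> sqrt (J / (2 * pi)) * C" using J0 C by simp
    fix I and \<sigma> c :: "'i \<Rightarrow> real" and \<tau> y :: real
    assume I: "finite I" "\<forall>i\<in>I. \<sigma> i > 0" and y: "0 < y" "y < l" and \<tau>: "0 \<le> \<tau>"
    define F where "F = (\<lambda>s. exp (- (s * of_real \<tau>)) *
      (sinh (heat_root \<alpha> \<kappa> s * of_real y) / sinh (heat_root \<alpha> \<kappa> s * of_real l) *
        (tanh (heat_root \<alpha>2 \<kappa>2 s * of_real b) / heat_root \<alpha>2 \<kappa>2 s)))"
    define k where "k = (\<lambda>s. exp (- (s * \<tau>)) *
        (sinh (sqrt (\<alpha> * s / \<kappa>) * y) / sinh (sqrt (\<alpha> * s / \<kappa>) * l) *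
        (tanh (sqrt (\<alpha>2 * s / \<kappa>2) * b) / sqrt (\<alpha>2 * s / \<kappa>2))))"
    have Fk: "F (of_real s) = of_real (k s)" if "s > 0" for s
      unfolding F_def k_def using pos that
      by (simp add: heat_root_of_real tanh_def cosh_field_def sinh_field_def
          exp_of_real[symmetric] del: exp_of_real)
    have hol: "F holomorphic_on {s. Re s > 0}"
    proof -
      have nz: "heat_root \<alpha>2 \<kappa>2 s \<noteq> 0" if "Re s > 0" for s
        using Re_heat_root_pos[OF pos(4,5) that] by auto
      have "(\<lambda>s. sinh (heat_root \<alpha> \<kappa> s * of_real y) / sinh (heat_root \<alpha> \<kappa> s * of_real l)) holomorphic_on {s. Re s > 0}"
        by (intro holomorphic_on_divide sinh_heat_root_holomorphic pos) (use pos sinh_heat_root_nonzero in auto)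
      moreover have "(\<lambda>s. tanh (heat_root \<alpha>2 \<kappa>2 s * of_real b) / heat_root \<alpha>2 \<kappa>2 s) holomorphic_on {s. Re s > 0}"
        by (intro holomorphic_on_divide tanh_heat_root_holomorphic heat_root_holomorphic pos) (use nz in auto)
      ultimately show ?thesis
        unfolding F_def by (intro holomorphic_on_mult) (auto intro!: holomorphic_intros)
    qed
    have bF: "cmod (F s) \<le> C * (l - y) powr (-1/4) * cmod s powr (-(5/8))" if s: "r \<le> Re s" for s
    proof -
      have "0 \<le> Re s * \<tau>" using s pos \<tau> by simp
      then have e1: "cmod (exp (- (s * of_real \<tau>))) \<le> 1" by simp
      show ?thesis unfolding F_def norm_mult[of "exp _"]
        using mult_mono[OF e1 bd[OF y s]] C by simp
    qed
    let ?S = "\<Sum>i\<in>I. c i * k (r + \<sigma> i)"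
    let ?N = "LINT \<omega>|lborel. (cmod (F (Complex r \<omega>)))\<^sup>2"
    have Q0: "0 \<le> cauchy_form I \<sigma> c" by (rule cauchy_form_nonneg[OF I])
    have ps: "r + \<sigma> i > 0" if "i \<in> I" for i using I pos that by (simp add: add_pos_pos)
    have e: "(\<Sum>i\<in>I. of_real (c i) * F (of_real (r + \<sigma> i))) = complex_of_real ?S"
      by (simp add: Fk ps del: of_real_add)
    have d: "(1/2::real) < 5/8" by simp
    have "2 * pi * \<bar>?S\<bar>\<^sup>2 \<le> ?N * cauchy_form I \<sigma> c"
      using half_plane_point_values_le[OF I hol pos(7) pos(7) d bF, of c] by (simp only: e norm_of_real)
    also have "\<dots> \<le> ((C * (l - y) powr (-1/4))\<^sup>2 * J) * cauchy_form I \<sigma> c"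
      unfolding J_def
      by (intro mult_right_mono square_integrable_on_vertical_line(3)[OF hol pos(7) pos(7) _ bF] Q0) auto
    finally have "\<bar>?S\<bar>\<^sup>2 \<le> (sqrt (J / (2 * pi)) * C * (l - y) powr (-1/4) * sqrt (cauchy_form I \<sigma> c))\<^sup>2"
      using J0 Q0 by (simp add: power_mult_distrib field_simps)
    then have "\<bar>?S\<bar> \<le> sqrt (J / (2 * pi)) * C * (l - y) powr (-1/4) * sqrt (cauchy_form I \<sigma> c)"
      by (rule power2_le_imp_le) (use J0 C Q0 in auto)
    then show "\<bar>\<Sum>i\<in>I. c i * (exp (- ((r + \<sigma> i) * \<tau>)) *
        (sinh (sqrt (\<alpha> * (r + \<sigma> i) / \<kappa>) * y) / sinh (sqrt (\<alpha> * (r + \<sigma> i) / \<kappa>) * l) *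
        (tanh (sqrt (\<alpha>2 * (r + \<sigma> i) / \<kappa>2) * b) / sqrt (\<alpha>2 * (r + \<sigma> i) / \<kappa>2))))\<bar>
      \<le> sqrt (J / (2 * pi)) * C * (l - y) powr (-1/4) * sqrt (cauchy_form I \<sigma> c)"
      unfolding k_def .
  qed
qed

section \<open>Test functions built from exponentials in time\<close>

text \<open>
  Equal to \<open>1\<close> up to \<open>T'\<close>, with a quadratic descent to \<open>0\<close> at \<open>T\<close>, so that it is continuously
  differentiable on the closed interval.
\<close>

definition cutoff :: "real \<Rightarrow> real \<Rightarrow> real \<Rightarrow> real" where
  "cutoff T' T t = 1 - (max 0 (t - T'))\<^sup>2 / (T - T')\<^sup>2"

definition cutoff_deriv :: "real \<Rightarrow> real \<Rightarrow> real \<Rightarrow> real" where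
  "cutoff_deriv T' T t = - (2 * max 0 (t - T') / (T - T')\<^sup>2)"

lemma has_real_derivative_positive_part_square:
  "((\<lambda>x::real. (max 0 x)\<^sup>2) has_real_derivative 2 * max 0 x) (at x)"
proof -
  consider "x > 0" | "x < 0" | "x = 0" by linarith
  then show ?thesis
  proof cases
    case 1
    have "((\<lambda>x::real. x\<^sup>2) has_real_derivative 2 * max 0 x) (at x)"
      using 1 by (auto intro!: derivative_eq_intros)
    then show ?thesis
      by (rule has_field_derivative_transform_within_open[where S = "{0<..}"]) (use 1 in auto)
  next
    case 2
    have "((\<lambda>x::real. 0) has_real_derivative 2 * max 0 x) (at x)"
      using 2 by (auto intro!: derivative_eq_intros)
    then show ?thesis
      by (rule has_field_derivative_transform_within_open[where S = "{..<0}"]) (use 2 in auto)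
  next
    case 3
    have "((\<lambda>h::real. (max 0 h)\<^sup>2 / h) \<longlongrightarrow> 0) (at 0)"
    proof (rule Lim_null_comparison)
      have "norm ((max 0 h)\<^sup>2 / h) \<le> \<bar>h\<bar>" for h :: real
        by (cases "h > 0") (auto simp: max_def power2_eq_square)
      then show "\<forall>\<^sub>F h in at 0. norm ((max 0 h)\<^sup>2 / h) \<le> \<bar>h::real\<bar>" by simp
      show "((\<lambda>h::real. \<bar>h\<bar>) \<longlongrightarrow> 0) (at 0)"
        by (rule tendsto_rabs_zero) (rule tendsto_ident_at)
    qed
    then show ?thesis using 3 by (simp add: has_field_derivative_iff)
  qed
qed

lemma cutoff_has_derivative:
  "(cutoff T' T has_real_derivative cutoff_deriv T' T t) (at t within S)"
proof -
  have "((\<lambda>t. (max 0 (t - T'))\<^sup>2) has_real_derivative (2 * max 0 (t - T')) * 1) (at t)"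
    by (rule DERIV_chain2[OF has_real_derivative_positive_part_square]) (auto intro!: derivative_eq_intros)
  then have "((\<lambda>t. 1 - (max 0 (t - T'))\<^sup>2 / (T - T')\<^sup>2) has_real_derivative 0 - (2 * max 0 (t - T')) * 1 / (T - T')\<^sup>2) (at t)"
    by (intro DERIV_diff DERIV_cdivide DERIV_const)
  then show ?thesis
    unfolding cutoff_def[abs_def] cutoff_deriv_def by (auto intro: DERIV_subset)
qed

lemma continuous_on_cutoff: "continuous_on S (cutoff T' T)"
  using cutoff_has_derivative DERIV_continuous_on by blast

lemma continuous_on_cutoff_deriv: "continuous_on S (cutoff_deriv T' T)"
  unfolding cutoff_deriv_def[abs_def] divide_inverse by (intro continuous_intros)

lemma cutoff_simps:
  assumes "T' < T"
  shows "cutoff T' T T = 0" "t \<le> T' \<Longrightarrow> cutoff T' T t = 1" "t \<le> T' \<Longrightarrow> cutoff_deriv T' T t = 0"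
  using assms by (auto simp: cutoff_def cutoff_deriv_def)

lemma cutoff_bounds:
  assumes "T' < T" "t \<le> T"
  shows "0 \<le> cutoff T' T t" "cutoff T' T t \<le> 1" "\<bar>cutoff_deriv T' T t\<bar> \<le> 2 / (T - T')"
proof -
  let ?m = "max 0 (t - T')"
  have m: "0 \<le> ?m" "?m \<le> T - T'" using assms by auto
  then have "?m\<^sup>2 \<le> (T - T')\<^sup>2" by (intro power_mono) auto
  then show "0 \<le> cutoff T' T t" using assms by (simp add: cutoff_def)
  show "cutoff T' T t \<le> 1" by (simp add: cutoff_def)
  have "\<bar>cutoff_deriv T' T t\<bar> = 2 * ?m / (T - T')\<^sup>2" using m by (simp add: cutoff_deriv_def)
  also have "\<dots> \<le> 2 * (T - T') / (T - T')\<^sup>2" using m by (intro divide_right_mono mult_left_mono) auto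
  also have "\<dots> = 2 / (T - T')" using assms by (simp only: power2_eq_square) (intro mult_divide_mult_cancel_right, simp)
  finally show "\<bar>cutoff_deriv T' T t\<bar> \<le> 2 / (T - T')" .
qed

text \<open>
  The cutoff provides the zero at the final time; boundary values are left to the profiles \<open>X\<close>.
\<close>

lemma test_function_exponential_sum:
  fixes d s :: "'i \<Rightarrow> real" and X X' X'' :: "'i \<Rightarrow> real \<Rightarrow> real"
  assumes "T' < T"
    and X: "\<And>i x. (X i has_real_derivative X' i x) (at x)"
    and X': "\<And>i x. (X' i has_real_derivative X'' i x) (at x)"
    and X'': "\<And>i. continuous_on UNIV (X'' i)"
  shows "test_function l m T
    (\<lambda>p. cutoff T' T (snd p) * (\<Sum>i\<in>I. d i * (exp (- (s i * snd p)) * X i (fst p))))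
    (\<lambda>p. cutoff_deriv T' T (snd p) * (\<Sum>i\<in>I. d i * (exp (- (s i * snd p)) * X i (fst p)))
       + cutoff T' T (snd p) * (\<Sum>i\<in>I. d i * (- s i * exp (- (s i * snd p)) * X i (fst p))))
    (\<lambda>p. cutoff T' T (snd p) * (\<Sum>i\<in>I. d i * (exp (- (s i * snd p)) * X' i (fst p))))
    (\<lambda>p. cutoff T' T (snd p) * (\<Sum>i\<in>I. d i * (exp (- (s i * snd p)) * X'' i (fst p))))"
proof -
  have cX: "continuous_on UNIV (X i)" "continuous_on UNIV (X' i)" for i
    using X X' by (auto intro!: DERIV_continuous_on)
  have c1: "continuous_on A (\<lambda>p. cutoff T' T (snd p))" for A :: "(real \<times> real) set"
    by (rule continuous_on_compose2[OF continuous_on_cutoff[of UNIV]]) (auto intro: continuous_intros)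
  have c2: "continuous_on A (\<lambda>p. cutoff_deriv T' T (snd p))" for A :: "(real \<times> real) set"
    by (rule continuous_on_compose2[OF continuous_on_cutoff_deriv[of UNIV]]) (auto intro: continuous_intros)
  have c3: "continuous_on A (\<lambda>p. X i (fst p))" "continuous_on A (\<lambda>p. X' i (fst p))"
      "continuous_on A (\<lambda>p. X'' i (fst p))" for A :: "(real \<times> real) set" and i
    by (rule continuous_on_compose2[OF cX(1)] continuous_on_compose2[OF cX(2)] continuous_on_compose2[OF X''];
        auto intro: continuous_intros)+
  have dt: "((\<lambda>\<tau>. cutoff T' T \<tau> * (\<Sum>i\<in>I. d i * (exp (- (s i * \<tau>)) * X i x))) has_real_derivative
      cutoff_deriv T' T t * (\<Sum>i\<in>I. d i * (exp (- (s i * t)) * X i x))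
       + cutoff T' T t * (\<Sum>i\<in>I. d i * (- s i * exp (- (s i * t)) * X i x))) (at t within S)" for x t S
    by (auto intro!: derivative_eq_intros cutoff_has_derivative sum.cong simp: algebra_simps)
  have dx: "((\<lambda>\<xi>. cutoff T' T t * (\<Sum>i\<in>I. d i * (exp (- (s i * t)) * X i \<xi>))) has_real_derivative
      cutoff T' T t * (\<Sum>i\<in>I. d i * (exp (- (s i * t)) * X' i x))) (at x within S)" for x t S
    by (intro DERIV_cmult DERIV_sum DERIV_subset[OF X]) auto
  have dxx: "((\<lambda>\<xi>. cutoff T' T t * (\<Sum>i\<in>I. d i * (exp (- (s i * t)) * X' i \<xi>))) has_real_derivative
      cutoff T' T t * (\<Sum>i\<in>I. d i * (exp (- (s i * t)) * X'' i x))) (at x within S)" for x t S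
    by (intro DERIV_cmult DERIV_sum DERIV_subset[OF X']) auto
  show ?thesis
    unfolding test_function_def
    using dt dx dxx cutoff_simps(1)[OF assms(1)]
    by (auto intro!: continuous_intros c1 c2 c3)
qed

lemma continuous_imp_L2_time_interval:
  fixes w :: "real \<Rightarrow> real"
  assumes "continuous_on {0..T} w"
  shows "w \<in> borel_measurable (time_interval T)" "integrable (time_interval T) w"
    "integrable (time_interval T) (\<lambda>t. (w t)\<^sup>2)"
proof -
  have m: "v \<in> borel_measurable (time_interval T)" if "continuous_on {0..T} v" for v :: "real \<Rightarrow> real"
    by (rule continuous_imp_measurable_on_sets_lebesgue[OF continuous_on_subset[OF that]]) auto
  have i: "integrable (time_interval T) v" if v: "continuous_on {0..T} v" for v :: "real \<Rightarrow> real"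
  proof -
    have "bounded (v ` {0..T})" by (intro compact_imp_bounded compact_continuous_image v) auto
    then obtain B where "\<forall>y\<in>v ` {0..T}. norm y \<le> B" unfolding bounded_iff by blast
    then have B: "\<And>t. t \<in> {0..T} \<Longrightarrow> norm (v t) \<le> B" by simp
    interpret finite_measure "time_interval T" by (rule finite_measure_lebesgue_on) simp
    show ?thesis
      by (rule integrable_const_bound[where B = B]) (use B m[OF v] in \<open>auto intro!: AE_I2\<close>)
  qed
  show "w \<in> borel_measurable (time_interval T)" "integrable (time_interval T) w"
    "integrable (time_interval T) (\<lambda>t. (w t)\<^sup>2)"
    using assms by (auto intro!: m i continuous_intros)
qed

lemma square_integrable_mult_continuous:
  assumes "square_integrable (time_interval T) f" "continuous_on {0..T} w"
  shows "integrable (time_interval T) (\<lambda>t. f t * w t)"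
  using assms continuous_imp_L2_time_interval[OF assms(2)]
  by (intro integrable_mult_of_square_integrable) (auto simp: square_integrable_def)

lemma borel_measurable_space_time:
  fixes f :: "real \<times> real \<Rightarrow> real"
  assumes "f \<in> borel_measurable borel"
  shows "f \<in> borel_measurable (space_time l m T)"
  using assms by (intro measurable_restrict_space1 measurable_completion) simp

lemma integrable_inverse_sqrt:
  fixes l m :: real
  shows "integrable lborel (\<lambda>x. indicator {l<..<m} x * \<bar>x\<bar> powr (-1/2))"
proof -
  define c where "c = \<bar>l\<bar> + \<bar>m\<bar>"
  let ?g = "\<lambda>x. indicator {0..c} x * x powr (-1/2)"
  have "((\<lambda>x. x powr (-1/2)) has_integral (c powr (-1/2 + 1) / (-1/2 + 1))) {0..c}"
    by (rule has_integral_powr_from_0) (auto simp: c_def)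
  then have "(\<lambda>x. x powr (-1/2)) absolutely_integrable_on {0..c}"
    by (intro nonnegative_absolutely_integrable_1) (auto simp: integrable_on_def)
  then have i1: "integrable lborel ?g"
    unfolding set_integrable_def by (subst (asm) integrable_completion) auto
  have i2: "integrable lborel (\<lambda>x. ?g (0 + (-1) * x))"
    by (rule lborel_integrable_real_affine[OF i1]) simp
  show ?thesis
  proof (rule Bochner_Integration.integrable_bound[OF Bochner_Integration.integrable_add[OF i1 i2]])
    show "AE x in lborel. norm (indicator {l<..<m} x * \<bar>x\<bar> powr (-1/2)) \<le> norm (?g x + ?g (0 + (-1) * x))"
      by (rule AE_I2) (auto simp: indicator_def c_def abs_if)
  qed auto
qed

text \<open>
  The weight is square integrable on the rectangle because \<open>\<bar>x\<bar> powr (-1/2)\<close> is integrable near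
  \<open>0\<close>.
\<close>

lemma integrable_singular_weight:
  "integrable (space_time l m T) (\<lambda>p. (\<bar>fst p\<bar> powr (-1/4))\<^sup>2)"
proof -
  let ?f = "\<lambda>x. indicator {l<..<m} x * \<bar>x\<bar> powr (-1/2) :: real" and ?g = "\<lambda>t. indicator {0<..<T} t :: real"
  have g: "integrable lborel ?g" by (cases "0 \<le> T") (auto simp: integrable_indicator_iff)
  have f: "integrable lborel ?f" by (rule integrable_inverse_sqrt)
  have "integrable (lborel \<Otimes>\<^sub>M lborel) (\<lambda>(x, t). ?f x * ?g t)"
  proof (rule lborel_pair.Fubini_integrable)
    show "(\<lambda>(x, t). ?f x * ?g t) \<in> borel_measurable (lborel \<Otimes>\<^sub>M lborel)" by measurable
    have "(\<lambda>x. LINT t|lborel. norm (case (x, t) of (x, t) \<Rightarrow> ?f x * ?g t)) = (\<lambda>x. norm (?f x) * (LINT t|lborel. norm (?g t)))"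
      by (simp add: norm_mult)
    then show "integrable lborel (\<lambda>x. LINT t|lborel. norm (case (x, t) of (x, t) \<Rightarrow> ?f x * ?g t))"
      using f by simp
    show "AE x in lborel. integrable lborel (\<lambda>t. case (x, t) of (x, t) \<Rightarrow> ?f x * ?g t)"
      using g by simp
  qed
  then have i: "integrable lborel (\<lambda>p. indicator ({l<..<m} \<times> {0<..<T}) p *\<^sub>R (\<bar>fst p\<bar> powr (-1/4))\<^sup>2 :: real)"
    unfolding lborel_prod
    by (rule back_subst[where P = "integrable lborel"])
      (auto simp: fun_eq_iff indicator_def power2_eq_square powr_add[symmetric])
  have "open ({l<..<m} \<times> {0<..<T})" by (intro open_Times) auto
  then have b: "{l<..<m} \<times> {0<..<T} \<in> sets borel" by (rule borel_open)
  have "integrable lebesgue (\<lambda>p. indicator ({l<..<m} \<times> {0<..<T}) p *\<^sub>R (\<bar>fst p\<bar> powr (-1/4))\<^sup>2 :: real)"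
  proof (subst integrable_completion)
    show "(\<lambda>p. indicator ({l<..<m} \<times> {0<..<T}) p *\<^sub>R (\<bar>fst p\<bar> powr (-1/4))\<^sup>2 :: real) \<in> borel_measurable lborel"
      using i by (rule borel_measurable_integrable)
  qed (rule i)
  then show ?thesis
    using b by (subst integrable_restrict_space) auto
qed

lemma square_integrable_mult_singular_weight:
  assumes "square_integrable (space_time l m T) u"
  shows "integrable (space_time l m T) (\<lambda>p. \<bar>u p\<bar> * \<bar>fst p\<bar> powr (-1/4))"
proof (rule integrable_mult_of_square_integrable)
  show "(\<lambda>p. \<bar>fst p\<bar> powr (-1/4)) \<in> borel_measurable (space_time l m T)"
    by (rule borel_measurable_space_time) (unfold borel_prod[symmetric], measurable)
qed (use assms integrable_singular_weight in \<open>auto simp: square_integrable_def\<close>)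

section \<open>Exponential moments of one step\<close>

text \<open>
  If the integrand on the left is not integrable, its Bochner integral is \<open>0\<close> by convention and the
  bound is trivial.
\<close>

lemma abs_integral_singular_weight_le:
  assumes u: "square_integrable (space_time l m T) u" and K: "0 \<le> K"
    and bd: "\<And>x t. \<lbrakk>l < x; x < m; 0 < t; t < T\<rbrakk> \<Longrightarrow> \<bar>\<Psi> (x, t)\<bar> \<le> K * \<bar>x\<bar> powr (-1/4)"
  shows "\<bar>LINT p|space_time l m T. u p * \<Psi> p\<bar> \<le> K * (LINT p|space_time l m T. \<bar>u p\<bar> * \<bar>fst p\<bar> powr (-1/4))"
proof (cases "integrable (space_time l m T) (\<lambda>p. u p * \<Psi> p)")
  case True
  have "\<bar>LINT p|space_time l m T. u p * \<Psi> p\<bar> \<le> (LINT p|space_time l m T. norm (u p * \<Psi> p))"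
    using integral_norm_bound[of "space_time l m T" "\<lambda>p. u p * \<Psi> p"] by simp
  also have "\<dots> \<le> (LINT p|space_time l m T. K * (\<bar>u p\<bar> * \<bar>fst p\<bar> powr (-1/4)))"
  proof (rule integral_mono)
    show "integrable (space_time l m T) (\<lambda>p. norm (u p * \<Psi> p))" using True by (rule integrable_norm)
    show "integrable (space_time l m T) (\<lambda>p. K * (\<bar>u p\<bar> * \<bar>fst p\<bar> powr (-1/4)))"
      by (intro integrable_mult_right square_integrable_mult_singular_weight u)
    fix p assume "p \<in> space (space_time l m T)"
    then have p: "l < fst p" "fst p < m" "0 < snd p" "snd p < T"
      by (auto simp: space_restrict_space)
    have "\<bar>\<Psi> p\<bar> \<le> K * \<bar>fst p\<bar> powr (-1/4)" using bd[OF p] by simp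
    then have "\<bar>u p\<bar> * \<bar>\<Psi> p\<bar> \<le> \<bar>u p\<bar> * (K * \<bar>fst p\<bar> powr (-1/4))" by (rule mult_left_mono) simp
    then show "norm (u p * \<Psi> p) \<le> K * (\<bar>u p\<bar> * \<bar>fst p\<bar> powr (-1/4))"
      by (simp add: abs_mult mult_ac)
  qed
  finally show ?thesis by simp
next
  case False
  have "0 \<le> K * (LINT p|space_time l m T. \<bar>u p\<bar> * \<bar>fst p\<bar> powr (-1/4))"
    using K by (intro mult_nonneg_nonneg integral_nonneg_AE) auto
  then show ?thesis using False by (simp add: not_integrable_integral_eq)
qed

text \<open>
  A step determines \<open>h'\<close> only almost everywhere; measurability of \<open>h'\<close> comes from the completeness
  of Lebesgue measure.
\<close>

lemma dnwr_step_square_integrable: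
  assumes "dnwr_step a b T \<alpha>1 \<kappa>1 \<alpha>2 \<kappa>2 \<theta> h h'" and h: "square_integrable (time_interval T) h"
  shows "square_integrable (time_interval T) h'"
proof -
  obtain g where g: "square_integrable (time_interval T) g"
    and ae: "AE t in time_interval T. h' t = (1 - \<theta>) * h t + \<theta> * g t"
    using assms(1) by (auto simp: dnwr_step_def left_trace_def)
  let ?k = "\<lambda>t. (1 - \<theta>) * h t + \<theta> * g t"
  have [measurable]: "h \<in> borel_measurable (time_interval T)" "g \<in> borel_measurable (time_interval T)"
    using h g by (auto simp: square_integrable_def)
  have hg: "integrable (time_interval T) (\<lambda>t. h t * g t)"
    using h g by (intro integrable_mult_of_square_integrable) (auto simp: square_integrable_def)
  have "(\<lambda>t. (?k t)\<^sup>2) = (\<lambda>t. (1 - \<theta>)\<^sup>2 * (h t)\<^sup>2 + (2 * \<theta> * (1 - \<theta>) * (h t * g t) + \<theta>\<^sup>2 * (g t)\<^sup>2))"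
    by (simp add: fun_eq_iff power2_eq_square algebra_simps)
  then have k2: "integrable (time_interval T) (\<lambda>t. (?k t)\<^sup>2)"
    using h g hg by (simp add: square_integrable_def)
  have km: "?k \<in> borel_measurable (time_interval T)" by measurable
  have ae': "AE t in time_interval T. ?k t = h' t" using ae by eventually_elim simp
  have null: "S \<in> sets (time_interval T)" if S: "S \<subseteq> N" "N \<in> null_sets (time_interval T)" for S N
  proof -
    have N: "N \<in> null_sets lebesgue" "N \<subseteq> {0<..<T}"
      using S(2) by (auto simp: null_sets_restrict_space)
    then have "S \<in> null_sets lebesgue"
      using S(1) by (metis negligible_iff_null_sets negligible_subset)
    then show ?thesis using N S(1) by (auto simp: sets_restrict_space_iff null_sets_def)
  qed
  have hm: "h' \<in> borel_measurable (time_interval T)"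
  proof (rule measurableI)
    fix A :: "real set" assume A: "A \<in> sets borel"
    obtain N where N: "N \<in> null_sets (time_interval T)" "{t \<in> space (time_interval T). ?k t \<noteq> h' t} \<subseteq> N"
      using ae' by (auto elim!: AE_E simp: null_sets_def)
    let ?sp = "space (time_interval T)"
    have e: "h' -` A \<inter> ?sp = ((?k -` A \<inter> ?sp) - N) \<union> (h' -` A \<inter> ?sp \<inter> N)"
      using N(2) by auto
    have 1: "?k -` A \<inter> ?sp \<in> sets (time_interval T)" using km A by (rule measurable_sets)
    have 2: "N \<in> sets (time_interval T)" using N by (auto simp: null_sets_def)
    have 3: "h' -` A \<inter> ?sp \<inter> N \<in> sets (time_interval T)" by (rule null[OF _ N(1)]) auto
    show "h' -` A \<inter> ?sp \<in> sets (time_interval T)"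
      by (subst e) (rule sets.Un[OF sets.Diff[OF 1 2] 3])
  qed simp
  have "integrable (time_interval T) (\<lambda>t. (h' t)\<^sup>2)"
    by (rule integrable_cong_AE_imp[OF k2]) (use hm ae' in \<open>auto elim!: eventually_mono\<close>)
  then show ?thesis using hm by (simp add: square_integrable_def)
qed

context
  fixes d s :: "'i \<Rightarrow> real" and X X' X'' :: "'i \<Rightarrow> real \<Rightarrow> real" and I :: "'i set"
    and \<alpha> \<kappa> l m T T' :: real
  assumes T': "T' < T"
    and X: "\<And>i x. (X i has_real_derivative X' i x) (at x)"
    and X': "\<And>i x. (X' i has_real_derivative X'' i x) (at x)"
    and X'': "\<And>i. continuous_on UNIV (X'' i)"
    and eigen: "\<And>i x. i \<in> I \<Longrightarrow> \<kappa> * X'' i x = \<alpha> * s i * X i x"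
begin

text \<open>
  Without the cutoff every summand solves the adjoint heat equation, so only the derivative of the
  cutoff survives.
\<close>

lemma adjoint_pairing_exponential_sum:
  "adjoint_pairing \<alpha> \<kappa> l m T u
    (\<lambda>p. cutoff_deriv T' T (snd p) * (\<Sum>i\<in>I. d i * (exp (- (s i * snd p)) * X i (fst p)))
       + cutoff T' T (snd p) * (\<Sum>i\<in>I. d i * (- s i * exp (- (s i * snd p)) * X i (fst p))))
    (\<lambda>p. cutoff T' T (snd p) * (\<Sum>i\<in>I. d i * (exp (- (s i * snd p)) * X'' i (fst p))))
  = (LINT p|space_time l m T. u p * (\<alpha> * (cutoff_deriv T' T (snd p) *
       (\<Sum>i\<in>I. d i * (exp (- (s i * snd p)) * X i (fst p))))))"
  unfolding adjoint_pairing_def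
proof (intro Bochner_Integration.integral_cong refl arg_cong2[of _ _ _ _ "(*)"])
  fix z :: "real \<times> real"
  let ?A = "\<Sum>i\<in>I. d i * (exp (- (s i * snd z)) * X i (fst z))"
  let ?B = "\<Sum>i\<in>I. d i * (- s i * exp (- (s i * snd z)) * X i (fst z))"
  let ?C = "\<Sum>i\<in>I. d i * (exp (- (s i * snd z)) * X'' i (fst z))"
  have "\<kappa> * ?C = (\<Sum>i\<in>I. d i * (exp (- (s i * snd z)) * (\<kappa> * X'' i (fst z))))"
    by (simp add: sum_distrib_left mult_ac)
  also have "\<dots> = (\<Sum>i\<in>I. d i * (exp (- (s i * snd z)) * (\<alpha> * s i * X i (fst z))))"
    by (intro sum.cong refl) (simp only: eigen)
  also have "\<dots> = - (\<alpha> * ?B)"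
    by (simp add: sum_distrib_left sum_negf mult_ac)
  finally have C: "\<kappa> * ?C = - (\<alpha> * ?B)" .
  have "\<alpha> * (cutoff_deriv T' T (snd z) * ?A + cutoff T' T (snd z) * ?B) + \<kappa> * (cutoff T' T (snd z) * ?C)
    = \<alpha> * (cutoff_deriv T' T (snd z) * ?A) + cutoff T' T (snd z) * (\<alpha> * ?B + \<kappa> * ?C)"
    by (simp only: distrib_left add.assoc mult.left_commute)
  then show "\<alpha> * (cutoff_deriv T' T (snd z) * ?A + cutoff T' T (snd z) * ?B) + \<kappa> * (cutoff T' T (snd z) * ?C)
    = \<alpha> * (cutoff_deriv T' T (snd z) * ?A)"
    unfolding C by simp
qed

lemma right_flux_exponential_sum:
  assumes q: "right_flux \<alpha> \<kappa> l m T (\<lambda>t. 0) h u q"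
    and bc: "\<And>i. i \<in> I \<Longrightarrow> X i l = 0" "\<And>i. i \<in> I \<Longrightarrow> X i m = 1"
  shows "q (\<lambda>t. cutoff T' T t * (\<Sum>i\<in>I. d i * exp (- (s i * t)))) =
    (LINT p|space_time l m T. u p * (\<alpha> * (cutoff_deriv T' T (snd p) *
       (\<Sum>i\<in>I. d i * (exp (- (s i * snd p)) * X i (fst p))))))
    - \<kappa> * (LINT t|time_interval T. h t * (cutoff T' T t * (\<Sum>i\<in>I. d i * (exp (- (s i * t)) * X' i m))))"
proof -
  have "(\<forall>t\<in>{0..T}. cutoff T' T (snd (l, t)) * (\<Sum>i\<in>I. d i * (exp (- (s i * snd (l, t))) * X i (fst (l, t)))) = 0)"
    by (simp add: bc)
  note q[unfolded right_flux_def, rule_format, OF test_function_exponential_sum[OF T' X X' X''], OF this[rule_format]]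
  then show ?thesis
    unfolding adjoint_pairing_exponential_sum by (simp add: bc)
qed

lemma left_trace_exponential_sum:
  assumes g: "left_trace \<alpha> \<kappa> l m T q (\<lambda>t. 0) u g"
    and bc: "\<And>i. i \<in> I \<Longrightarrow> X i l = 1" "\<And>i. i \<in> I \<Longrightarrow> X i m = 0"
  shows "(LINT p|space_time l m T. u p * (\<alpha> * (cutoff_deriv T' T (snd p) *
       (\<Sum>i\<in>I. d i * (exp (- (s i * snd p)) * X i (fst p))))))
    = - q (\<lambda>t. cutoff T' T t * (\<Sum>i\<in>I. d i * exp (- (s i * t))))
    - \<kappa> * (LINT t|time_interval T. g t * (cutoff T' T t * (\<Sum>i\<in>I. d i * (exp (- (s i * t)) * X' i l))))"
proof -
  have "(\<forall>t\<in>{0..T}. cutoff T' T (snd (m, t)) * (\<Sum>i\<in>I. d i * (exp (- (s i * snd (m, t))) * X i (fst (m, t)))) = 0)"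
    by (simp add: bc)
  note g[unfolded left_trace_def, THEN conjunct2, rule_format, OF test_function_exponential_sum[OF T' X X' X''], OF this[rule_format]]
  then show ?thesis
    unfolding adjoint_pairing_exponential_sum by (simp add: bc)
qed

end

context
  fixes a b T \<alpha>1 \<alpha>2 \<kappa>1 \<kappa>2 \<theta> :: real
  assumes pos: "a > 0" "b > 0" "\<alpha>1 > 0" "\<kappa>1 > 0" "\<alpha>2 > 0" "\<kappa>2 > 0"
begin

abbreviation (input) real_symbol :: "real \<Rightarrow> real" where
  "real_symbol \<equiv> real_dnwr_symbol a b \<alpha>1 \<kappa>1 \<alpha>2 \<kappa>2 \<theta>"

text \<open>
  This is where the factor \<open>sqrt ((\<alpha>1 * \<kappa>1) / (\<alpha>2 * \<kappa>2))\<close> of the symbol comes from.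
\<close>

lemma interface_flux_ratio:
  assumes "s > 0"
  shows "\<kappa>1 * sqrt (\<alpha>1 * s / \<kappa>1) / sqrt (\<alpha>2 * s / \<kappa>2) = \<kappa>2 * sqrt ((\<alpha>1 * \<kappa>1) / (\<alpha>2 * \<kappa>2))"
proof (rule power2_eq_imp_eq)
  show "(\<kappa>1 * sqrt (\<alpha>1 * s / \<kappa>1) / sqrt (\<alpha>2 * s / \<kappa>2))\<^sup>2 = (\<kappa>2 * sqrt ((\<alpha>1 * \<kappa>1) / (\<alpha>2 * \<kappa>2)))\<^sup>2"
    using pos assms by (simp add: power_divide power_mult_distrib) (simp add: field_simps power2_eq_square)
qed (use pos assms in auto)

text \<open>
  The weights \<open>G i\<close> normalise the Neumann side: with them \<open>- \<partial>\<^sub>x\<close> of the test function in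
  the right domain has the trace \<open>\<eta> t * (\<Sum>i. c i * exp (- s i t))\<close>, where \<open>\<eta>\<close> is the cutoff.
  The two test functions agree at the interface, so the unknown flux functional \<open>q\<close> is evaluated at
  the same argument in both domains and cancels. Up to the two cutoff terms, each exponential moment
  of \<open>h'\<close> is that of \<open>h\<close> multiplied by the symbol.
\<close>

lemma dnwr_step_exponential_moments:
  fixes s c :: "'i \<Rightarrow> real"
  assumes sol: "right_flux \<alpha>1 \<kappa>1 (-a) 0 T (\<lambda>t. 0) h u1 q" "left_trace \<alpha>2 \<kappa>2 0 b T q (\<lambda>t. 0) u2 g"
    and ae: "AE t in time_interval T. h' t = (1 - \<theta>) * h t + \<theta> * g t"
    and h: "square_integrable (time_interval T) h" "h' \<in> borel_measurable (time_interval T)"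
    and T': "T' < T" and s: "\<forall>i\<in>I. s i > 0"
  defines "G \<equiv> \<lambda>i. tanh (sqrt (\<alpha>2 * s i / \<kappa>2) * b) / sqrt (\<alpha>2 * s i / \<kappa>2)"
  shows "(LINT t|time_interval T. h' t * (cutoff T' T t * (\<Sum>i\<in>I. c i * exp (- (s i * t)))))
      - (LINT t|time_interval T. h t * (cutoff T' T t * (\<Sum>i\<in>I. c i * real_symbol (s i) * exp (- (s i * t)))))
    = \<theta> / \<kappa>2 *
      ((LINT p|space_time (-a) 0 T. u1 p * (\<alpha>1 * (cutoff_deriv T' T (snd p) * (\<Sum>i\<in>I. c i * G i * (exp (- (s i * snd p)) *
          (sinh (sqrt (\<alpha>1 * s i / \<kappa>1) * (fst p + a)) / sinh (sqrt (\<alpha>1 * s i / \<kappa>1) * a)))))))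
      + (LINT p|space_time 0 b T. u2 p * (\<alpha>2 * (cutoff_deriv T' T (snd p) * (\<Sum>i\<in>I. c i * G i * (exp (- (s i * snd p)) *
          (sinh (sqrt (\<alpha>2 * s i / \<kappa>2) * (b - fst p)) / sinh (sqrt (\<alpha>2 * s i / \<kappa>2) * b))))))))"
    (is "?H' - ?H = \<theta> / \<kappa>2 * (?A1 + ?A2)")
proof -
  define p1 where "p1 i = sqrt (\<alpha>1 * s i / \<kappa>1)" for i
  define p2 where "p2 i = sqrt (\<alpha>2 * s i / \<kappa>2)" for i
  have p: "p1 i > 0" "p2 i > 0" "\<kappa>1 * (p1 i)\<^sup>2 = \<alpha>1 * s i" "\<kappa>2 * (p2 i)\<^sup>2 = \<alpha>2 * s i"
    "sinh (p1 i * a) > 0" "sinh (p2 i * b) > 0" "cosh (p2 i * b) > 0" if "i \<in> I" for i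
    using s that pos by (auto simp: p1_def p2_def)
  define S where "S = sqrt ((\<alpha>1 * \<kappa>1) / (\<alpha>2 * \<kappa>2))"
  define R where "R i = S * coth (p1 i * a) * tanh (p2 i * b)" for i
  define X1 where "X1 i x = sinh (p1 i * (x + a)) / sinh (p1 i * a)" for i x
  define X1' where "X1' i x = p1 i * cosh (p1 i * (x + a)) / sinh (p1 i * a)" for i x
  define X1'' where "X1'' i x = (p1 i)\<^sup>2 * sinh (p1 i * (x + a)) / sinh (p1 i * a)" for i x
  define X2 where "X2 i x = sinh (p2 i * (b - x)) / sinh (p2 i * b)" for i x
  define X2' where "X2' i x = - (p2 i * cosh (p2 i * (b - x))) / sinh (p2 i * b)" for i x
  define X2'' where "X2'' i x = (p2 i)\<^sup>2 * sinh (p2 i * (b - x)) / sinh (p2 i * b)" for i x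
  have D1: "(X1 i has_real_derivative X1' i x) (at x)" "(X1' i has_real_derivative X1'' i x) (at x)" for i x
    unfolding X1_def[abs_def] X1'_def[abs_def] X1''_def
    by (rule DERIV_cdivide; auto intro!: derivative_eq_intros simp: power2_eq_square)+
  have D2: "(X2 i has_real_derivative X2' i x) (at x)" "(X2' i has_real_derivative X2'' i x) (at x)" for i x
    unfolding X2_def[abs_def] X2'_def[abs_def] X2''_def
    by (rule DERIV_cdivide; auto intro!: derivative_eq_intros simp: power2_eq_square)+
  have C: "continuous_on UNIV (X1'' i)" "continuous_on UNIV (X2'' i)" for i
    unfolding X1''_def[abs_def] X2''_def[abs_def] divide_inverse by (intro continuous_intros)+
  have E1: "\<kappa>1 * X1'' i x = \<alpha>1 * s i * X1 i x" if "i \<in> I" for i x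
    unfolding X1''_def X1_def p(3)[OF that, symmetric] by simp
  have E2: "\<kappa>2 * X2'' i x = \<alpha>2 * s i * X2 i x" if "i \<in> I" for i x
    unfolding X2''_def X2_def p(4)[OF that, symmetric] by simp
  have flux: "q (\<lambda>t. cutoff T' T t * (\<Sum>i\<in>I. c i * G i * exp (- (s i * t)))) =
      (LINT p|space_time (-a) 0 T. u1 p * (\<alpha>1 * (cutoff_deriv T' T (snd p) *
        (\<Sum>i\<in>I. c i * G i * (exp (- (s i * snd p)) * X1 i (fst p))))))
      - \<kappa>1 * (LINT t|time_interval T. h t * (cutoff T' T t * (\<Sum>i\<in>I. c i * G i * (exp (- (s i * t)) * X1' i 0))))"
    by (rule right_flux_exponential_sum[OF T' D1 C(1) E1 sol(1)]) (use p in \<open>auto simp: X1_def less_imp_neq[symmetric]\<close>)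
  have trace: "(LINT p|space_time 0 b T. u2 p * (\<alpha>2 * (cutoff_deriv T' T (snd p) *
        (\<Sum>i\<in>I. c i * G i * (exp (- (s i * snd p)) * X2 i (fst p))))))
    = - q (\<lambda>t. cutoff T' T t * (\<Sum>i\<in>I. c i * G i * exp (- (s i * t))))
      - \<kappa>2 * (LINT t|time_interval T. g t * (cutoff T' T t * (\<Sum>i\<in>I. c i * G i * (exp (- (s i * t)) * X2' i 0))))"
    by (rule left_trace_exponential_sum[OF T' D2 C(2) E2 sol(2)]) (use p in \<open>auto simp: X2_def less_imp_neq[symmetric]\<close>)
  define w where "w t = cutoff T' T t * (\<Sum>i\<in>I. c i * exp (- (s i * t)))" for t
  define v where "v t = cutoff T' T t * (\<Sum>i\<in>I. c i * R i * exp (- (s i * t)))" for t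
  have d1: "c i * G i * (e * X1' i 0) = \<kappa>2 / \<kappa>1 * (c i * R i * e)" if "i \<in> I" for i e
  proof -
    have "\<kappa>1 * p1 i / p2 i = \<kappa>2 * S"
      unfolding p1_def p2_def S_def by (rule interface_flux_ratio) (use s that in auto)
    then have "p1 i / p2 i = \<kappa>2 / \<kappa>1 * S" using pos by (simp add: field_simps)
    moreover have "c i * G i * (e * X1' i 0) = (p1 i / p2 i) * (c i * (coth (p1 i * a) * tanh (p2 i * b)) * e)"
      unfolding G_def X1'_def p2_def[symmetric] coth_def by simp
    ultimately show ?thesis by (simp add: R_def)
  qed
  have d2: "c i * G i * (e * X2' i 0) = - (c i * e)" if "i \<in> I" for i e
    unfolding G_def X2'_def p2_def[symmetric] tanh_def using p[OF that] pos by simp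
  have "(\<lambda>t. cutoff T' T t * (\<Sum>i\<in>I. c i * G i * (exp (- (s i * t)) * X1' i 0))) = (\<lambda>t. \<kappa>2 / \<kappa>1 * v t)"
    by (simp add: d1 v_def sum_distrib_left[symmetric] del: times_divide_eq_left) (simp only: mult.left_commute)
  moreover have "(LINT t|time_interval T. h t * (\<kappa>2 / \<kappa>1 * v t)) = \<kappa>2 / \<kappa>1 * (LINT t|time_interval T. h t * v t)"
    by (subst mult.left_commute) simp
  ultimately have flux': "\<kappa>1 * (LINT t|time_interval T. h t * (cutoff T' T t * (\<Sum>i\<in>I. c i * G i * (exp (- (s i * t)) * X1' i 0))))
    = \<kappa>2 * (LINT t|time_interval T. h t * v t)"
    using pos by (simp add: fun_eq_iff)
  have "(\<lambda>t. cutoff T' T t * (\<Sum>i\<in>I. c i * G i * (exp (- (s i * t)) * X2' i 0))) = (\<lambda>t. - w t)"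
    by (simp add: d2 w_def sum_negf)
  then have trace': "(LINT t|time_interval T. g t * (cutoff T' T t * (\<Sum>i\<in>I. c i * G i * (exp (- (s i * t)) * X2' i 0))))
    = - (LINT t|time_interval T. g t * w t)"
    by (simp add: fun_eq_iff)
  have g: "square_integrable (time_interval T) g" using sol(2) by (simp add: left_trace_def)
  have cw: "continuous_on {0..T} w" and cv: "continuous_on {0..T} v"
    unfolding w_def[abs_def] v_def[abs_def] by (intro continuous_intros continuous_on_cutoff)+
  note int = square_integrable_mult_continuous[OF h(1) cw] square_integrable_mult_continuous[OF h(1) cv]
    square_integrable_mult_continuous[OF g cw]
  have [measurable]: "w \<in> borel_measurable (time_interval T)" "h \<in> borel_measurable (time_interval T)"
    "h' \<in> borel_measurable (time_interval T)" "g \<in> borel_measurable (time_interval T)"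
    using continuous_imp_L2_time_interval[OF cw] h g by (auto simp: square_integrable_def)
  have "(LINT t|time_interval T. h' t * w t) = (LINT t|time_interval T. (1 - \<theta>) * (h t * w t) + \<theta> * (g t * w t))"
  proof (rule integral_cong_AE)
    show "AE t in time_interval T. h' t * w t = (1 - \<theta>) * (h t * w t) + \<theta> * (g t * w t)"
      using ae
    proof eventually_elim
      case (elim t)
      show ?case unfolding elim by (simp add: algebra_simps)
    qed
  qed measurable
  then have 1: "?H' = (1 - \<theta>) * (LINT t|time_interval T. h t * w t) + \<theta> * (LINT t|time_interval T. g t * w t)"
    using int unfolding w_def[symmetric] by simp
  have "cutoff T' T t * (\<Sum>i\<in>I. c i * real_symbol (s i) * exp (- (s i * t))) = (1 - \<theta>) * w t - \<theta> * v t" for t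
  proof -
    have "(\<Sum>i\<in>I. c i * real_symbol (s i) * exp (- (s i * t))) =
        (\<Sum>i\<in>I. (1 - \<theta>) * (c i * exp (- (s i * t))) - \<theta> * (c i * R i * exp (- (s i * t))))"
      by (intro sum.cong refl) (simp add: real_dnwr_symbol_def R_def p1_def p2_def S_def algebra_simps)
    also have "\<dots> = (1 - \<theta>) * (\<Sum>i\<in>I. c i * exp (- (s i * t))) - \<theta> * (\<Sum>i\<in>I. c i * R i * exp (- (s i * t)))"
      by (simp only: sum_subtractf sum_distrib_left)
    finally show ?thesis by (simp only: w_def v_def right_diff_distrib mult.left_commute)
  qed
  then have "?H = (LINT t|time_interval T. (1 - \<theta>) * (h t * w t) - \<theta> * (h t * v t))"
    by (simp add: right_diff_distrib mult.left_commute)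
  then have 2: "?H = (1 - \<theta>) * (LINT t|time_interval T. h t * w t) - \<theta> * (LINT t|time_interval T. h t * v t)"
    using int by simp
  have "\<kappa>2 * (LINT t|time_interval T. g t * w t) = ?A1 + ?A2 - \<kappa>2 * (LINT t|time_interval T. h t * v t)"
    using flux trace unfolding flux' trace' X1_def X2_def p1_def p2_def by simp
  then have 3: "(LINT t|time_interval T. g t * w t) = (?A1 + ?A2) / \<kappa>2 - (LINT t|time_interval T. h t * v t)"
    using pos by (simp add: field_simps)
  have "(1 - \<theta>) * x + \<theta> * (y / \<kappa>2 - z) - ((1 - \<theta>) * x - \<theta> * z) = \<theta> / \<kappa>2 * y" for x y z
    by (simp add: algebra_simps)
  then show ?thesis unfolding 1 2 3 .
qed

text \<open>
  On \<open>t \<ge> T'\<close> the factor \<open>exp (- (r + \<sigma> i) T')\<close> is moved into the coefficients. What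
  remains is a profile with \<open>\<tau> = t - T' \<ge> 0\<close>, to which \<open>heat_profile_sum_bound\<close> applies uniformly
  in \<open>\<tau>\<close>. The Cauchy form on the right is, up to the factor \<open>exp (- 2 r T')\<close>, the squared norm of
  \<open>\<Sum>i. c i * exp (- \<sigma> i t)\<close> over \<open>t > T'\<close>.
\<close>

lemma dnwr_step_defect_bound:
  assumes step: "dnwr_step a b T \<alpha>1 \<kappa>1 \<alpha>2 \<kappa>2 \<theta> h h'"
    and h: "square_integrable (time_interval T) h"
    and T': "T' < T" and r: "r > 0"
  obtains C where "C \<ge> 0"
    "\<And>I (\<sigma> :: 'i \<Rightarrow> real) c. \<lbrakk>finite I; \<forall>i\<in>I. \<sigma> i > 0\<rbrakk> \<Longrightarrow>
      \<bar>(LINT t|time_interval T. h' t * (cutoff T' T t * (\<Sum>i\<in>I. c i * exp (- ((r + \<sigma> i) * t)))))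
      - (LINT t|time_interval T. h t * (cutoff T' T t * (\<Sum>i\<in>I. c i * real_symbol (r + \<sigma> i) * exp (- ((r + \<sigma> i) * t)))))\<bar>
      \<le> C * sqrt (cauchy_form I \<sigma> (\<lambda>i. c i * exp (- ((r + \<sigma> i) * T'))))"
proof -
  obtain u1 q u2 g where
    u1: "square_integrable (space_time (-a) 0 T) u1" and q: "right_flux \<alpha>1 \<kappa>1 (-a) 0 T (\<lambda>t. 0) h u1 q" and
    u2: "square_integrable (space_time 0 b T) u2" and g: "left_trace \<alpha>2 \<kappa>2 0 b T q (\<lambda>t. 0) u2 g" and
    ae: "AE t in time_interval T. h' t = (1 - \<theta>) * h t + \<theta> * g t"
    using step by (auto simp: dnwr_step_def dirichlet_solution_def neumann_dirichlet_solution_def)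
  have h': "h' \<in> borel_measurable (time_interval T)"
    using dnwr_step_square_integrable[OF step h] by (simp add: square_integrable_def)
  define K where "K = (\<lambda>\<alpha> l m u. (\<alpha> * (2 / (T - T'))) * (LINT p|space_time l m T. \<bar>u p\<bar> * \<bar>fst p\<bar> powr (-1/4)))"
  have K0: "0 \<le> K \<alpha> l m u" if "\<alpha> > 0" for \<alpha> l m u
    unfolding K_def using that T' by (intro mult_nonneg_nonneg integral_nonneg_AE) auto
  obtain C1 where C1: "C1 \<ge> 0" and b1: "\<And>I (\<sigma> :: 'i \<Rightarrow> real) c \<tau> y. \<lbrakk>finite I; \<forall>i\<in>I. \<sigma> i > 0; 0 < y; y < a; 0 \<le> \<tau>\<rbrakk> \<Longrightarrow>
      \<bar>\<Sum>i\<in>I. c i * (exp (- ((r + \<sigma> i) * \<tau>)) *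
        (sinh (sqrt (\<alpha>1 * (r + \<sigma> i) / \<kappa>1) * y) / sinh (sqrt (\<alpha>1 * (r + \<sigma> i) / \<kappa>1) * a) *
        (tanh (sqrt (\<alpha>2 * (r + \<sigma> i) / \<kappa>2) * b) / sqrt (\<alpha>2 * (r + \<sigma> i) / \<kappa>2))))\<bar>
      \<le> C1 * (a - y) powr (-1/4) * sqrt (cauchy_form I \<sigma> c)"
    using heat_profile_sum_bound[OF pos(3,4,1,5,6,2) r, where ?'i = 'i] by blast
  obtain C2 where C2: "C2 \<ge> 0" and b2: "\<And>I (\<sigma> :: 'i \<Rightarrow> real) c \<tau> y. \<lbrakk>finite I; \<forall>i\<in>I. \<sigma> i > 0; 0 < y; y < b; 0 \<le> \<tau>\<rbrakk> \<Longrightarrow>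
      \<bar>\<Sum>i\<in>I. c i * (exp (- ((r + \<sigma> i) * \<tau>)) *
        (sinh (sqrt (\<alpha>2 * (r + \<sigma> i) / \<kappa>2) * y) / sinh (sqrt (\<alpha>2 * (r + \<sigma> i) / \<kappa>2) * b) *
        (tanh (sqrt (\<alpha>2 * (r + \<sigma> i) / \<kappa>2) * b) / sqrt (\<alpha>2 * (r + \<sigma> i) / \<kappa>2))))\<bar>
      \<le> C2 * (b - y) powr (-1/4) * sqrt (cauchy_form I \<sigma> c)"
    using heat_profile_sum_bound[OF pos(5,6,2,5,6,2) r, where ?'i = 'i] by blast
  \<comment> \<open>Shared by both domains; \<open>Z\<close> stands for the spatial profile at a fixed point.\<close>
  have weighted: "\<bar>\<alpha> * (cutoff_deriv T' T t * (\<Sum>i\<in>I. c i * G i * (exp (- ((r + \<sigma> i) * t)) * Z i)))\<bar>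
      \<le> \<alpha> * (2 / (T - T')) * B"
    if \<alpha>: "\<alpha> > 0" and t: "t < T" and B: "0 \<le> B"
      and bd: "T' \<le> t \<Longrightarrow> \<bar>\<Sum>i\<in>I. (c i * exp (- ((r + \<sigma> i) * T'))) * (exp (- ((r + \<sigma> i) * (t - T'))) * (Z i * G i))\<bar> \<le> B"
    for \<alpha> t B and I :: "'i set" and c G \<sigma> Z
  proof (cases "T' \<le> t")
    case True
    have "(\<Sum>i\<in>I. c i * G i * (exp (- ((r + \<sigma> i) * t)) * Z i)) =
      (\<Sum>i\<in>I. (c i * exp (- ((r + \<sigma> i) * T'))) * (exp (- ((r + \<sigma> i) * (t - T'))) * (Z i * G i)))"
    proof (intro sum.cong refl)
      fix i
      have "exp (- ((r + \<sigma> i) * t)) = exp (- ((r + \<sigma> i) * T')) * exp (- ((r + \<sigma> i) * (t - T')))"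
        by (simp add: exp_add[symmetric] algebra_simps)
      then show "c i * G i * (exp (- ((r + \<sigma> i) * t)) * Z i) =
        (c i * exp (- ((r + \<sigma> i) * T'))) * (exp (- ((r + \<sigma> i) * (t - T'))) * (Z i * G i))" by simp
    qed
    then have "\<bar>\<Sum>i\<in>I. c i * G i * (exp (- ((r + \<sigma> i) * t)) * Z i)\<bar> \<le> B" using bd[OF True] by simp
    then show ?thesis
      unfolding abs_mult using \<alpha> t cutoff_bounds(3)[OF T', of t] T'
      by (simp only: mult.assoc abs_of_pos) (intro mult_left_mono mult_mono, auto)
  next
    case False
    then show ?thesis using \<alpha> T' B by (simp add: cutoff_simps)
  qed
  show thesis
  proof
    show "0 \<le> \<bar>\<theta> / \<kappa>2\<bar> * (K \<alpha>1 (-a) 0 u1 * C1 + K \<alpha>2 0 b u2 * C2)"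
      using C1 C2 K0 pos by simp
    fix I and \<sigma> c :: "'i \<Rightarrow> real"
    assume I: "finite I" "\<forall>i\<in>I. \<sigma> i > 0"
    define Q where "Q = sqrt (cauchy_form I \<sigma> (\<lambda>i. c i * exp (- ((r + \<sigma> i) * T'))))"
    have Q0: "Q \<ge> 0" unfolding Q_def using cauchy_form_nonneg[OF I] by simp
    define G where "G i = tanh (sqrt (\<alpha>2 * (r + \<sigma> i) / \<kappa>2) * b) / sqrt (\<alpha>2 * (r + \<sigma> i) / \<kappa>2)" for i
    let ?\<Psi>1 = "\<lambda>p. \<alpha>1 * (cutoff_deriv T' T (snd p) * (\<Sum>i\<in>I. c i * G i * (exp (- ((r + \<sigma> i) * snd p)) *
          (sinh (sqrt (\<alpha>1 * (r + \<sigma> i) / \<kappa>1) * (fst p + a)) / sinh (sqrt (\<alpha>1 * (r + \<sigma> i) / \<kappa>1) * a)))))"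
    let ?\<Psi>2 = "\<lambda>p. \<alpha>2 * (cutoff_deriv T' T (snd p) * (\<Sum>i\<in>I. c i * G i * (exp (- ((r + \<sigma> i) * snd p)) *
          (sinh (sqrt (\<alpha>2 * (r + \<sigma> i) / \<kappa>2) * (b - fst p)) / sinh (sqrt (\<alpha>2 * (r + \<sigma> i) / \<kappa>2) * b)))))"
    have A1: "\<bar>LINT p|space_time (-a) 0 T. u1 p * ?\<Psi>1 p\<bar> \<le>
        (\<alpha>1 * (2 / (T - T')) * (C1 * Q)) * (LINT p|space_time (-a) 0 T. \<bar>u1 p\<bar> * \<bar>fst p\<bar> powr (-1/4))"
    proof (rule abs_integral_singular_weight_le[OF u1])
      show "0 \<le> \<alpha>1 * (2 / (T - T')) * (C1 * Q)" using pos T' C1 Q0 by simp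
      fix x t :: real assume x: "-a < x" "x < 0" and t: "0 < t" "t < T"
      have e: "a - (x + a) = \<bar>x\<bar>" and pre: "0 < x + a" "x + a < a" using x by auto
      have "\<bar>?\<Psi>1 (x, t)\<bar> \<le> \<alpha>1 * (2 / (T - T')) * (C1 * \<bar>x\<bar> powr (-1/4) * Q)"
        unfolding fst_conv snd_conv
      proof (rule weighted[where I = I and c = c and G = G and \<sigma> = \<sigma> and B = "C1 * \<bar>x\<bar> powr (-1/4) * Q"
          and Z = "\<lambda>i. sinh (sqrt (\<alpha>1 * (r + \<sigma> i) / \<kappa>1) * (x + a)) / sinh (sqrt (\<alpha>1 * (r + \<sigma> i) / \<kappa>1) * a)", OF pos(3) t(2)])
        show "0 \<le> C1 * \<bar>x\<bar> powr (-1/4) * Q" using C1 Q0 by simp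
        assume "T' \<le> t"
        then show "\<bar>\<Sum>i\<in>I. (c i * exp (- ((r + \<sigma> i) * T'))) * (exp (- ((r + \<sigma> i) * (t - T'))) *
          (sinh (sqrt (\<alpha>1 * (r + \<sigma> i) / \<kappa>1) * (x + a)) / sinh (sqrt (\<alpha>1 * (r + \<sigma> i) / \<kappa>1) * a) * G i))\<bar>
          \<le> C1 * \<bar>x\<bar> powr (-1/4) * Q"
          unfolding G_def Q_def
          by (intro b1[OF I, of "x + a" "t - T'" "\<lambda>i. c i * exp (- ((r + \<sigma> i) * T'))", unfolded e] pre) simp
      qed
      then show "\<bar>?\<Psi>1 (x, t)\<bar> \<le> \<alpha>1 * (2 / (T - T')) * (C1 * Q) * \<bar>x\<bar> powr (-1/4)" by (simp only: mult_ac)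
    qed
    have A2: "\<bar>LINT p|space_time 0 b T. u2 p * ?\<Psi>2 p\<bar> \<le>
        (\<alpha>2 * (2 / (T - T')) * (C2 * Q)) * (LINT p|space_time 0 b T. \<bar>u2 p\<bar> * \<bar>fst p\<bar> powr (-1/4))"
    proof (rule abs_integral_singular_weight_le[OF u2])
      show "0 \<le> \<alpha>2 * (2 / (T - T')) * (C2 * Q)" using pos T' C2 Q0 by simp
      fix x t :: real assume x: "0 < x" "x < b" and t: "0 < t" "t < T"
      have e: "b - (b - x) = \<bar>x\<bar>" and pre: "0 < b - x" "b - x < b" using x by auto
      have "\<bar>?\<Psi>2 (x, t)\<bar> \<le> \<alpha>2 * (2 / (T - T')) * (C2 * \<bar>x\<bar> powr (-1/4) * Q)"
        unfolding fst_conv snd_conv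
      proof (rule weighted[where I = I and c = c and G = G and \<sigma> = \<sigma> and B = "C2 * \<bar>x\<bar> powr (-1/4) * Q"
          and Z = "\<lambda>i. sinh (sqrt (\<alpha>2 * (r + \<sigma> i) / \<kappa>2) * (b - x)) / sinh (sqrt (\<alpha>2 * (r + \<sigma> i) / \<kappa>2) * b)", OF pos(5) t(2)])
        show "0 \<le> C2 * \<bar>x\<bar> powr (-1/4) * Q" using C2 Q0 by simp
        assume "T' \<le> t"
        then show "\<bar>\<Sum>i\<in>I. (c i * exp (- ((r + \<sigma> i) * T'))) * (exp (- ((r + \<sigma> i) * (t - T'))) *
          (sinh (sqrt (\<alpha>2 * (r + \<sigma> i) / \<kappa>2) * (b - x)) / sinh (sqrt (\<alpha>2 * (r + \<sigma> i) / \<kappa>2) * b) * G i))\<bar>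
          \<le> C2 * \<bar>x\<bar> powr (-1/4) * Q"
          unfolding G_def Q_def
          by (intro b2[OF I, of "b - x" "t - T'" "\<lambda>i. c i * exp (- ((r + \<sigma> i) * T'))", unfolded e] pre) simp
      qed
      then show "\<bar>?\<Psi>2 (x, t)\<bar> \<le> \<alpha>2 * (2 / (T - T')) * (C2 * Q) * \<bar>x\<bar> powr (-1/4)" by (simp only: mult_ac)
    qed
    have s: "\<forall>i\<in>I. r + \<sigma> i > 0" using I r by (auto intro: add_pos_pos)
    have "\<bar>(LINT t|time_interval T. h' t * (cutoff T' T t * (\<Sum>i\<in>I. c i * exp (- ((r + \<sigma> i) * t)))))
      - (LINT t|time_interval T. h t * (cutoff T' T t * (\<Sum>i\<in>I. c i * real_symbol (r + \<sigma> i) * exp (- ((r + \<sigma> i) * t)))))\<bar>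
      = \<bar>\<theta> / \<kappa>2\<bar> * \<bar>(LINT p|space_time (-a) 0 T. u1 p * ?\<Psi>1 p) + (LINT p|space_time 0 b T. u2 p * ?\<Psi>2 p)\<bar>"
      unfolding dnwr_step_exponential_moments[OF q g ae h h' T' s] G_def by (rule abs_mult)
    also have "\<dots> \<le> \<bar>\<theta> / \<kappa>2\<bar> * (K \<alpha>1 (-a) 0 u1 * C1 * Q + K \<alpha>2 0 b u2 * C2 * Q)"
      using A1 A2 unfolding K_def
      by (intro mult_left_mono order_trans[OF abs_triangle_ineq] add_mono) (simp_all add: mult_ac)
    finally show "\<bar>(LINT t|time_interval T. h' t * (cutoff T' T t * (\<Sum>i\<in>I. c i * exp (- ((r + \<sigma> i) * t)))))
      - (LINT t|time_interval T. h t * (cutoff T' T t * (\<Sum>i\<in>I. c i * real_symbol (r + \<sigma> i) * exp (- ((r + \<sigma> i) * t)))))\<bar>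
      \<le> \<bar>\<theta> / \<kappa>2\<bar> * (K \<alpha>1 (-a) 0 u1 * C1 + K \<alpha>2 0 b u2 * C2) * sqrt (cauchy_form I \<sigma> (\<lambda>i. c i * exp (- ((r + \<sigma> i) * T'))))"
      unfolding Q_def[symmetric] by (simp only: distrib_right mult.assoc)
  qed
qed

end

section \<open>Approximation by exponential sums and duality\<close>

lemma exponential_sum_square_has_integral:
  fixes c \<sigma> :: "'i \<Rightarrow> real"
  assumes "finite I" "\<forall>i\<in>I. \<sigma> i > 0"
  shows "((\<lambda>t. (\<Sum>i\<in>I. c i * exp (- (\<sigma> i * t)))\<^sup>2) has_integral cauchy_form I \<sigma> c) {0..}"
proof -
  have "((\<lambda>t. \<Sum>i\<in>I. \<Sum>j\<in>I. c i * c j * exp (- (\<sigma> i + \<sigma> j) * t)) has_integral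
      (\<Sum>i\<in>I. \<Sum>j\<in>I. c i * c j * (exp (- (\<sigma> i + \<sigma> j) * 0) / (\<sigma> i + \<sigma> j)))) {0..}"
    using assms by (intro has_integral_sum has_integral_mult_right has_integral_exp_minus_to_infinity)
      (auto intro: add_pos_pos)
  moreover have "(\<Sum>i\<in>I. \<Sum>j\<in>I. c i * c j * exp (- (\<sigma> i + \<sigma> j) * t)) = (\<Sum>i\<in>I. c i * exp (- (\<sigma> i * t)))\<^sup>2" for t
    unfolding power2_eq_square sum_product
    by (intro sum.cong refl) (simp add: exp_add[symmetric] algebra_simps)
  ultimately show ?thesis by (simp add: cauchy_form_def)
qed

lemma exp_neg_has_integral: "((\<lambda>t::real. exp (- t)) has_integral 1) {0..}"
  using has_integral_exp_minus_to_infinity[of 1 0] by simp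

lemma cauchy_form_le_of_uniform_approximation:
  fixes c \<sigma> :: "'i \<Rightarrow> real" and f :: "real \<Rightarrow> real"
  assumes I: "finite I" "\<forall>i\<in>I. \<sigma> i > 0"
    and f: "continuous_on {0..T} f" "\<And>t. t \<ge> T \<Longrightarrow> f t = 0" "\<And>t. t \<ge> 0 \<Longrightarrow> \<bar>f t\<bar> \<le> B"
    and approx: "\<And>t. t \<ge> 0 \<Longrightarrow> \<bar>(\<Sum>i\<in>I. c i * exp (- (\<sigma> i * t))) - f t\<bar> \<le> \<epsilon> * exp (- t)"
  shows "cauchy_form I \<sigma> c \<le> integral {0..T} (\<lambda>t. (f t)\<^sup>2) + (2 * B * \<epsilon> + \<epsilon>\<^sup>2)"
proof (rule has_integral_le)
  show "((\<lambda>t. (\<Sum>i\<in>I. c i * exp (- (\<sigma> i * t)))\<^sup>2) has_integral cauchy_form I \<sigma> c) {0..}"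
    by (rule exponential_sum_square_has_integral[OF I])
  have "((\<lambda>t. (f t)\<^sup>2) has_integral integral {0..T} (\<lambda>t. (f t)\<^sup>2)) {0..T}"
    by (intro integrable_integral integrable_continuous_interval continuous_intros f)
  then have "((\<lambda>t. if 0 \<le> t then (f t)\<^sup>2 else 0) has_integral integral {0..T} (\<lambda>t. (f t)\<^sup>2)) {0..T}"
    by (rule has_integral_eq[rotated]) simp
  then have "((\<lambda>t. if 0 \<le> t then (f t)\<^sup>2 else 0) has_integral integral {0..T} (\<lambda>t. (f t)\<^sup>2)) {0..}"
    by (rule has_integral_on_superset) (use f(2) in auto)
  then have "((\<lambda>t. (f t)\<^sup>2) has_integral integral {0..T} (\<lambda>t. (f t)\<^sup>2)) {0..}"
    by (rule has_integral_eq[rotated]) simp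
  then show "((\<lambda>t. (f t)\<^sup>2 + (2 * B * \<epsilon> + \<epsilon>\<^sup>2) * exp (- t)) has_integral
      integral {0..T} (\<lambda>t. (f t)\<^sup>2) + (2 * B * \<epsilon> + \<epsilon>\<^sup>2)) {0..}"
    using has_integral_add[OF _ has_integral_mult_right[OF exp_neg_has_integral, of "2 * B * \<epsilon> + \<epsilon>\<^sup>2"]] by simp
  fix t :: real assume "t \<in> {0..}"
  then have t: "t \<ge> 0" by simp
  let ?e = "\<Sum>i\<in>I. c i * exp (- (\<sigma> i * t))"
  have B0: "B \<ge> 0" using f(3)[OF t] by linarith
  have \<epsilon>0: "\<epsilon> \<ge> 0" using order_trans[OF abs_ge_zero approx[OF t]] by (simp add: zero_le_mult_iff)
  have "\<bar>?e\<bar> \<le> \<bar>f t\<bar> + \<epsilon> * exp (- t)" using approx[OF t] by linarith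
  then have "?e\<^sup>2 \<le> (\<bar>f t\<bar> + \<epsilon> * exp (- t))\<^sup>2" unfolding abs_le_square_iff[symmetric] by (rule order_trans[OF _ abs_ge_self])
  also have "\<dots> = (f t)\<^sup>2 + (2 * \<bar>f t\<bar> * \<epsilon> * exp (- t) + \<epsilon>\<^sup>2 * (exp (- t))\<^sup>2)"
    by (simp add: power2_eq_square algebra_simps)
  also have "\<dots> \<le> (f t)\<^sup>2 + (2 * B * \<epsilon> * exp (- t) + \<epsilon>\<^sup>2 * exp (- t))"
  proof -
    have "(exp (- t))\<^sup>2 \<le> exp (- t)" using t by (simp add: power2_eq_square mult_left_le)
    then show ?thesis
      using f(3)[OF t] \<epsilon>0 by (intro add_left_mono add_mono mult_right_mono mult_left_mono) auto
  qed
  finally show "?e\<^sup>2 \<le> (f t)\<^sup>2 + (2 * B * \<epsilon> + \<epsilon>\<^sup>2) * exp (- t)"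
    by (simp only: distrib_right)
qed

text \<open>
  The form is the squared norm of \<open>exp (- r T') * (\<Sum>i\<in>I. c i * exp (- \<sigma> i (t + T')))\<close> in \<open>t > 0\<close>, so
  it sees only the tail of the exponential sum beyond \<open>T'\<close>.
\<close>

lemma cauchy_form_tail_le:
  fixes c \<sigma> :: "'i \<Rightarrow> real"
  assumes I: "finite I" "\<forall>i\<in>I. \<sigma> i > 0" and r: "r \<ge> 0" and T': "T' \<ge> 0"
    and tail: "\<And>t. t \<ge> T' \<Longrightarrow> \<bar>\<Sum>i\<in>I. c i * exp (- (\<sigma> i * t))\<bar> \<le> \<epsilon> * exp (- t)"
  shows "cauchy_form I \<sigma> (\<lambda>i. c i * exp (- ((r + \<sigma> i) * T'))) \<le> \<epsilon>\<^sup>2"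
proof (rule has_integral_le)
  show "((\<lambda>t. (\<Sum>i\<in>I. c i * exp (- ((r + \<sigma> i) * T')) * exp (- (\<sigma> i * t)))\<^sup>2) has_integral
      cauchy_form I \<sigma> (\<lambda>i. c i * exp (- ((r + \<sigma> i) * T')))) {0..}"
    by (rule exponential_sum_square_has_integral[OF I])
  show "((\<lambda>t. \<epsilon>\<^sup>2 * exp (- t)) has_integral \<epsilon>\<^sup>2) {0..}"
    using has_integral_mult_right[OF exp_neg_has_integral, of "\<epsilon>\<^sup>2"] by simp
  fix t :: real assume "t \<in> {0..}"
  then have t: "t \<ge> 0" by simp
  let ?E = "\<Sum>i\<in>I. c i * exp (- (\<sigma> i * (t + T')))"
  have e: "(\<Sum>i\<in>I. c i * exp (- ((r + \<sigma> i) * T')) * exp (- (\<sigma> i * t))) = exp (- (r * T')) * ?E"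
    unfolding sum_distrib_left by (intro sum.cong refl) (simp add: exp_add[symmetric] algebra_simps)
  have "\<bar>exp (- (r * T')) * ?E\<bar> \<le> 1 * (\<epsilon> * exp (- (t + T')))"
    unfolding abs_mult using tail[of "t + T'"] t r T' by (intro mult_mono) auto
  then have "(exp (- (r * T')) * ?E)\<^sup>2 \<le> (\<epsilon> * exp (- (t + T')))\<^sup>2"
    unfolding abs_le_square_iff[symmetric] mult_1 by (rule order_trans[OF _ abs_ge_self])
  also have "\<dots> = \<epsilon>\<^sup>2 * exp (- (2 * (t + T')))"
    by (simp add: power_mult_distrib power2_eq_square[of "exp _"] exp_add[symmetric])
  also have "\<dots> \<le> \<epsilon>\<^sup>2 * exp (- t)" using t T' by (intro mult_left_mono) auto
  finally show "(\<Sum>i\<in>I. c i * exp (- ((r + \<sigma> i) * T')) * exp (- (\<sigma> i * t)))\<^sup>2 \<le> \<epsilon>\<^sup>2 * exp (- t)"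
    unfolding e .
qed

text \<open>
  Weierstrass' theorem on \<open>[0,1]\<close> for \<open>F y = f (- ln y) / y\<close>, extended by \<open>0\<close> near \<open>y = 0\<close>. The
  division by \<open>y\<close> yields the error factor \<open>exp (- t)\<close> and makes all exponents positive.
\<close>

lemma exponential_sum_approximation:
  fixes f :: "real \<Rightarrow> real"
  assumes f: "continuous_on UNIV f" "\<And>t. t \<ge> T' \<Longrightarrow> f t = 0" and T': "T' \<ge> 0" and \<epsilon>: "\<epsilon> > 0"
  obtains n :: nat and c :: "nat \<Rightarrow> real" where
    "\<And>t. t \<ge> 0 \<Longrightarrow> \<bar>(\<Sum>i\<le>n. c i * exp (- (real (Suc i) * t))) - f t\<bar> \<le> \<epsilon> * exp (- t)"
proof -
  define F where "F y = (if y \<le> exp (- T') then 0 else f (- ln y) / y)" for y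
  have "continuous_on ({0..exp (-T')} \<union> {exp (-T')..1}) F"
    unfolding F_def
  proof (rule continuous_on_cases)
    show "continuous_on {exp (- T')..1} (\<lambda>y. f (- ln y) / y)"
    proof (intro continuous_on_divide continuous_on_compose2[OF f(1)] continuous_intros)
      show "\<forall>y\<in>{exp (- T')..1}. y \<noteq> 0" by (metis atLeastAtMost_iff exp_gt_zero less_le_trans less_irrefl)
    qed auto
    show "\<forall>y. y \<in> {0..exp (- T')} \<and> \<not> y \<le> exp (- T') \<or> y \<in> {exp (- T')..1} \<and> y \<le> exp (- T') \<longrightarrow> 0 = f (- ln y) / y"
    proof (intro allI impI)
      fix y assume "y \<in> {0..exp (- T')} \<and> \<not> y \<le> exp (- T') \<or> y \<in> {exp (- T')..1} \<and> y \<le> exp (- T')"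
      then have "y = exp (- T')" by auto
      then show "0 = f (- ln y) / y" by (simp add: f(2))
    qed
  qed auto
  moreover have "{0..exp (-T')} \<union> {exp (-T')..1} = {0..1::real}"
    by (rule ivl_disj_un_two_touch(4)) (use T' in auto)
  ultimately have "continuous_on {0..1} F" by simp
  then obtain g where g: "real_polynomial_function g" "\<And>y. y \<in> {0..1} \<Longrightarrow> \<bar>F y - g y\<bar> < \<epsilon>"
    using Stone_Weierstrass_real_polynomial_function[of "{0..1::real}" F \<epsilon>] \<epsilon> by auto
  then obtain c n where gs: "g = (\<lambda>y. \<Sum>i\<le>n. c i * y ^ i)"
    unfolding real_polynomial_function_iff_sum by auto
  show thesis
  proof
    fix t :: real assume t: "t \<ge> 0"
    have "f t = exp (- t) * F (exp (- t))"
    proof (cases "t \<ge> T'")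
      case True
      then show ?thesis by (simp add: F_def f(2))
    next
      case False
      then show ?thesis by (simp add: F_def)
    qed
    moreover have "(\<Sum>i\<le>n. c i * exp (- (real (Suc i) * t))) = exp (- t) * g (exp (- t))"
      unfolding gs sum_distrib_left
      by (intro sum.cong refl) (simp add: exp_of_nat_mult[symmetric] exp_add[symmetric] algebra_simps)
    ultimately have "\<bar>(\<Sum>i\<le>n. c i * exp (- (real (Suc i) * t))) - f t\<bar> = exp (- t) * \<bar>F (exp (- t)) - g (exp (- t))\<bar>"
      by (simp add: right_diff_distrib[symmetric] abs_mult abs_minus_commute)
    also have "\<dots> \<le> exp (- t) * \<epsilon>" using g(2)[of "exp (- t)"] t by (intro mult_left_mono) auto
    finally show "\<bar>(\<Sum>i\<le>n. c i * exp (- (real (Suc i) * t))) - f t\<bar> \<le> \<epsilon> * exp (- t)"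
      by (simp only: mult.commute)
  qed
qed

lemma integral_time_interval_continuous:
  fixes f :: "real \<Rightarrow> real"
  assumes "continuous_on {0..T} f"
  shows "(LINT t|time_interval T. f t) = integral {0..T} f"
proof -
  have "(LINT t|time_interval T. f t) = integral {0<..<T} f"
    using continuous_imp_L2_time_interval(2)[OF assms] by (intro lebesgue_integral_eq_integral) auto
  also have "\<dots> = integral {0..T} f"
    using integral_open_interval_real[of 0 T f] by simp
  finally show ?thesis .
qed

text \<open>
  Duality with a dense class. Truncating \<open>v\<close> at height \<open>m\<close> makes dominated convergence available: a
  measurable function is almost everywhere a limit of continuous functions, and clamping these and
  cutting them off near \<open>T\<close> gives admissible test functions converging to the truncation \<open>w\<close>. Then
  \<open>\<integral> w\<^sup>2 \<le> \<integral> v w \<le> K * sqrt (\<integral> w\<^sup>2)\<close>, and \<open>m\<close> tends to infinity.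
\<close>

lemma L2_norm_le_of_test_functions:
  fixes v :: "real \<Rightarrow> real"
  assumes v: "square_integrable (time_interval T) v" and T: "T > 0" and K: "K \<ge> 0"
    and test: "\<And>f T'. \<lbrakk>continuous_on UNIV f; 0 < T'; T' < T; \<And>t. t \<ge> T' \<Longrightarrow> f t = 0\<rbrakk> \<Longrightarrow>
      \<bar>LINT t|time_interval T. v t * f t\<bar> \<le> K * sqrt (LINT t|time_interval T. (f t)\<^sup>2)"
  shows "L2_norm (time_interval T) v \<le> K"
proof -
  have vm[measurable]: "v \<in> borel_measurable (time_interval T)" and v2: "integrable (time_interval T) (\<lambda>t. (v t)\<^sup>2)"
    using v by (auto simp: square_integrable_def)
  have v1: "integrable (time_interval T) v"
    using square_integrable_mult_continuous[OF v, of "\<lambda>t. 1"] by simp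
  interpret fm: finite_measure "time_interval T" by (rule finite_measure_lebesgue_on) simp
  obtain N g where N: "negligible N" and g: "\<And>n. continuous_on UNIV (g n)"
    and lim: "\<And>t. t \<notin> N \<Longrightarrow> (\<lambda>n. g n t) \<longlonglongrightarrow> (if t \<in> {0<..<T} then v t else 0)"
    using vm measurable_on_iff_borel_measurable[of "{0<..<T}" v] unfolding measurable_on_def by auto
  have aeN: "AE t in time_interval T. t \<notin> N"
    using N by (subst AE_restrict_space_iff) (auto intro: AE_mp[OF AE_not_in] simp: negligible_iff_null_sets)
  define cl where "cl = (\<lambda>(m::nat) (y::real). max (- real m) (min (real m) y))"
  have cl_cont: "continuous_on UNIV (cl m)" for m unfolding cl_def by (intro continuous_intros)
  have cl_bd: "\<bar>cl m y\<bar> \<le> real m" for m y unfolding cl_def by (auto simp: max_def min_def)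
  have cl_sq: "(cl m y)\<^sup>2 \<le> y * cl m y" "(cl m y)\<^sup>2 \<le> y\<^sup>2" for m y
  proof -
    have *: "\<bar>cl m y\<bar> \<le> \<bar>y\<bar>" "0 \<le> y * cl m y"
      unfolding cl_def by (auto simp: max_def min_def zero_le_mult_iff)
    then have "\<bar>cl m y\<bar> * \<bar>cl m y\<bar> \<le> \<bar>y\<bar> * \<bar>cl m y\<bar>" by (intro mult_right_mono) auto
    then show "(cl m y)\<^sup>2 \<le> y * cl m y" using *(2) by (simp add: power2_eq_square abs_mult[symmetric])
    show "(cl m y)\<^sup>2 \<le> y\<^sup>2" using *(1) by (simp add: abs_le_square_iff)
  qed
  have [measurable]: "(\<lambda>t. cl m (v t)) \<in> borel_measurable (time_interval T)" for m
    unfolding cl_def by measurable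
  \<comment> \<open>Zero from \<open>T - 1 / (n + 1)\<close> on, and tending to \<open>1\<close> at every time before \<open>T\<close>.\<close>
  define z where "z = (\<lambda>(n::nat) t. max 0 (min 1 (real (Suc n) * (T - t) - 1)))"
  have z_bd: "\<bar>z n t\<bar> \<le> 1" for n t unfolding z_def by auto
  have z_cont: "continuous_on UNIV (z n)" for n unfolding z_def by (intro continuous_intros)
  have z_lim: "(\<lambda>n. z n t) \<longlonglongrightarrow> 1" if "t < T" for t
  proof (rule tendsto_eventually)
    obtain n0 :: nat where n0: "2 / (T - t) \<le> real n0" using real_arch_simple by blast
    show "\<forall>\<^sub>F n in sequentially. z n t = 1"
      using eventually_ge_at_top[of n0]
    proof eventually_elim
      case (elim n)
      have "2 / (T - t) \<le> real (Suc n)" using n0 elim by linarith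
      then have "2 \<le> real (Suc n) * (T - t)" using that by (simp add: field_simps)
      then show ?case unfolding z_def by simp
    qed
  qed
  have clamped: "sqrt (LINT t|time_interval T. (cl m (v t))\<^sup>2) \<le> K" for m
  proof -
    define f where "f n t = z n t * cl m (g n t)" for n t
    have f_cont: "continuous_on UNIV (f n)" for n
      unfolding f_def[abs_def]
      by (intro continuous_intros z_cont continuous_on_compose2[OF cl_cont g]) auto
    have f_bd: "\<bar>f n t\<bar> \<le> real m" for n t
      unfolding f_def abs_mult using mult_mono[OF z_bd cl_bd] by simp
    have f_meas[measurable]: "f n \<in> borel_measurable (time_interval T)" for n
      using f_cont by (intro continuous_imp_L2_time_interval(1)) (rule continuous_on_subset, auto)
    have f_lim: "AE t in time_interval T. (\<lambda>n. f n t) \<longlonglongrightarrow> cl m (v t)"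
      using aeN AE_space
    proof eventually_elim
      case (elim t)
      then have t: "t \<in> {0<..<T}" "t \<notin> N" by (auto simp: space_restrict_space)
      have "(\<lambda>n. cl m (g n t)) \<longlonglongrightarrow> cl m (v t)"
        using continuous_on_tendsto_compose[OF cl_cont lim[OF t(2)]] t by simp
      then have "(\<lambda>n. z n t * cl m (g n t)) \<longlonglongrightarrow> 1 * cl m (v t)"
        using t by (intro tendsto_mult z_lim) auto
      then show ?case by (simp add: f_def)
    qed
    have 1: "(\<lambda>n. LINT t|time_interval T. v t * f n t) \<longlonglongrightarrow> (LINT t|time_interval T. v t * cl m (v t))"
    proof (rule integral_dominated_convergence[where w = "\<lambda>t. real m * \<bar>v t\<bar>"])
      show "AE t in time_interval T. (\<lambda>n. v t * f n t) \<longlonglongrightarrow> v t * cl m (v t)"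
        using f_lim by eventually_elim (intro tendsto_intros)
      show "AE t in time_interval T. norm (v t * f n t) \<le> real m * \<bar>v t\<bar>" for n
        using f_bd by (intro AE_I2) (simp add: abs_mult mult.commute[of "real m"] mult_left_mono)
      show "integrable (time_interval T) (\<lambda>t. real m * \<bar>v t\<bar>)"
        using v1 by (intro integrable_mult_right integrable_abs)
    qed measurable
    have 2: "(\<lambda>n. LINT t|time_interval T. (f n t)\<^sup>2) \<longlonglongrightarrow> (LINT t|time_interval T. (cl m (v t))\<^sup>2)"
    proof (rule integral_dominated_convergence[where w = "\<lambda>t. (real m)\<^sup>2"])
      show "AE t in time_interval T. (\<lambda>n. (f n t)\<^sup>2) \<longlonglongrightarrow> (cl m (v t))\<^sup>2"
        using f_lim by eventually_elim (intro tendsto_intros)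
      show "AE t in time_interval T. norm ((f n t)\<^sup>2) \<le> (real m)\<^sup>2" for n
        using f_bd[of n] by (intro AE_I2) (simp add: abs_le_square_iff[symmetric])
      show "(\<lambda>t. (cl m (v t))\<^sup>2) \<in> borel_measurable (time_interval T)" by (intro borel_measurable_power) measurable
      show "(\<lambda>t. (f n t)\<^sup>2) \<in> borel_measurable (time_interval T)" for n by (intro borel_measurable_power f_meas)
      show "integrable (time_interval T) (\<lambda>t. (real m)\<^sup>2)" by simp
    qed
    have tst: "\<bar>LINT t|time_interval T. v t * f n t\<bar> \<le> K * sqrt (LINT t|time_interval T. (f n t)\<^sup>2)" for n
    proof (rule test[OF f_cont])
      let ?T' = "max (T / 2) (T - 1 / real (Suc n))"
      show "0 < ?T'" "?T' < T" using T by auto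
      fix t assume "t \<ge> ?T'"
      then have "T - t \<le> 1 / real (Suc n)" by simp
      then have "real (Suc n) * (T - t) \<le> real (Suc n) * (1 / real (Suc n))" by (intro mult_left_mono) auto
      then have "real (Suc n) * (T - t) - 1 \<le> 0" by simp
      then show "f n t = 0" unfolding f_def z_def by simp
    qed
    have "(LINT t|time_interval T. v t * cl m (v t)) \<le> K * sqrt (LINT t|time_interval T. (cl m (v t))\<^sup>2)"
      by (rule LIMSEQ_le[OF 1 tendsto_mult[OF tendsto_const tendsto_real_sqrt[OF 2]]])
        (use tst abs_le_D1 in blast)
    moreover have "(LINT t|time_interval T. (cl m (v t))\<^sup>2) \<le> (LINT t|time_interval T. v t * cl m (v t))"
    proof (rule integral_mono)
      show "integrable (time_interval T) (\<lambda>t. (cl m (v t))\<^sup>2)"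
        by (rule Bochner_Integration.integrable_bound[OF v2]) (use cl_sq in auto)
      show "integrable (time_interval T) (\<lambda>t. v t * cl m (v t))"
        by (rule Bochner_Integration.integrable_bound[OF integrable_mult_right[OF integrable_abs[OF v1], of "real m"]])
          (auto intro!: AE_I2 mult_left_mono simp: abs_mult mult.commute[of "real m"] cl_bd)
    qed (rule cl_sq)
    ultimately have a: "(LINT t|time_interval T. (cl m (v t))\<^sup>2) \<le> K * sqrt (LINT t|time_interval T. (cl m (v t))\<^sup>2)"
      by linarith
    let ?s = "sqrt (LINT t|time_interval T. (cl m (v t))\<^sup>2)"
    have s0: "?s \<ge> 0" by (intro real_sqrt_ge_zero integral_nonneg_AE) auto
    have "?s * ?s \<le> K * ?s" using a by (simp add: integral_nonneg_AE)
    show ?thesis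
    proof (cases "?s = 0")
      case True
      then show ?thesis using K by simp
    next
      case False
      then have "0 < ?s" using s0 by linarith
      with \<open>?s * ?s \<le> K * ?s\<close> show ?thesis by (rule mult_right_le_imp_le)
    qed
  qed
  have "(\<lambda>m. LINT t|time_interval T. (cl m (v t))\<^sup>2) \<longlonglongrightarrow> (LINT t|time_interval T. (v t)\<^sup>2)"
  proof (rule integral_dominated_convergence[where w = "\<lambda>t. (v t)\<^sup>2"])
    show "AE t in time_interval T. (\<lambda>m. (cl m (v t))\<^sup>2) \<longlonglongrightarrow> (v t)\<^sup>2"
    proof (rule AE_I2, rule tendsto_eventually)
      fix t
      obtain m0 :: nat where m0: "\<bar>v t\<bar> \<le> real m0" using real_arch_simple by blast
      show "\<forall>\<^sub>F m in sequentially. (cl m (v t))\<^sup>2 = (v t)\<^sup>2"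
        using eventually_ge_at_top[of m0]
      proof eventually_elim
        case (elim m)
        then have "\<bar>v t\<bar> \<le> real m" using m0 by linarith
        then show ?case unfolding cl_def by (simp add: max_def min_def abs_le_iff)
      qed
    qed
  qed (use cl_sq v2 in auto)
  then have "(\<lambda>m. sqrt (LINT t|time_interval T. (cl m (v t))\<^sup>2)) \<longlonglongrightarrow> L2_norm (time_interval T) v"
    unfolding L2_norm_def by (rule tendsto_real_sqrt)
  then show ?thesis by (rule LIMSEQ_le_const2) (use clamped in blast)
qed

text \<open>
  Passing to the weighted norm costs nothing, passing back costs \<open>exp (r * T)\<close>.
\<close>

lemma square_integrable_exp_weight:
  assumes "square_integrable (time_interval T) h" "r \<ge> 0"
  shows "square_integrable (time_interval T) (\<lambda>t. exp (- (r * t)) * h t)"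
    and "L2_norm (time_interval T) (\<lambda>t. exp (- (r * t)) * h t) \<le> L2_norm (time_interval T) h"
    and "L2_norm (time_interval T) h \<le> exp (r * T) * L2_norm (time_interval T) (\<lambda>t. exp (- (r * t)) * h t)"
proof -
  have hm: "h \<in> borel_measurable (time_interval T)" and h2: "integrable (time_interval T) (\<lambda>t. (h t)\<^sup>2)"
    using assms by (auto simp: square_integrable_def)
  have wm: "(\<lambda>t. exp (- (r * t))) \<in> borel_measurable (time_interval T)"
    by (rule continuous_imp_L2_time_interval(1)) (intro continuous_intros)
  have m[measurable]: "(\<lambda>t. exp (- (r * t)) * h t) \<in> borel_measurable (time_interval T)"
    using wm hm by (rule borel_measurable_times)
  have le: "(exp (- (r * t)) * h t)\<^sup>2 \<le> (h t)\<^sup>2" if "t \<in> space (time_interval T)" for t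
  proof -
    have "exp (- (r * t)) \<le> 1" using that assms(2) by (auto simp: space_restrict_space)
    then have "(exp (- (r * t)))\<^sup>2 \<le> 1" by (simp add: power_le_one)
    then show ?thesis by (simp add: power_mult_distrib mult_left_le_one_le)
  qed
  have i: "integrable (time_interval T) (\<lambda>t. (exp (- (r * t)) * h t)\<^sup>2)"
    by (rule Bochner_Integration.integrable_bound[OF h2]) (use le in \<open>auto intro!: AE_I2\<close>)
  show "square_integrable (time_interval T) (\<lambda>t. exp (- (r * t)) * h t)"
    using m i by (simp add: square_integrable_def)
  show "L2_norm (time_interval T) (\<lambda>t. exp (- (r * t)) * h t) \<le> L2_norm (time_interval T) h"
    unfolding L2_norm_def using i h2 le by (intro real_sqrt_le_mono integral_mono) auto
  have "(LINT t|time_interval T. (h t)\<^sup>2) \<le> (LINT t|time_interval T. (exp (r * T))\<^sup>2 * (exp (- (r * t)) * h t)\<^sup>2)"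
  proof (rule integral_mono[OF h2])
    show "integrable (time_interval T) (\<lambda>t. (exp (r * T))\<^sup>2 * (exp (- (r * t)) * h t)\<^sup>2)"
      using i by (rule integrable_mult_right)
    fix t assume "t \<in> space (time_interval T)"
    then have "r * t \<le> r * T" using assms(2) by (intro mult_left_mono) (auto simp: space_restrict_space)
    then have "1 \<le> exp (r * T) * exp (- (r * t))" by (simp add: exp_add[symmetric])
    then have "1 \<le> (exp (r * T) * exp (- (r * t)))\<^sup>2" by (rule one_le_power)
    then have "(h t)\<^sup>2 \<le> (exp (r * T) * exp (- (r * t)))\<^sup>2 * (h t)\<^sup>2"
      by (simp add: mult_le_cancel_right1)
    then show "(h t)\<^sup>2 \<le> (exp (r * T))\<^sup>2 * (exp (- (r * t)) * h t)\<^sup>2"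
      by (simp only: power_mult_distrib mult.assoc)
  qed
  then have "sqrt (LINT t|time_interval T. (h t)\<^sup>2) \<le> sqrt ((exp (r * T))\<^sup>2 * (LINT t|time_interval T. (exp (- (r * t)) * h t)\<^sup>2))"
    by (intro real_sqrt_le_mono) simp
  then show "L2_norm (time_interval T) h \<le> exp (r * T) * L2_norm (time_interval T) (\<lambda>t. exp (- (r * t)) * h t)"
    unfolding L2_norm_def by (simp add: real_sqrt_mult)
qed

section \<open>The weighted contraction estimate and the iteration\<close>

context
  fixes a b T \<alpha>1 \<alpha>2 \<kappa>1 \<kappa>2 \<theta> :: real
  assumes pos: "a > 0" "b > 0" "T > 0" "\<alpha>1 > 0" "\<kappa>1 > 0" "\<alpha>2 > 0" "\<kappa>2 > 0"
begin

abbreviation (input) symb :: "complex \<Rightarrow> complex" where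
  "symb \<equiv> dnwr_symbol a b \<alpha>1 \<kappa>1 \<alpha>2 \<kappa>2 \<theta>"

text \<open>
  The test function \<open>f\<close> is replaced by an exponential sum \<open>E\<close>. The main term is bounded by
  Cauchy--Schwarz and the Pick inequality, with the Cauchy form of \<open>E\<close> close to \<open>\<integral> f\<^sup>2\<close>; the defect
  is controlled by the tail of \<open>E\<close>, where \<open>f\<close> vanishes. Both errors disappear with \<open>\<epsilon>\<close>.
\<close>

lemma dnwr_step_weighted_test:
  assumes step: "dnwr_step a b T \<alpha>1 \<kappa>1 \<alpha>2 \<kappa>2 \<theta> h h'"
    and h: "square_integrable (time_interval T) h" and r: "r > 0"
    and M: "\<And>\<omega>. cmod (symb (Complex r \<omega>)) \<le> M"
    and f: "continuous_on UNIV f" and T': "0 < T'" "T' < T" and f0: "\<And>t. t \<ge> T' \<Longrightarrow> f t = 0"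
  shows "\<bar>LINT t|time_interval T. (exp (- (r * t)) * h' t) * f t\<bar> \<le>
    M * L2_norm (time_interval T) (\<lambda>t. exp (- (r * t)) * h t) * sqrt (LINT t|time_interval T. (f t)\<^sup>2)"
proof -
  let ?\<mu> = "time_interval T"
  let ?N = "L2_norm ?\<mu> (\<lambda>t. exp (- (r * t)) * h t)"
  let ?F = "LINT t|?\<mu>. (f t)\<^sup>2"
  define \<eta> where "\<eta> = cutoff T' T"
  have h': "square_integrable ?\<mu> h'" by (rule dnwr_step_square_integrable[OF step h])
  have h'1: "integrable ?\<mu> h'" using square_integrable_mult_continuous[OF h', of "\<lambda>t. 1"] by simp
  note wh = square_integrable_exp_weight(1)[OF h less_imp_le[OF r]]
  have fc: "continuous_on S f" for S using f continuous_on_subset by blast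
  have \<eta>c: "continuous_on S \<eta>" for S unfolding \<eta>_def by (rule continuous_on_cutoff)
  have \<eta>b: "0 \<le> \<eta> t" "\<eta> t \<le> 1" if "t \<in> space ?\<mu>" for t
    using cutoff_bounds[OF T'(2), of t] that by (auto simp: \<eta>_def space_restrict_space)
  have f\<eta>: "f t = \<eta> t * f t" for t
    using f0[of t] cutoff_simps(2)[OF T'(2), of t] by (cases "t \<le> T'") (auto simp: \<eta>_def)
  have M0: "M \<ge> 0" using order_trans[OF norm_ge_zero M] .
  have "bounded (f ` {0..T})" by (intro compact_imp_bounded compact_continuous_image fc) auto
  then obtain B' where B': "\<forall>y\<in>f ` {0..T}. norm y \<le> B'" unfolding bounded_iff by blast
  define B where "B = max 0 B'"
  have B: "\<bar>f t\<bar> \<le> B" if "t \<ge> 0" for t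
    using B' that T' f0[of t] by (cases "t \<le> T") (auto simp: B_def le_max_iff_disj)
  obtain C where C: "C \<ge> 0" and defect: "\<And>I (\<sigma> :: nat \<Rightarrow> real) c. \<lbrakk>finite I; \<forall>i\<in>I. \<sigma> i > 0\<rbrakk> \<Longrightarrow>
      \<bar>(LINT t|?\<mu>. h' t * (\<eta> t * (\<Sum>i\<in>I. c i * exp (- ((r + \<sigma> i) * t)))))
      - (LINT t|?\<mu>. h t * (\<eta> t * (\<Sum>i\<in>I. c i * real_dnwr_symbol a b \<alpha>1 \<kappa>1 \<alpha>2 \<kappa>2 \<theta> (r + \<sigma> i) * exp (- ((r + \<sigma> i) * t)))))\<bar>
      \<le> C * sqrt (cauchy_form I \<sigma> (\<lambda>i. c i * exp (- ((r + \<sigma> i) * T'))))"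
    unfolding \<eta>_def
    using dnwr_step_defect_bound[OF pos(1,2,4-7) step h T'(2) r, where ?'i = nat] by blast
  have main: "\<bar>LINT t|?\<mu>. (exp (- (r * t)) * h' t) * f t\<bar> \<le>
      \<epsilon> * ((LINT t|?\<mu>. \<bar>h' t\<bar>) + C) + ?N * (M * sqrt (?F + (2 * B * \<epsilon> + \<epsilon>\<^sup>2)))"
    if \<epsilon>: "\<epsilon> > 0" for \<epsilon>
  proof -
    obtain n :: nat and c where approx: "\<And>t. t \<ge> 0 \<Longrightarrow> \<bar>(\<Sum>i\<le>n. c i * exp (- (real (Suc i) * t))) - f t\<bar> \<le> \<epsilon> * exp (- t)"
      using exponential_sum_approximation[OF f f0 less_imp_le[OF T'(1)] \<epsilon>] by blast
    define \<sigma> where "\<sigma> i = real (Suc i)" for i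
    define E where "E t = (\<Sum>i\<le>n. c i * exp (- (\<sigma> i * t)))" for t
    define p where "p i = real_dnwr_symbol a b \<alpha>1 \<kappa>1 \<alpha>2 \<kappa>2 \<theta> (r + \<sigma> i)" for i
    define P where "P t = (\<Sum>i\<le>n. c i * p i * exp (- (\<sigma> i * t)))" for t
    have I: "finite {..n}" "\<forall>i\<in>{..n}. \<sigma> i > 0" by (auto simp: \<sigma>_def)
    have ap: "\<bar>E t - f t\<bar> \<le> \<epsilon> * exp (- t)" if "t \<ge> 0" for t
      using approx[OF that] by (simp only: E_def \<sigma>_def)
    have Ec: "continuous_on S E" "continuous_on S P" for S
      unfolding E_def[abs_def] P_def[abs_def] by (intro continuous_intros)+
    have shift: "(\<Sum>i\<le>n. d i * exp (- ((r + \<sigma> i) * t))) = exp (- (r * t)) * (\<Sum>i\<le>n. d i * exp (- (\<sigma> i * t)))" for d t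
      unfolding sum_distrib_left by (intro sum.cong refl) (simp add: exp_add[symmetric] algebra_simps)
    have X: "(LINT t|?\<mu>. h' t * (\<eta> t * (\<Sum>i\<le>n. c i * exp (- ((r + \<sigma> i) * t))))) = (LINT t|?\<mu>. h' t * (\<eta> t * (exp (- (r * t)) * E t)))"
      unfolding shift E_def ..
    have Y: "(LINT t|?\<mu>. h t * (\<eta> t * (\<Sum>i\<le>n. c i * p i * exp (- ((r + \<sigma> i) * t))))) = (LINT t|?\<mu>. (exp (- (r * t)) * h t) * (\<eta> t * P t))"
      unfolding shift P_def by (simp only: mult_ac)
    have "cauchy_form {..n} \<sigma> (\<lambda>i. c i * exp (- ((r + \<sigma> i) * T'))) \<le> \<epsilon>\<^sup>2"
    proof (rule cauchy_form_tail_le[OF I])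
      fix t assume "t \<ge> T'"
      then show "\<bar>\<Sum>i\<le>n. c i * exp (- (\<sigma> i * t))\<bar> \<le> \<epsilon> * exp (- t)"
        using ap[of t] f0[of t] T' by (simp add: E_def)
    qed (use r T' in auto)
    then have "sqrt (cauchy_form {..n} \<sigma> (\<lambda>i. c i * exp (- ((r + \<sigma> i) * T')))) \<le> \<epsilon>"
      using \<epsilon> by (intro real_le_lsqrt) auto
    then have XY: "\<bar>(LINT t|?\<mu>. h' t * (\<eta> t * (exp (- (r * t)) * E t))) - (LINT t|?\<mu>. (exp (- (r * t)) * h t) * (\<eta> t * P t))\<bar> \<le> C * \<epsilon>"
      using defect[OF I, of c] C unfolding X p_def[symmetric] Y by (meson mult_left_mono order_trans)
    have "cauchy_form {..n} \<sigma> c \<le> integral {0..T} (\<lambda>t. (f t)\<^sup>2) + (2 * B * \<epsilon> + \<epsilon>\<^sup>2)"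
      using B ap T' f0 by (intro cauchy_form_le_of_uniform_approximation[OF I fc]) (auto simp: E_def)
    also have "integral {0..T} (\<lambda>t. (f t)\<^sup>2) = ?F"
      by (rule integral_time_interval_continuous[symmetric]) (intro continuous_intros fc)
    finally have Qc: "cauchy_form {..n} \<sigma> c \<le> ?F + (2 * B * \<epsilon> + \<epsilon>\<^sup>2)" .
    have "cauchy_form {..n} \<sigma> (\<lambda>i. c i * p i) \<le> M\<^sup>2 * cauchy_form {..n} \<sigma> c"
    proof -
      obtain D where D: "\<And>s. r \<le> Re s \<Longrightarrow> cmod (symb s) \<le> D"
        using dnwr_symbol_bounded[OF pos(1,2,4-7) r] by blast
      show ?thesis
      proof (rule Pick_inequality[OF I dnwr_symbol_holomorphic[OF pos(1,2,4-7)] r r D M])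
        fix i assume "i \<in> {..n}"
        show "symb (of_real (r + \<sigma> i)) = of_real (p i)"
          unfolding p_def using r by (intro dnwr_symbol_of_real[OF pos(1,2,4-7)]) (simp add: \<sigma>_def)
      qed
    qed
    also have "\<dots> \<le> M\<^sup>2 * (?F + (2 * B * \<epsilon> + \<epsilon>\<^sup>2))" using Qc by (rule mult_left_mono) simp
    finally have Qp: "cauchy_form {..n} \<sigma> (\<lambda>i. c i * p i) \<le> M\<^sup>2 * (?F + (2 * B * \<epsilon> + \<epsilon>\<^sup>2))" .
    have Pint: "((\<lambda>t. (P t)\<^sup>2) has_integral cauchy_form {..n} \<sigma> (\<lambda>i. c i * p i)) {0..}"
      unfolding P_def by (rule exponential_sum_square_has_integral[OF I])
    have "(LINT t|?\<mu>. (\<eta> t * P t)\<^sup>2) \<le> (LINT t|?\<mu>. (P t)\<^sup>2)"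
    proof (rule integral_mono)
      show "integrable ?\<mu> (\<lambda>t. (\<eta> t * P t)\<^sup>2)" "integrable ?\<mu> (\<lambda>t. (P t)\<^sup>2)"
        by (intro continuous_imp_L2_time_interval(3) continuous_intros \<eta>c Ec)+
      fix t assume t: "t \<in> space ?\<mu>"
      have "(\<eta> t)\<^sup>2 \<le> 1" using \<eta>b[OF t] by (simp add: power_le_one)
      then show "(\<eta> t * P t)\<^sup>2 \<le> (P t)\<^sup>2" by (simp add: power_mult_distrib mult_left_le_one_le)
    qed
    also have "\<dots> = integral {0..T} (\<lambda>t. (P t)\<^sup>2)"
      by (intro integral_time_interval_continuous continuous_intros Ec)
    also have "\<dots> \<le> integral {0..} (\<lambda>t. (P t)\<^sup>2)"
      using Pint by (intro integral_subset_le integrable_continuous_interval continuous_intros Ec) (auto simp: has_integral_integrable)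
    also have "\<dots> = cauchy_form {..n} \<sigma> (\<lambda>i. c i * p i)" using Pint by (rule integral_unique)
    also note Qp
    finally have "sqrt (LINT t|?\<mu>. (\<eta> t * P t)\<^sup>2) \<le> sqrt (M\<^sup>2 * (?F + (2 * B * \<epsilon> + \<epsilon>\<^sup>2)))"
      by (rule real_sqrt_le_mono)
    then have sP: "sqrt (LINT t|?\<mu>. (\<eta> t * P t)\<^sup>2) \<le> M * sqrt (?F + (2 * B * \<epsilon> + \<epsilon>\<^sup>2))"
      using M0 by (simp add: real_sqrt_mult)
    have "\<bar>LINT t|?\<mu>. (exp (- (r * t)) * h t) * (\<eta> t * P t)\<bar> \<le> ?N * sqrt (LINT t|?\<mu>. (\<eta> t * P t)\<^sup>2)"
      unfolding L2_norm_def
    proof (rule integral_Cauchy_Schwarz)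
      show "(\<lambda>t. \<eta> t * P t) \<in> borel_measurable ?\<mu>" "integrable ?\<mu> (\<lambda>t. (\<eta> t * P t)\<^sup>2)"
        by (intro continuous_imp_L2_time_interval continuous_intros \<eta>c Ec)+
    qed (use wh in \<open>auto simp: square_integrable_def\<close>)
    also have "\<dots> \<le> ?N * (M * sqrt (?F + (2 * B * \<epsilon> + \<epsilon>\<^sup>2)))"
      using sP by (intro mult_left_mono) (auto simp: L2_norm_def intro!: integral_nonneg_AE)
    finally have Yb: "\<bar>LINT t|?\<mu>. (exp (- (r * t)) * h t) * (\<eta> t * P t)\<bar> \<le> ?N * (M * sqrt (?F + (2 * B * \<epsilon> + \<epsilon>\<^sup>2)))" .
    have i1: "integrable ?\<mu> (\<lambda>t. h' t * (exp (- (r * t)) * f t))"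
      by (intro square_integrable_mult_continuous h' continuous_intros fc)
    have i2: "integrable ?\<mu> (\<lambda>t. h' t * (\<eta> t * (exp (- (r * t)) * E t)))"
      by (intro square_integrable_mult_continuous h' continuous_intros \<eta>c Ec)
    have "\<bar>(LINT t|?\<mu>. h' t * (exp (- (r * t)) * f t)) - (LINT t|?\<mu>. h' t * (\<eta> t * (exp (- (r * t)) * E t)))\<bar>
      = \<bar>LINT t|?\<mu>. h' t * (exp (- (r * t)) * f t) - h' t * (\<eta> t * (exp (- (r * t)) * E t))\<bar>"
      using i1 i2 by simp
    also have "\<dots> \<le> (LINT t|?\<mu>. norm (h' t * (exp (- (r * t)) * f t) - h' t * (\<eta> t * (exp (- (r * t)) * E t))))"
      using integral_norm_bound[of ?\<mu> "\<lambda>t. h' t * (exp (- (r * t)) * f t) - h' t * (\<eta> t * (exp (- (r * t)) * E t))"]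
      by (simp only: real_norm_def)
    also have "\<dots> \<le> (LINT t|?\<mu>. \<epsilon> * \<bar>h' t\<bar>)"
    proof (rule integral_mono)
      show "integrable ?\<mu> (\<lambda>t. norm (h' t * (exp (- (r * t)) * f t) - h' t * (\<eta> t * (exp (- (r * t)) * E t))))"
        using i1 i2 by (intro integrable_norm Bochner_Integration.integrable_diff)
      show "integrable ?\<mu> (\<lambda>t. \<epsilon> * \<bar>h' t\<bar>)" using h'1 by (intro integrable_mult_right integrable_abs)
      fix t assume t: "t \<in> space ?\<mu>"
      then have t0: "t \<ge> 0" by (auto simp: space_restrict_space)
      have e1: "exp (- (r * t)) \<le> 1" "exp (- t) \<le> 1" using r t0 by auto
      have "\<bar>E t - f t\<bar> \<le> \<epsilon>" using ap[OF t0] e1(2) \<epsilon> mult_left_le[of "exp (- t)" \<epsilon>] by linarith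
      then have "\<bar>exp (- (r * t)) * \<eta> t * (f t - E t)\<bar> \<le> 1 * 1 * \<epsilon>"
        unfolding abs_mult using \<eta>b[OF t] e1 \<epsilon> by (intro mult_mono) (auto simp: abs_minus_commute)
      moreover have "h' t * (exp (- (r * t)) * f t) - h' t * (\<eta> t * (exp (- (r * t)) * E t))
        = h' t * (exp (- (r * t)) * \<eta> t * (f t - E t))"
        by (subst f\<eta>) (simp add: algebra_simps)
      ultimately show "norm (h' t * (exp (- (r * t)) * f t) - h' t * (\<eta> t * (exp (- (r * t)) * E t))) \<le> \<epsilon> * \<bar>h' t\<bar>"
        by (simp only: real_norm_def abs_mult[of "h' t"] mult.commute[of \<epsilon>]) (intro mult_left_mono, auto)
    qed
    finally have fE: "\<bar>(LINT t|?\<mu>. h' t * (exp (- (r * t)) * f t)) - (LINT t|?\<mu>. h' t * (\<eta> t * (exp (- (r * t)) * E t)))\<bar>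
      \<le> \<epsilon> * (LINT t|?\<mu>. \<bar>h' t\<bar>)" by simp
    have tri: "\<bar>x\<bar> \<le> p + q + s" if "\<bar>x - y\<bar> \<le> p" "\<bar>y - z\<bar> \<le> q" "\<bar>z\<bar> \<le> s" for x y z p q s :: real
      using that by linarith
    have eq: "(LINT t|?\<mu>. (exp (- (r * t)) * h' t) * f t) = (LINT t|?\<mu>. h' t * (exp (- (r * t)) * f t))"
      by (simp only: mult_ac)
    show ?thesis
      unfolding eq distrib_left mult.commute[of \<epsilon> C] by (rule tri[OF fE XY Yb])
  qed
  have "((\<lambda>\<epsilon>. \<epsilon> * ((LINT t|?\<mu>. \<bar>h' t\<bar>) + C) + ?N * (M * sqrt (?F + (2 * B * \<epsilon> + \<epsilon>\<^sup>2)))) \<longlongrightarrow>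
      0 * ((LINT t|?\<mu>. \<bar>h' t\<bar>) + C) + ?N * (M * sqrt (?F + (2 * B * 0 + 0\<^sup>2)))) (at_right 0)"
    by (intro tendsto_intros)
  moreover have "\<forall>\<^sub>F \<epsilon> in at_right 0. \<bar>LINT t|?\<mu>. (exp (- (r * t)) * h' t) * f t\<bar> \<le>
      \<epsilon> * ((LINT t|?\<mu>. \<bar>h' t\<bar>) + C) + ?N * (M * sqrt (?F + (2 * B * \<epsilon> + \<epsilon>\<^sup>2)))"
    by (rule eventually_mono[OF eventually_at_right_less]) (rule main)
  ultimately have "\<bar>LINT t|?\<mu>. (exp (- (r * t)) * h' t) * f t\<bar> \<le>
      0 * ((LINT t|?\<mu>. \<bar>h' t\<bar>) + C) + ?N * (M * sqrt (?F + (2 * B * 0 + 0\<^sup>2)))"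
    by (rule tendsto_lowerbound) simp
  then show ?thesis by (simp add: mult_ac)
qed

lemma dnwr_step_weighted_contraction:
  assumes "dnwr_step a b T \<alpha>1 \<kappa>1 \<alpha>2 \<kappa>2 \<theta> h h'" "square_integrable (time_interval T) h" "r > 0"
    and M: "\<And>\<omega>. cmod (symb (Complex r \<omega>)) \<le> M"
  shows "L2_norm (time_interval T) (\<lambda>t. exp (- (r * t)) * h' t) \<le>
    M * L2_norm (time_interval T) (\<lambda>t. exp (- (r * t)) * h t)"
proof (rule L2_norm_le_of_test_functions)
  show "square_integrable (time_interval T) (\<lambda>t. exp (- (r * t)) * h' t)"
    using assms by (intro square_integrable_exp_weight(1) dnwr_step_square_integrable[OF assms(1,2)]) simp
  have "0 \<le> M" using order_trans[OF norm_ge_zero M] .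
  then show "0 \<le> M * L2_norm (time_interval T) (\<lambda>t. exp (- (r * t)) * h t)"
    by (auto simp: L2_norm_def intro!: mult_nonneg_nonneg integral_nonneg_AE)
qed (use dnwr_step_weighted_test[OF assms] pos in auto)

lemma dnwr_iterates_L2_bound:
  fixes h :: "nat \<Rightarrow> real \<Rightarrow> real"
  assumes h0: "square_integrable (time_interval T) (h 0)"
    and step: "\<And>n. dnwr_step a b T \<alpha>1 \<kappa>1 \<alpha>2 \<kappa>2 \<theta> (h n) (h (Suc n))"
    and r: "r > 0" and M: "\<And>\<omega>. cmod (symb (Complex r \<omega>)) \<le> M"
  shows "L2_norm (time_interval T) (h k) \<le> exp (r * T) * M ^ k * L2_norm (time_interval T) (h 0)"
proof -
  let ?w = "\<lambda>n. L2_norm (time_interval T) (\<lambda>t. exp (- (r * t)) * h n t)"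
  have sq: "square_integrable (time_interval T) (h n)" for n
    by (induction n) (use h0 dnwr_step_square_integrable[OF step] in auto)
  have M0: "0 \<le> M" using order_trans[OF norm_ge_zero M] .
  have "?w n \<le> M ^ n * ?w 0" for n
  proof (induction n)
    case (Suc n)
    have "?w (Suc n) \<le> M * ?w n" by (rule dnwr_step_weighted_contraction[OF step sq r M])
    also have "\<dots> \<le> M * (M ^ n * ?w 0)" using Suc M0 by (rule mult_left_mono)
    finally show ?case by simp
  qed simp
  then have "exp (r * T) * ?w k \<le> exp (r * T) * (M ^ k * ?w 0)" by (intro mult_left_mono) auto
  also have "\<dots> \<le> exp (r * T) * (M ^ k * L2_norm (time_interval T) (h 0))"
    using r M0 h0 by (intro mult_left_mono square_integrable_exp_weight(2)) auto
  finally show ?thesis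
    using order_trans[OF square_integrable_exp_weight(3)[OF sq less_imp_le[OF r]]] by (simp only: mult.assoc)
qed

end

theorem theorem1:
  fixes a b T \<alpha>1 \<alpha>2 \<kappa>1 \<kappa>2 \<theta> :: real
    and h :: "nat \<Rightarrow> real \<Rightarrow> real" and k :: nat
  assumes "a > 0" "b > 0" "T > 0"
    and "\<alpha>1 > 0" "\<alpha>2 > 0" "\<kappa>1 > 0" "\<kappa>2 > 0"
    and "0 < \<theta>" "\<theta> < 1"
    and "square_integrable (time_interval T) (h 0)"
    and "\<And>n. dnwr_step a b T \<alpha>1 \<kappa>1 \<alpha>2 \<kappa>2 \<theta> (h n) (h (Suc n))"
    and "k \<ge> 1"
  shows "L2_norm (time_interval T) (h k) \<le>
    (INF r\<in>{0<..}. exp (r * T) *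
       (SUP \<omega>. cmod (dnwr_symbol a b \<alpha>1 \<kappa>1 \<alpha>2 \<kappa>2 \<theta> (Complex r \<omega>)) ^ k)) *
    L2_norm (time_interval T) (h 0)"
proof -
  note pos = assms(1,2,4,6,5,7)
  let ?s = "\<lambda>r \<omega>. cmod (dnwr_symbol a b \<alpha>1 \<kappa>1 \<alpha>2 \<kappa>2 \<theta> (Complex r \<omega>))"
  let ?A = "\<lambda>r. exp (r * T) * (SUP \<omega>. ?s r \<omega> ^ k)"
  let ?N = "L2_norm (time_interval T) (h 0)" and ?K = "L2_norm (time_interval T) (h k)"
  have bound: "?K \<le> ?A r * ?N" if r: "r > 0" for r
  proof -
    obtain B where B: "\<And>s. r \<le> Re s \<Longrightarrow> cmod (dnwr_symbol a b \<alpha>1 \<kappa>1 \<alpha>2 \<kappa>2 \<theta> s) \<le> B"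
      using dnwr_symbol_bounded[OF pos r] by blast
    have bdd: "bdd_above (range (\<lambda>\<omega>. ?s r \<omega> ^ k))"
      using B by (intro bdd_aboveI[where M = "B ^ k"]) (auto intro!: power_mono)
    define S where "S = (SUP \<omega>. ?s r \<omega> ^ k)"
    have S: "?s r \<omega> ^ k \<le> S" for \<omega> unfolding S_def using bdd by (rule cSUP_upper2) auto
    have S0: "S \<ge> 0" using order_trans[OF _ S[of 0]] by simp
    have k: "k > 0" using assms by simp
    \<comment> \<open>The supremum of the \<open>k\<close>-th powers is used through its root, which bounds the symbol itself.\<close>
    have "?s r \<omega> \<le> root k S" for \<omega>
      using real_root_le_mono[OF k S[of \<omega>]] by (simp add: real_root_power_cancel[OF k])
    from dnwr_iterates_L2_bound[OF assms(1-4,6,5,7) assms(10,11) r this]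
    have "?K \<le> exp (r * T) * root k S ^ k * ?N" .
    then show ?thesis using S0 k by (simp only: real_root_pow_pos2 S_def[symmetric])
  qed
  have N0: "?N \<ge> 0" by (simp add: L2_norm_def)
  \<comment> \<open>The infimum is compared with \<open>?K / ?N\<close>, so a vanishing initial error is treated apart.\<close>
  show ?thesis
  proof (cases "?N = 0")
    case True
    then show ?thesis using bound[of 1] by simp
  next
    case False
    then have N: "?N > 0" using N0 by simp
    have "?K / ?N \<le> (INF r\<in>{0<..}. ?A r)"
      using bound N by (intro cINF_greatest) (auto simp: field_simps)
    then show ?thesis using N by (simp add: field_simps)
  qed
qed

end
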